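(* Let $m$ and $n$ be non-negative integers. (1) If $n\le m$, then $$\sum_{\mu\in I^{n}_{1}(c_{m})}\delta_{1}(\mu)\,S_{\mu[1]}(t)=S_{\Box(m-n,n)}(2t^{(2)}),$$ where $S_{\nu}(2t^{(2)})$ denotes the polynomial obtained from $S_\nu(t)$ by the substitution $t_j\mapsto 2t_{2j}$ for all $j\ge1$. (2) $$\sum_{\mu\in I^{n}_{0}(c_{-m})}\delta_{0}(\mu)\,Q_{\mu[0]}(s)\,S_{\mu[1]}(t)=\sum_{\mu\in I^{n}_{0}(c_{-m}),\ \mu[0]=\emptyset}\delta_{0}(\mu)\,S_{\mu[1]}(u),$$ where $u=(u_1,u_2,\ldots)$ with $u_j=t_j$ for $j$ even and $u_j=t_j-s_j$ for $j$ odd.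
   Context: $t=(t_1,t_2,t_3,\ldots)$ and $s=(s_1,s_3,s_5,\ldots)$ are families of indeterminates. Schur functions: $\exp\sum_{n\ge1}t_nz^n=\sum_{n\ge0}h_n(t)z^n$, $h_k=0$ for $k<0$, and $S_\lambda(t)=\det(h_{\lambda_i+j-i}(t))$ for a partition $\lambda$ ($S_\emptyset=1$). Schur $Q$-functions: $\exp\sum_{n\ge1}s_{2n-1}z^{2n-1}=\sum_{n\ge0}q_n(s)z^n$. For $a>b\ge0$, $Q_{a,b}=q_aq_b+2\sum_{i=1}^{b}(-1)^iq_{a+i}q_{b-i}$, and $Q_{a,b}=-Q_{b,a}$ for $a\le b$. For a strict partition written as $\lambda=(\lambda_1>\cdots>\lambda_{2k}\ge0)$ (append one zero if the number of positive parts is odd), $Q_\lambda(s)$ is the Pfaffian of $(Q_{\lambda_i,\lambda_j}(s))_{1\le i,j\le 2k}$; $Q_\emptyset=1$. $Q_\lambda$ depends only on the positive parts of $\lambda$. $\Box(m,n)=(n^m)$ is the rectangular partition with $m$ parts equal to $n$ (empty if $m=0$ or $n=0$). Colors: a node in column $j$ of (the Young diagram of) a strict partition has color $a(x)=0$ if $j\equiv0,1\pmod 3$ and color $1$ if $j\equiv2\pmod3$. Set $c_0=\emptyset$, and for $m>0$, $c_m=(3m-2,\ldots,4,1)$, $c_{-m}=(3m-1,\ldots,5,2)$. For $i\in\{0,1\}$, $n\ge 0$ and $r\in\mathbb Z$, $I^n_i(c_r)$ is the set of strict partitions $\mu\supset c_r$ with $|\mu|=|c_r|+n$ such that all nodes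 of $\mu/c_r$ have color $i$. 3-bar quotient: for a strict partition $\lambda$ and $a=0,1,2$, $\lambda^{(a)}$ is the subpartition of parts congruent to $a$ mod 3. $\lambda[0]$ is the strict partition obtained by dividing the positive parts of $\lambda^{(0)}$ by 3 (zero parts are ignored). Let $\ell_1,\ell_2$ be the numbers of parts of $\lambda^{(1)},\lambda^{(2)}$. Fix an integer $k\ge0$ with $k\ge(\lambda^{(2)}_1+1)/3$ when $\lambda^{(2)}\neq\emptyset$. Let $\mathcal M(k,\lambda)=(a_1,\ldots,a_{\ell_1},b_1,\ldots,b_{k-\ell_2})$, where $a_i=(\lambda^{(1)}_i-1)/3$ and $(b_1,\ldots,b_{k-\ell_2})$ is obtained from $(-1,-2,\ldots,-k)$ by deleting the numbers $-(\lambda^{(2)}_i+1)/3$, $1\le i\le\ell_2$. Then $$\lambda[1]=\mathcal M(k,\lambda)-(\ell_1-\ell_2-1,\ \ell_1-\ell_2-2,\ \ldots,\ \ell_1-\ell_2-(k+\ell_1-\ell_2))$$ (componentwise), a partition which up to trailing zeros is independent of $k$. Signs: write a strict partition as $\lambda=(\lambda_1>\cdots>\lambda_{2k}\ge0)$ (appending one part $0$ exactly when the number of positive parts is odd; this $0$ then counts as a part of $\lambda^{(0)}$). Put $f(\lambda)=|\lambda^{(2)}|$ (sum of parts), $g(\lambda)=\sum_{i\ge1}\#\{j\mid\lambda^{(1)}_j>\lambda^{(0)}_i\}$, $h(\lambda)=\ell(\lambda^{(2)})$ (number of parts). For $m\ge0$: $\delta_1(\lambda)=(-1)^{f(\lambda)+\binom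 n2}$ for $\lambda\in I^n_1(c_m)$; for $\lambda\in I^n_0(c_{-m})$, $\delta_0(\lambda)=(-1)^{f(\lambda)+g(\lambda)}$ if $m$ is even and $\delta_0(\lambda)=(-1)^{f(\lambda)+g(\lambda)+h(\lambda)}$ if $m$ is odd. *)

theory Defs
  imports
    "HOL-Computational_Algebra.Formal_Power_Series"
    "HOL-Combinatorics.Permutations"
    "Jordan_Normal_Form.Determinant"
begin

text \<open>
  The families of indeterminates are functions on the natural numbers with values in an arbitrary
  field of characteristic 0, so that an identity stated for all families contains (by taking the
  field of rational functions) the identity of polynomials over the rationals, and is equivalent
  to it. Of \<^term>\<open>t\<close> only the values at positive indices are used, of \<^term>\<open>s\<close> only those at odd
  indices.
\<close>

section \<open>Schur functions\<close>

definition h_fun :: "(nat \<Rightarrow> 'a::field_char_0) \<Rightarrow> int \<Rightarrow> 'a" where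
  "h_fun t k = (if k < 0 then 0 else
     fps_nth (fps_exp 1 oo Abs_fps (\<lambda>n. if n = 0 then 0 else t n)) (nat k))"

definition schur :: "nat list \<Rightarrow> (nat \<Rightarrow> 'a::field_char_0) \<Rightarrow> 'a" where
  "schur \<nu> t = det (mat (length \<nu>) (length \<nu>)
     (\<lambda>(i, j). h_fun t (int (\<nu> ! i) + int j - int i)))"

section \<open>Schur Q-functions\<close>

definition q_fun :: "(nat \<Rightarrow> 'a::field_char_0) \<Rightarrow> nat \<Rightarrow> 'a" where
  "q_fun s k = fps_nth (fps_exp 1 oo Abs_fps (\<lambda>n. if odd n then s n else 0)) k"

definition Q_pos :: "(nat \<Rightarrow> 'a::field_char_0) \<Rightarrow> nat \<Rightarrow> nat \<Rightarrow> 'a" where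
  "Q_pos s a b = q_fun s a * q_fun s b
     + 2 * (\<Sum>i = 1..b. (- 1) ^ i * q_fun s (a + i) * q_fun s (b - i))"

text \<open>On the diagonal the rule \<open>Q\<^bsub>a,b\<^esub> = - Q\<^bsub>b,a\<^esub>\<close> forces the value 0.\<close>

definition Q2 :: "(nat \<Rightarrow> 'a::field_char_0) \<Rightarrow> nat \<Rightarrow> nat \<Rightarrow> 'a" where
  "Q2 s a b = (if a > b then Q_pos s a b else if a < b then - Q_pos s b a else 0)"

text \<open>The Pfaffian of the alternating \<open>2k \<times> 2k\<close> matrix with entries \<open>A i j\<close>, \<open>0 \<le> i, j < 2k\<close>.\<close>

definition pfaffian :: "nat \<Rightarrow> (nat \<Rightarrow> nat \<Rightarrow> 'a::field_char_0) \<Rightarrow> 'a" where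
  "pfaffian k A =
     (\<Sum>\<sigma> | \<sigma> permutes {..<2 * k}.
        of_int (sign \<sigma>) * (\<Prod>i<k. A (\<sigma> (2 * i)) (\<sigma> (2 * i + 1)))) / (2 ^ k * fact k)"

text \<open>Strict partitions are represented by the strictly decreasing list of their positive parts.\<close>

definition strict_partition :: "nat list \<Rightarrow> bool" where
  "strict_partition \<nu> \<longleftrightarrow> sorted_wrt (>) \<nu> \<and> 0 \<notin> set \<nu>"

definition pad_even :: "nat list \<Rightarrow> nat list" where
  "pad_even \<nu> = (if odd (length \<nu>) then \<nu> @ [0] else \<nu>)"

definition schur_Q :: "nat list \<Rightarrow> (nat \<Rightarrow> 'a::field_char_0) \<Rightarrow> 'a" where
  "schur_Q \<nu> s =
     pfaffian (length (pad_even \<nu>) div 2) (\<lambda>i j. Q2 s (pad_even \<nu> ! i) (pad_even \<nu> ! j))"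

section \<open>Rectangles, diagrams and colors\<close>

definition rectangle :: "nat \<Rightarrow> nat \<Rightarrow> nat list" where
  "rectangle m n = (if n = 0 then [] else replicate m n)"

text \<open>Rows are numbered from 0, columns from 1.\<close>

definition diagram :: "nat list \<Rightarrow> (nat \<times> nat) set" where
  "diagram \<nu> = {(i, j). i < length \<nu> \<and> 1 \<le> j \<and> j \<le> \<nu> ! i}"

definition color :: "nat \<times> nat \<Rightarrow> nat" where
  "color x = (if snd x mod 3 = 2 then 1 else 0)"

definition core :: "int \<Rightarrow> nat list" where
  "core r = (if r \<ge> 0 then map (\<lambda>i. 3 * i - 2) (rev [1..<nat r + 1])
             else map (\<lambda>i. 3 * i - 1) (rev [1..<nat (- r) + 1]))"

definition I_set :: "nat \<Rightarrow> nat \<Rightarrow> int \<Rightarrow> nat list set" where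
  "I_set i n r = {\<mu>. strict_partition \<mu> \<and> diagram (core r) \<subseteq> diagram \<mu> \<and>
     sum_list \<mu> = sum_list (core r) + n \<and>
     (\<forall>x \<in> diagram \<mu> - diagram (core r). color x = i)}"

lemma length_le_sum_list: "0 \<notin> set \<mu> \<Longrightarrow> length \<mu> \<le> sum_list (\<mu> :: nat list)"
  by (induction \<mu>) auto

lemma finite_I_set: "finite (I_set i n r)"
proof -
  let ?N = "sum_list (core r) + n"
  have "I_set i n r \<subseteq> {xs. set xs \<subseteq> {..?N} \<and> length xs \<le> ?N}"
  proof
    fix \<mu> assume "\<mu> \<in> I_set i n r"
    then have s: "sum_list \<mu> = ?N" and "0 \<notin> set \<mu>"
      by (auto simp: I_set_def strict_partition_def)
    then show "\<mu> \<in> {xs. set xs \<subseteq> {..?N} \<and> length xs \<le> ?N}"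
      using length_le_sum_list[of \<mu>] member_le_sum_list[of _ \<mu>] by auto
  qed
  then show ?thesis
    using finite_lists_length_le[of "{..?N}" ?N] finite_subset by blast
qed

section \<open>The 3-bar quotient\<close>

definition residue_parts :: "nat \<Rightarrow> nat list \<Rightarrow> nat list" where
  "residue_parts a \<nu> = filter (\<lambda>p. p mod 3 = a) \<nu>"

definition quotient0 :: "nat list \<Rightarrow> nat list" where
  "quotient0 \<nu> = map (\<lambda>p. p div 3) (residue_parts 0 \<nu>)"

definition admissible :: "nat \<Rightarrow> nat list \<Rightarrow> bool" where
  "admissible k \<nu> \<longleftrightarrow> (\<forall>p \<in> set (residue_parts 2 \<nu>). (p + 1) div 3 \<le> k)"

definition maya :: "nat \<Rightarrow> nat list \<Rightarrow> int list" where
  "maya k \<nu> =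
     map (\<lambda>p. (int p - 1) div 3) (residue_parts 1 \<nu>) @
     filter (\<lambda>b. b \<notin> (\<lambda>p. - ((int p + 1) div 3)) ` set (residue_parts 2 \<nu>))
       (map (\<lambda>i. - int i) [1..<k + 1])"

text \<open>Position \<open>i\<close> (counted from 0) of \<^const>\<open>maya\<close> is lowered by \<open>\<ell>\<^sub>1 - \<ell>\<^sub>2 - 1 - i\<close>.\<close>

definition quotient1_int :: "nat \<Rightarrow> nat list \<Rightarrow> int list" where
  "quotient1_int k \<nu> =
     (let d = int (length (residue_parts 1 \<nu>)) - int (length (residue_parts 2 \<nu>))
      in map (\<lambda>i. maya k \<nu> ! i - (d - 1 - int i)) [0..<length (maya k \<nu>)])"

text \<open>
  The entries of \<^const>\<open>quotient1_int\<close> are weakly decreasing and nonnegative, and, after removal of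
  trailing zeros, do not depend on the choice of an admissible \<open>k\<close>; see \<open>quotient1_int_nonneg\<close>,
  \<open>quotient1_int_decreasing\<close> and \<open>quotient1_eq\<close> below. The definition takes the least such \<open>k\<close>.
\<close>

definition quotient1 :: "nat list \<Rightarrow> nat list" where
  "quotient1 \<nu> = map nat (filter (\<lambda>x. x \<noteq> 0) (quotient1_int (LEAST k. admissible k \<nu>) \<nu>))"

lemma admissible_Least: "admissible (LEAST k. admissible k \<nu>) \<nu>"
proof (rule LeastI)
  show "admissible (Max (insert 0 ((\<lambda>p. (p + 1) div 3) ` set (residue_parts 2 \<nu>)))) \<nu>"
    unfolding admissible_def by (intro ballI Max_ge) auto
qed

lemma length_maya:
  assumes "strict_partition \<nu>" "admissible k \<nu>"
  shows "int (length (maya k \<nu>)) =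
    int (length (residue_parts 1 \<nu>)) - int (length (residue_parts 2 \<nu>)) + int k"
proof -
  let ?R = "residue_parts 2 \<nu>"
  let ?f = "\<lambda>p::nat. - ((int p + 1) div 3)"
  let ?B = "map (\<lambda>i. - int i) [1..<k + 1]"
  have "distinct \<nu>"
    using assms(1) unfolding strict_partition_def by (induction \<nu>) auto
  then have dR: "distinct ?R"
    by (simp add: residue_parts_def)
  have "inj_on ?f (set ?R)"
  proof (rule inj_onI)
    fix x y assume "x \<in> set ?R" "y \<in> set ?R" "?f x = ?f y"
    then have "x mod 3 = 2" "y mod 3 = 2" "(int x + 1) div 3 = (int y + 1) div 3"
      by (auto simp: residue_parts_def)
    then show "x = y" by presburger
  qed
  then have card1: "card (?f ` set ?R) = length ?R"
    using dR by (simp add: card_image distinct_card)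
  have sub: "?f ` set ?R \<subseteq> set ?B"
  proof
    fix b assume "b \<in> ?f ` set ?R"
    then obtain p where p: "p \<in> set ?R" "b = ?f p" by auto
    have k: "(p + 1) div 3 \<le> k" using assms(2) p by (auto simp: admissible_def)
    have "p mod 3 = 2" using p by (auto simp: residue_parts_def)
    then have "1 \<le> (p + 1) div 3" by presburger
    moreover have "b = - int ((p + 1) div 3)" using p by (simp add: zdiv_int add.commute)
    ultimately show "b \<in> set ?B" using k by auto
  qed
  have dB: "distinct ?B" by (simp add: distinct_map inj_on_def)
  have cardB: "card (set ?B) = k" using distinct_card[OF dB] by simp
  have "length (filter (\<lambda>b. b \<notin> ?f ` set ?R) ?B) = card (set ?B - ?f ` set ?R)"
    using distinct_card[OF distinct_filter[OF dB, of "\<lambda>b. b \<notin> ?f ` set ?R"]]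
    by (simp add: set_diff_eq)
  also have "\<dots> = card (set ?B) - length ?R"
    using card_Diff_subset[OF _ sub] card1 by simp
  also note cardB
  finally have "length (filter (\<lambda>b. b \<notin> ?f ` set ?R) ?B) = k - length ?R" .
  moreover have "length ?R \<le> k"
    using card_mono[OF _ sub] card1 cardB by simp
  ultimately show ?thesis by (simp add: maya_def)
qed

lemma maya_decreasing:
  assumes "strict_partition \<nu>"
  shows "sorted_wrt (>) (maya k \<nu>)"
proof -
  have "sorted_wrt (>) (residue_parts 1 \<nu>)"
    using assms by (simp add: strict_partition_def residue_parts_def sorted_wrt_filter)
  then have "sorted_wrt (\<lambda>x y. (int x - 1) div 3 > (int y - 1) div 3) (residue_parts 1 \<nu>)"
  proof (rule sorted_wrt_mono_rel[rotated])
    fix x y assume "x \<in> set (residue_parts 1 \<nu>)" "y \<in> set (residue_parts 1 \<nu>)" "x > y"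
    then have "x mod 3 = 1" "y mod 3 = 1" "x > y" by (auto simp: residue_parts_def)
    then show "(int x - 1) div 3 > (int y - 1) div 3" by presburger
  qed
  moreover have "sorted_wrt (>) (map (\<lambda>i. - int i) [1..<k + 1])"
    unfolding sorted_wrt_map using sorted_wrt_upt[of 1 "k + 1"] by simp
  moreover have "(int x - 1) div 3 \<ge> 0" if "x \<in> set (residue_parts 1 \<nu>)" for x
  proof -
    have "x mod 3 = 1" using that by (auto simp: residue_parts_def)
    then show ?thesis by presburger
  qed
  then have "x > b"
    if "x \<in> set (map (\<lambda>p. (int p - 1) div 3) (residue_parts 1 \<nu>))"
      and "b \<in> set (map (\<lambda>i. - int i) [1..<k + 1])" for x b
    using that by force
  ultimately show ?thesis
    unfolding maya_def sorted_wrt_append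
    by (simp add: sorted_wrt_map sorted_wrt_filter)
qed

lemma maya_ge: "b \<in> set (maya k \<nu>) \<Longrightarrow> - int k \<le> b"
proof -
  assume "b \<in> set (maya k \<nu>)"
  moreover have "(int x - 1) div 3 \<ge> 0" if "x \<in> set (residue_parts 1 \<nu>)" for x
  proof -
    have "x mod 3 = 1" using that by (auto simp: residue_parts_def)
    then show ?thesis by presburger
  qed
  ultimately show ?thesis unfolding maya_def by fastforce
qed

lemma quotient1_int_decreasing:
  assumes "strict_partition \<nu>"
  shows "sorted_wrt (\<ge>) (quotient1_int k \<nu>)"
proof -
  have *: "maya k \<nu> ! i + int i \<ge> maya k \<nu> ! j + int j"
    if "i < j" "j < length (maya k \<nu>)" for i j
    using that
  proof (induction j)
    case (Suc j)
    have "maya k \<nu> ! j > maya k \<nu> ! Suc j"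
      using sorted_wrt_nth_less[OF maya_decreasing[OF assms], of j "Suc j"] Suc.prems by simp
    then show ?case using Suc by (cases "i = j") auto
  qed simp
  show ?thesis
    unfolding quotient1_int_def Let_def sorted_wrt_iff_nth_less
  proof (clarsimp, goal_cases)
    case (1 i j)
    then show ?case using *[of i j] by simp
  qed
qed

lemma quotient1_int_nonneg:
  assumes "strict_partition \<nu>" "admissible k \<nu>" "x \<in> set (quotient1_int k \<nu>)"
  shows "x \<ge> 0"
proof -
  let ?q = "quotient1_int k \<nu>" and ?n = "length (maya k \<nu>)"
  have len: "length ?q = ?n" by (simp add: quotient1_int_def)
  from assms(3) obtain i where i: "i < ?n" "x = ?q ! i"
    by (auto simp: in_set_conv_nth len)
  have "?q ! i \<ge> ?q ! (?n - 1)"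
    using sorted_wrt_nth_less[OF quotient1_int_decreasing[OF assms(1)], of i "?n - 1" k] i len
    by (cases "i = ?n - 1") auto
  moreover have "?q ! (?n - 1) = maya k \<nu> ! (?n - 1)
      - (int (length (residue_parts 1 \<nu>)) - int (length (residue_parts 2 \<nu>)) - 1 - int (?n - 1))"
    using i by (simp add: quotient1_int_def Let_def)
  moreover have "int (?n - 1) = int ?n - 1"
    using i by simp
  moreover have "- int k \<le> maya k \<nu> ! (?n - 1)"
    using i maya_ge[of "maya k \<nu> ! (?n - 1)" k \<nu>] by simp
  ultimately show ?thesis using i length_maya[OF assms(1,2)] by linarith
qed

lemma quotient1_int_Suc:
  assumes "strict_partition \<nu>" "admissible k \<nu>"
  shows "quotient1_int (Suc k) \<nu> = quotient1_int k \<nu> @ [0]"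
proof -
  have "- int (Suc k) \<notin> (\<lambda>p. - ((int p + 1) div 3)) ` set (residue_parts 2 \<nu>)"
  proof
    assume "- int (Suc k) \<in> (\<lambda>p. - ((int p + 1) div 3)) ` set (residue_parts 2 \<nu>)"
    then obtain p where p: "p \<in> set (residue_parts 2 \<nu>)" "int (Suc k) = (int p + 1) div 3"
      by auto
    have "(p + 1) div 3 \<le> k" using assms(2) p(1) by (auto simp: admissible_def)
    with p(2) show False by presburger
  qed
  then have "maya (Suc k) \<nu> = maya k \<nu> @ [- int (Suc k)]"
    by (simp add: maya_def)
  then show ?thesis
    using length_maya[OF assms]
    by (auto simp: quotient1_int_def Let_def nth_append)
qed

lemma quotient1_eq:
  assumes "strict_partition \<nu>" "admissible k \<nu>"
  shows "quotient1 \<nu> = map nat (filter (\<lambda>x. x \<noteq> 0) (quotient1_int k \<nu>))"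
proof -
  have "(LEAST k. admissible k \<nu>) \<le> k" by (rule Least_le) (rule assms(2))
  then show ?thesis
    using assms(2)
  proof (induction k rule: dec_induct)
    case base
    show ?case by (simp add: quotient1_def)
  next
    case (step j)
    have "admissible j \<nu>"
      using admissible_Least[of \<nu>] step.hyps(1) by (fastforce simp: admissible_def)
    then show ?case using step.IH quotient1_int_Suc[OF assms(1)] by simp
  qed
qed

section \<open>Signs\<close>

definition f_stat :: "nat list \<Rightarrow> nat" where
  "f_stat \<nu> = sum_list (residue_parts 2 \<nu>)"

definition g_stat :: "nat list \<Rightarrow> nat" where
  "g_stat \<nu> = (\<Sum>p \<leftarrow> residue_parts 0 (pad_even \<nu>).
     length (filter (\<lambda>q. q > p) (residue_parts 1 \<nu>)))"

definition h_stat :: "nat list \<Rightarrow> nat" where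
  "h_stat \<nu> = length (residue_parts 2 \<nu>)"

definition delta1 :: "nat \<Rightarrow> nat list \<Rightarrow> 'a::field_char_0" where
  "delta1 n \<nu> = (- 1) ^ (f_stat \<nu> + (n choose 2))"

definition delta0 :: "nat \<Rightarrow> nat list \<Rightarrow> 'a::field_char_0" where
  "delta0 m \<nu> = (- 1) ^ (f_stat \<nu> + g_stat \<nu> + (if even m then 0 else h_stat \<nu>))"

end

theory Submission
  imports Defs
begin

text \<open>
  Both identities are evaluations of a Pfaffian. Write \<open>V_x\<close> for the row of all \<open>h_{x + c}(t)\<close>. By the
  Jacobi--Trudi formula, \<open>S_{\<mu>[1]}(t)\<close> is the determinant of the rows \<open>V_x\<close> for \<open>x\<close> in the Maya diagram
  of \<open>\<mu>\<close> (\<open>schur_quotient1\<close>). To add nodes of one color to a core means to decide for each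
  part separately how far it grows (\<open>grows_bar0\<close>, \<open>grows_bar1\<close>), and for the \<open>i\<close>-th part this
  decides which of two opposite positions occur in the Maya diagram: both of them (a pair), only the negative one (a
  single), or none. Singles are at the same time the parts of \<open>\<mu>[0]\<close>, so their weight \<open>Q_{\<mu>[0]}(s)\<close> is a
  Pfaffian indexed by the singles. The signs \<open>\<delta>\<close> are such that, after the rows of each pair have been made
  adjacent (\<open>rows_det_nested\<close>, \<open>stats_parity_bar0\<close>), the sum becomes \<open>\<Sum>S. Pf(A_S) * det(V_S)\<close> for one alternating matrix
  \<open>A\<close> that couples the two members of a pair with a sign and the singles by \<open>Q_{a,b}\<close>. By the Cauchy--Binet
  formula for Pfaffians (\<open>pfaffian_minor_sum\<close>, \<open>sum_pairs_singles\<close>) this is the Pfaffian of the transformed matrix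
  \<open>V\<^sup>T A V\<close>, whose size is \<open>2 (m - n)\<close> for color 1 and \<open>n\<close> or \<open>n + 1\<close> for color 0. It remains to compute its entries.

  For color 1 there are only pairs. An entry is, up to sign, a coefficient of \<open>H(- z) * H(z)\<close>,
  where \<open>H\<close> is the series of the \<open>h_n(t)\<close>. In the exponent of this product the terms of odd degree cancel, and it is the
  series of the \<open>h_n(2 t^(2))\<close> in \<open>z\<^sup>2\<close>. So the matrix has the zeros of a checkerboard, its Pfaffian is a
  determinant (\<open>pfaffian_checkerboard\<close>), and this is the Jacobi--Trudi determinant of the rectangle.

  For color 0 the entries come from the alternating form \<open>\<Sum>i. (- 1)^(i + 1) V_i \<and> V_{- i}\<close> of the pairs and from the form
  \<open>- \<Sum>a b. (- 1)^(a + b) Q_{a,b} V_{- a} \<otimes> V_{- b}\<close> of the singles. Their sum is the alternating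
  form for the family \<open>u\<close> in place of \<open>t\<close> (\<open>skew_form_twist\<close>), since the series of \<open>h_n(u)\<close> is
  \<open>H(z) * q(- z)\<close>. So the left hand side depends on \<open>s\<close> and \<open>t\<close> only through \<open>u\<close> and may be evaluated at \<open>(0, u)\<close>
  instead of \<open>(s, t)\<close>. For \<open>s = 0\<close> only the \<open>\<mu>\<close> with \<open>\<mu>[0] = \<emptyset>\<close> survive, which is the right hand side. For odd \<open>n\<close>
  the determinants have odd size; bordering them with one more column makes the size even, and the same argument applies.
\<close>


section \<open>Determinants of lists of rows\<close>

text \<open>
  Rows are functions of the column number, so that a row belongs to determinants of every size; the
  length of the list decides how many columns count.
\<close>

definition rows_det :: "(nat \<Rightarrow> 'a::field_char_0) list \<Rightarrow> 'a" where
  "rows_det vs = det (mat (length vs) (length vs) (\<lambda>(i, j). (vs ! i) j))"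

definition pf_list :: "('b \<Rightarrow> 'b \<Rightarrow> 'a::field_char_0) \<Rightarrow> 'b list \<Rightarrow> 'a" where
  "pf_list A xs = pfaffian (length xs div 2) (\<lambda>i j. A (xs ! i) (xs ! j))"

lemma rows_det_permute:
  assumes "p permutes {..<n}"
  shows "rows_det (map (\<lambda>i. f (p i)) [0..<n]) = of_int (sign p) * rows_det (map f [0..<n])"
proof -
  let ?A = "mat n n (\<lambda>(i, j). f i j)"
  have p: "p permutes {0..<n}" using assms by (simp add: atLeast0LessThan)
  have lt: "p i < n" if "i < n" for i using permutes_in_image[OF p, of i] that by simp
  have "det (mat n n (\<lambda>(i, j). ?A $$ (p i, j))) = of_int (sign p) * det ?A"
    by (rule det_permute_rows[OF _ p]) simp
  moreover have "mat n n (\<lambda>(i, j). ?A $$ (p i, j)) = mat n n (\<lambda>(i, j). f (p i) j)"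
    by (rule cong_mat) (auto simp: lt)
  moreover have "mat n n (\<lambda>(i, j). f (p i) j)
      = mat n n (\<lambda>(i, j). (map (\<lambda>i. f (p i)) [0..<n] ! i) j)"
    by (rule cong_mat) auto
  moreover have "?A = mat n n (\<lambda>(i, j). (map f [0..<n] ! i) j)"
    by (rule cong_mat) auto
  ultimately show ?thesis by (simp add: rows_det_def)
qed

lemma rows_det_leibniz:
  "rows_det (map f [0..<n]) = (\<Sum>\<sigma> | \<sigma> permutes {..<n}. of_int (sign \<sigma>) * (\<Prod>j<n. f j (\<sigma> j)))"
proof -
  have "rows_det (map f [0..<n]) = (\<Sum>\<sigma> | \<sigma> permutes {0..<n}. of_int (sign \<sigma>) *
      (\<Prod>j = 0..<n. mat n n (\<lambda>(i, j). (map f [0..<n] ! i) j) $$ (j, \<sigma> j)))"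
    unfolding rows_det_def by (subst det_def'[of _ n]) auto
  also have "\<dots> = (\<Sum>\<sigma> | \<sigma> permutes {..<n}. of_int (sign \<sigma>) * (\<Prod>j<n. f j (\<sigma> j)))"
    unfolding atLeast0LessThan
  proof (intro sum.cong refl, goal_cases)
    case (1 \<sigma>)
    then have "\<sigma> i < n" if "i < n" for i using permutes_in_image[of \<sigma> "{..<n}" i] that by simp
    then show ?case by simp
  qed
  finally show ?thesis .
qed

lemma rows_det_eq_map: "rows_det vs = rows_det (map ((!) vs) [0..<length vs])"
  by (simp add: map_nth)

lemma rows_det_swap: "rows_det (xs @ a # b # ys) = - rows_det (xs @ b # a # ys)"
proof -
  let ?k = "length xs" and ?vs = "xs @ b # a # ys"
  let ?p = "Transposition.transpose ?k (Suc ?k)" and ?n = "length ?vs"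
  have p: "?p permutes {..<?n}" by (rule permutes_swap_id) auto
  have "xs @ a # b # ys = map (\<lambda>i. ?vs ! ?p i) [0..<?n]"
  proof (rule nth_equalityI)
    fix i assume i: "i < length (xs @ a # b # ys)"
    consider "i < ?k" | "i = ?k" | "i = Suc ?k" | j where "i = Suc (Suc (?k + j))"
      by (metis add_Suc_right less_imp_Suc_add linorder_neqE_nat not_less_eq)
    then show "(xs @ a # b # ys) ! i = map (\<lambda>i. ?vs ! ?p i) [0..<?n] ! i"
      by cases (use i in \<open>auto simp: nth_append transpose_def simp del: upt_Suc\<close>)
  qed simp
  then have "rows_det (xs @ a # b # ys) = of_int (sign ?p) * rows_det (map ((!) ?vs) [0..<?n])"
    using rows_det_permute[OF p, of "(!) ?vs"] by simp
  then show ?thesis using rows_det_eq_map[of ?vs] by (simp add: sign_swap_id)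
qed

text \<open>
  Every comparison of row orders below is a sequence of such moves, which avoids permutations and
  their signs.
\<close>

lemma rows_det_move: "rows_det (xs @ a # ys @ zs) = (- 1) ^ length ys * rows_det (xs @ ys @ a # zs)"
proof (induction ys arbitrary: xs)
  case (Cons y ys)
  have "rows_det (xs @ a # (y # ys) @ zs) = - rows_det ((xs @ [y]) @ a # ys @ zs)"
    using rows_det_swap[of xs a y "ys @ zs"] by simp
  then show ?case using Cons[of "xs @ [y]"] by simp
qed simp

lemma rows_det_eq_0_if_eq_rows:
  assumes "i < length vs" "j < length vs" "i \<noteq> j" "vs ! i = vs ! j"
  shows "rows_det vs = 0"
proof -
  let ?A = "mat (length vs) (length vs) (\<lambda>(i, j). (vs ! i) j)"
  have "row ?A i = row ?A j" by (rule eq_vecI) (use assms in auto)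
  then show ?thesis unfolding rows_det_def using det_identical_rows[of ?A "length vs" i j] assms by simp
qed

lemma prod_lessThan_double:
  "(\<Prod>j<2 * r. f j) = (\<Prod>i<r. f (2 * i) * f (2 * i + 1 :: nat) :: 'a::comm_monoid_mult)"
  by (induction r) (auto simp: mult.assoc)

section \<open>The minor summation formula for Pfaffians\<close>

lemma pfaffian_mult: "2 ^ k * fact k * pfaffian k A = (\<Sum>\<sigma> | \<sigma> permutes {..<2 * k}.
        of_int (sign \<sigma>) * (\<Prod>i<k. A (\<sigma> (2 * i)) (\<sigma> (2 * i + 1))))"
  by (simp add: pfaffian_def)

text \<open>
  An injective function with image \<open>set xs\<close> is \<open>xs\<close> read in a permuted
  order. This turns the sum over injective functions in the minor summation formula into a sum over
  subsets and permutations.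
\<close>

lemma bij_betw_enumerations:
  assumes "distinct xs" "length xs = n" "set xs \<subseteq> Z"
  shows "bij_betw (\<lambda>\<tau>. restrict (\<lambda>i. xs ! \<tau> i) {..<n}) {\<tau>. \<tau> permutes {..<n}}
    {f \<in> {..<n} \<rightarrow>\<^sub>E Z. inj_on f {..<n} \<and> f ` {..<n} = set xs}"
  (is "bij_betw ?h ?P ?F")
proof -
  have nth: "bij_betw ((!) xs) {..<n} (set xs)"
    using assms bij_betw_nth[of xs "{..<n}" "set xs"] by auto
  have lt: "\<tau> i < n" if "\<tau> permutes {..<n}" "i < n" for \<tau> i
    using permutes_in_image[OF that(1), of i] that by simp
  show ?thesis
  proof (rule bij_betwI')
    fix \<tau> \<tau>' assume t: "\<tau> \<in> ?P" "\<tau>' \<in> ?P"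
    show "?h \<tau> = ?h \<tau>' \<longleftrightarrow> \<tau> = \<tau>'"
    proof
      assume eq: "?h \<tau> = ?h \<tau>'"
      show "\<tau> = \<tau>'"
      proof
        fix i show "\<tau> i = \<tau>' i"
        proof (cases "i < n")
          case True
          then have "xs ! \<tau> i = xs ! \<tau>' i" using fun_cong[OF eq, of i] by simp
          then show ?thesis
            using nth lt[of \<tau> i] lt[of \<tau>' i] t True by (auto simp: bij_betw_def inj_on_def)
        next
          case False
          then show ?thesis using t permutes_not_in[of \<tau> "{..<n}" i] permutes_not_in[of \<tau>' "{..<n}" i]
            by simp
        qed
      qed
    qed simp
  next
    fix \<tau> assume t: "\<tau> \<in> ?P"
    then have "bij_betw ((!) xs \<circ> \<tau>) {..<n} (set xs)"
      using bij_betw_trans[OF permutes_imp_bij nth] by simp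
    then have "bij_betw (?h \<tau>) {..<n} (set xs)"
      by (subst bij_betw_cong[of _ _ "(!) xs \<circ> \<tau>"]) auto
    then show "?h \<tau> \<in> ?F"
      using assms by (auto simp: bij_betw_def)
  next
    fix f assume f: "f \<in> ?F"
    then have bf: "bij_betw f {..<n} (set xs)" by (auto simp: bij_betw_def)
    let ?g = "inv_into {..<n} ((!) xs)"
    have b: "bij_betw (?g \<circ> f) {..<n} {..<n}"
      by (rule bij_betw_trans[OF bf bij_betw_inv_into[OF nth]])
    let ?\<tau> = "\<lambda>i. if i < n then ?g (f i) else i"
    have "bij_betw ?\<tau> {..<n} {..<n}"
      by (subst bij_betw_cong[of _ _ "?g \<circ> f"]) (use b in auto)
    then have "?\<tau> permutes {..<n}" by (intro bij_imp_permutes) auto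
    moreover have "f = ?h ?\<tau>"
    proof
      fix i show "f i = ?h ?\<tau> i"
      proof (cases "i < n")
        case True
        then have "f i \<in> set xs" using bf by (auto simp: bij_betw_def)
        then show ?thesis using True nth by (simp add: bij_betw_inv_into_right)
      next
        case False
        then show ?thesis using f by (auto simp: PiE_def extensional_def)
      qed
    qed
    ultimately show "\<exists>\<tau>\<in>?P. f = ?h \<tau>" by (intro bexI[of _ ?\<tau>]) simp_all
  qed
qed

text \<open>
  The Cauchy--Binet formula for Pfaffians (Ishikawa and Wakayama). Expanding the Pfaffian on the
  right gives a sum over all functions \<open>f\<close> from \<open>2 * r\<close> positions to the
  index set, weighted with the determinant of the rows \<open>V (f j)\<close>. Functions that are
  not injective contribute a determinant with two equal rows; the others are grouped by their image
  \<open>S\<close>. A summand does not depend on the enumeration \<open>L S\<close>, since a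
  permutation changes both factors by its sign, so each \<open>S\<close> may be listed in whichever
  order is convenient.
\<close>

theorem pfaffian_minor_sum:
  fixes V :: "'b \<Rightarrow> nat \<Rightarrow> 'a::field_char_0"
  assumes Z: "finite Z"
    and L: "\<And>S. S \<subseteq> Z \<Longrightarrow> card S = 2 * r \<Longrightarrow> distinct (L S) \<and> set (L S) = S"
  shows "(\<Sum>S | S \<subseteq> Z \<and> card S = 2 * r. pf_list A (L S) * rows_det (map V (L S))) =
    pfaffian r (\<lambda>c d. \<Sum>a\<in>Z. \<Sum>b\<in>Z. A a b * V a c * V b d)"
proof -
  define n where "n = 2 * r"
  define F where "F = {..<n} \<rightarrow>\<^sub>E Z"
  define G where "G f = (\<Prod>i<r. A (f (2 * i)) (f (2 * i + 1))) * rows_det (map (\<lambda>i. V (f i)) [0..<n])"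
    for f
  have finF: "finite F" unfolding F_def using Z by (intro finite_PiE) auto
  have finS: "finite {S. S \<subseteq> Z \<and> card S = 2 * r}" using Z by simp
  have "2 ^ r * fact r * pfaffian r (\<lambda>c d. \<Sum>a\<in>Z. \<Sum>b\<in>Z. A a b * V a c * V b d)
      = (\<Sum>\<sigma> | \<sigma> permutes {..<n}. of_int (sign \<sigma>) *
          (\<Prod>i<r. \<Sum>(a, b)\<in>Z \<times> Z. A a b * V a (\<sigma> (2 * i)) * V b (\<sigma> (2 * i + 1))))"
    by (simp add: pfaffian_mult n_def sum.cartesian_product)
  also have "\<dots> = (\<Sum>\<sigma> | \<sigma> permutes {..<n}. of_int (sign \<sigma>) *
      (\<Sum>f\<in>F. (\<Prod>i<r. A (f (2 * i)) (f (2 * i + 1))) * (\<Prod>j<n. V (f j) (\<sigma> j))))"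
  proof (intro sum.cong refl arg_cong2[where f = "(*)"], goal_cases)
    case (1 \<sigma>)
    have "(\<Prod>i<r. \<Sum>(a, b)\<in>Z \<times> Z. A a b * V a (\<sigma> (2 * i)) * V b (\<sigma> (2 * i + 1)))
      = (\<Sum>g\<in>{..<r} \<rightarrow>\<^sub>E Z \<times> Z. \<Prod>i<r. A (fst (g i)) (snd (g i))
          * V (fst (g i)) (\<sigma> (2 * i)) * V (snd (g i)) (\<sigma> (2 * i + 1)))"
      using Z by (subst prod_sum_PiE) (auto simp: case_prod_unfold)
    also have "\<dots> = (\<Sum>f\<in>F. \<Prod>i<r. A (f (2 * i)) (f (2 * i + 1))
          * V (f (2 * i)) (\<sigma> (2 * i)) * V (f (2 * i + 1)) (\<sigma> (2 * i + 1)))"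
    proof (rule sum.reindex_bij_witness[where
          i = "\<lambda>f. restrict (\<lambda>i. (f (2 * i), f (2 * i + 1))) {..<r}" and
          j = "\<lambda>g. restrict (\<lambda>k. if even k then fst (g (k div 2)) else snd (g (k div 2))) {..<n}"],
        goal_cases)
      case (1 g)
      show ?case
      proof
        fix i
        show "restrict (\<lambda>i. (restrict (\<lambda>k. if even k then fst (g (k div 2)) else snd (g (k div 2))) {..<n} (2 * i),
            restrict (\<lambda>k. if even k then fst (g (k div 2)) else snd (g (k div 2))) {..<n} (2 * i + 1))) {..<r} i
          = g i"
          using PiE_arb[OF 1, of i] by (cases "i < r") (simp_all add: n_def)
      qed
    next
      case (2 g)
      then have "g (k div 2) \<in> Z \<times> Z" if "k < n" for k
        using that by (auto simp: n_def PiE_def Pi_def)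
      then have "(if even k then fst (g (k div 2)) else snd (g (k div 2))) \<in> Z" if "k < n" for k
        using that by (simp add: mem_Times_iff)
      then show ?case by (auto simp: F_def)
    next
      case (3 f)
      show ?case
      proof
        fix k :: nat
        have "2 * (k div 2) = k" if "even k" using that by simp
        moreover have "Suc (2 * (k div 2)) = k" if "odd k" using that by simp
        moreover have "k div 2 < r \<longleftrightarrow> k < n" unfolding n_def by linarith
        ultimately show "restrict (\<lambda>k. if even k
            then fst (restrict (\<lambda>i. (f (2 * i), f (2 * i + 1))) {..<r} (k div 2))
            else snd (restrict (\<lambda>i. (f (2 * i), f (2 * i + 1))) {..<r} (k div 2))) {..<n} k = f k"
          using PiE_arb[of f _ _ k] 3 by (cases "k < n") (simp_all add: F_def)
      qed
    next
      case (4 f)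
      then have "f k \<in> Z" if "k < n" for k using that by (auto simp: F_def)
      then show ?case by (subst restrict_PiE_iff) (simp add: n_def)
    next
      case (5 g)
      show ?case by (intro prod.cong refl) (simp add: n_def)
    qed
    also have "\<dots> = (\<Sum>f\<in>F. (\<Prod>i<r. A (f (2 * i)) (f (2 * i + 1))) * (\<Prod>j<n. V (f j) (\<sigma> j)))"
      by (simp add: n_def prod_lessThan_double prod.distrib mult.assoc)
    finally show ?case .
  qed
  also have "\<dots> = (\<Sum>f\<in>F. G f)"
    unfolding G_def rows_det_leibniz sum_distrib_left
    by (subst sum.swap) (simp add: mult_ac)
  also have "\<dots> = (\<Sum>f\<in>{f\<in>F. inj_on f {..<n}}. G f)"
  proof (rule sum.mono_neutral_right[OF finF])
    show "\<forall>f\<in>F - {f \<in> F. inj_on f {..<n}}. G f = 0"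
    proof
      fix f assume "f \<in> F - {f \<in> F. inj_on f {..<n}}"
      then obtain i j where "i < n" "j < n" "i \<noteq> j" "f i = f j" by (auto simp: inj_on_def)
      then have "rows_det (map (\<lambda>i. V (f i)) [0..<n]) = 0"
        by (intro rows_det_eq_0_if_eq_rows[of i _ j]) auto
      then show "G f = 0" by (simp add: G_def)
    qed
  qed auto
  also have "\<dots> = (\<Sum>S | S \<subseteq> Z \<and> card S = 2 * r.
      \<Sum>f\<in>{f\<in>{f\<in>F. inj_on f {..<n}}. f ` {..<n} = S}. G f)"
  proof (rule sum.group[symmetric])
    show "(\<lambda>f. f ` {..<n}) ` {f \<in> F. inj_on f {..<n}} \<subseteq> {S. S \<subseteq> Z \<and> card S = 2 * r}"
    proof (rule image_subsetI, rule CollectI, rule conjI)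
      fix f assume f: "f \<in> {f \<in> F. inj_on f {..<n}}"
      then show "card (f ` {..<n}) = 2 * r" by (simp add: card_image n_def)
      from f have "f \<in> {..<n} \<rightarrow> Z" by (simp add: F_def PiE_def)
      then show "f ` {..<n} \<subseteq> Z" by (simp only: image_subset_iff_funcset)
    qed
  qed (use finF finS in simp_all)
  also have "\<dots> = (\<Sum>S | S \<subseteq> Z \<and> card S = 2 * r.
      2 ^ r * fact r * (pf_list A (L S) * rows_det (map V (L S))))"
  proof (intro sum.cong refl)
    fix S assume "S \<in> {S. S \<subseteq> Z \<and> card S = 2 * r}"
    then have S: "S \<subseteq> Z" "card S = 2 * r" by auto
    let ?xs = "L S"
    have xs: "distinct ?xs" "set ?xs = S" using L[OF S] by auto
    have len: "length ?xs = n" using distinct_card[OF xs(1)] xs(2) S(2) by (simp add: n_def)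
    let ?h = "\<lambda>\<tau>. restrict (\<lambda>i. ?xs ! \<tau> i) {..<n}"
    have "{f\<in>{f\<in>F. inj_on f {..<n}}. f ` {..<n} = S}
        = {f \<in> {..<n} \<rightarrow>\<^sub>E Z. inj_on f {..<n} \<and> f ` {..<n} = set ?xs}"
      using xs unfolding F_def by blast
    then have "(\<Sum>f\<in>{f\<in>{f\<in>F. inj_on f {..<n}}. f ` {..<n} = S}. G f)
        = (\<Sum>\<tau> | \<tau> permutes {..<n}. G (?h \<tau>))"
      using sum.reindex_bij_betw[OF bij_betw_enumerations[OF xs(1) len], of Z G] xs S by simp
    also have "\<dots> = (\<Sum>\<tau> | \<tau> permutes {..<n}. of_int (sign \<tau>) *
        (\<Prod>i<r. A (?xs ! \<tau> (2 * i)) (?xs ! \<tau> (2 * i + 1))) * rows_det (map V ?xs))"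
    proof (intro sum.cong refl)
      fix \<tau> assume "\<tau> \<in> {\<tau>. \<tau> permutes {..<n}}"
      then have t: "\<tau> permutes {..<n}" by simp
      have "rows_det (map (\<lambda>i. V (?h \<tau> i)) [0..<n]) = rows_det (map (\<lambda>i. V (?xs ! \<tau> i)) [0..<n])"
        by (intro arg_cong[where f = rows_det]) auto
      also have "\<dots> = of_int (sign \<tau>) * rows_det (map (\<lambda>i. V (?xs ! i)) [0..<n])"
        by (rule rows_det_permute[OF t])
      also have "map (\<lambda>i. V (?xs ! i)) [0..<n] = map V ?xs"
        by (rule nth_equalityI) (auto simp: len)
      finally have d: "rows_det (map (\<lambda>i. V (?h \<tau> i)) [0..<n]) = of_int (sign \<tau>) * rows_det (map V ?xs)" .
      have "(\<Prod>i<r. A (?h \<tau> (2 * i)) (?h \<tau> (2 * i + 1)))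
        = (\<Prod>i<r. A (?xs ! \<tau> (2 * i)) (?xs ! \<tau> (2 * i + 1)))"
        by (intro prod.cong) (auto simp: n_def)
      then show "G (?h \<tau>) = of_int (sign \<tau>) *
        (\<Prod>i<r. A (?xs ! \<tau> (2 * i)) (?xs ! \<tau> (2 * i + 1))) * rows_det (map V ?xs)"
        unfolding G_def d by simp
    qed
    also have "\<dots> = 2 ^ r * fact r * (pf_list A ?xs * rows_det (map V ?xs))"
      by (simp add: pf_list_def len n_def pfaffian_mult sum_distrib_right[symmetric]
          mult.assoc[symmetric])
    finally show "(\<Sum>f\<in>{f\<in>{f\<in>F. inj_on f {..<n}}. f ` {..<n} = S}. G f)
        = 2 ^ r * fact r * (pf_list A ?xs * rows_det (map V ?xs))" .
  qed
  finally show ?thesis by (simp add: sum_distrib_left[symmetric])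
qed

section \<open>Evaluation of Pfaffians\<close>

lemma pfaffian_cong:
  assumes "\<And>i j. i < 2 * k \<Longrightarrow> j < 2 * k \<Longrightarrow> A i j = B i j"
  shows "pfaffian k A = pfaffian k B"
proof -
  have "A (\<sigma> (2 * i)) (\<sigma> (2 * i + 1)) = B (\<sigma> (2 * i)) (\<sigma> (2 * i + 1))"
    if "\<sigma> permutes {..<2 * k}" "i < k" for \<sigma> i
    using permutes_in_image[OF that(1), of "2 * i"] permutes_in_image[OF that(1), of "2 * i + 1"] that
    by (intro assms) auto
  then show ?thesis unfolding pfaffian_def by simp
qed

lemma pfaffian_scale:
  "pfaffian k (\<lambda>i j. c * d i * d j * A i j) = c ^ k * (\<Prod>i<2 * k. d i) * pfaffian k A"
proof -
  have "(\<Prod>i<k. c * d (\<sigma> (2 * i)) * d (\<sigma> (2 * i + 1)) * A (\<sigma> (2 * i)) (\<sigma> (2 * i + 1)))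
      = c ^ k * (\<Prod>i<2 * k. d i) * (\<Prod>i<k. A (\<sigma> (2 * i)) (\<sigma> (2 * i + 1)))"
    if "\<sigma> permutes {..<2 * k}" for \<sigma>
  proof -
    have "(\<Prod>i<2 * k. d i) = (\<Prod>i<2 * k. d (\<sigma> i))"
      using prod.permute[OF that, of d] by simp
    also have "\<dots> = (\<Prod>i<k. d (\<sigma> (2 * i)) * d (\<sigma> (2 * i + 1)))"
      by (rule prod_lessThan_double)
    finally show ?thesis by (simp add: prod.distrib mult_ac)
  qed
  then show ?thesis
    unfolding pfaffian_def by (simp add: sum_distrib_left mult_ac)
qed

lemma pfaffian_zero_row:
  assumes "k < 2 * r" "\<And>j. j < 2 * r \<Longrightarrow> A k j = 0 \<and> A j k = 0"
  shows "pfaffian r A = 0"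
proof -
  have "(\<Prod>i<r. A (\<sigma> (2 * i)) (\<sigma> (2 * i + 1))) = 0" if s: "\<sigma> permutes {..<2 * r}" for \<sigma>
  proof -
    have lt: "\<sigma> i < 2 * r" if "i < 2 * r" for i using permutes_in_image[OF s, of i] that by simp
    obtain p where p: "\<sigma> p = k" "p < 2 * r"
      using permutes_image[OF s] assms(1) by (metis imageE lessThan_iff)
    have "A (\<sigma> (2 * (p div 2))) (\<sigma> (2 * (p div 2) + 1)) = 0"
    proof (cases "even p")
      case True
      then show ?thesis using p lt[of "Suc p"] assms(2)[of "\<sigma> (Suc p)"] by (auto elim!: evenE)
    next
      case False
      then show ?thesis using p lt[of "p - 1"] assms(2)[of "\<sigma> (p - 1)"] by (auto elim!: oddE)
    qed
    moreover have "p div 2 < r" using p by auto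
    ultimately show ?thesis by (intro prod_zero) auto
  qed
  then show ?thesis by (simp add: pfaffian_def del: prod_zero_iff)
qed

lemma sum_permutes_compose_fiber:
  assumes "\<tau> permutes A" "\<tau> k = l" "l \<in> A"
    and "\<And>\<sigma>. \<sigma> permutes A \<Longrightarrow> F (\<sigma> \<circ> \<tau>) = F \<sigma>"
  shows "(\<Sum>\<sigma> | \<sigma> permutes A \<and> \<sigma> k = x. F \<sigma>) = (\<Sum>\<sigma> | \<sigma> permutes A \<and> \<sigma> l = x. F \<sigma>)"
proof (rule sum.reindex_bij_witness[where i = "\<lambda>\<sigma>. \<sigma> \<circ> \<tau>" and j = "\<lambda>\<sigma>. \<sigma> \<circ> Hilbert_Choice.inv \<tau>"], goal_cases)
  case (1 \<sigma>)
  then show ?case using permutes_inverses[OF assms(1)] by (auto simp: fun_eq_iff)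
next
  case (2 \<sigma>)
  then show ?case
    using permutes_compose[OF permutes_inv[OF assms(1)]] permutes_inverses[OF assms(1)] assms(2)
    by auto
next
  case (3 \<sigma>)
  then show ?case using permutes_inverses[OF assms(1)] by (auto simp: fun_eq_iff)
next
  case (4 \<sigma>)
  then show ?case using permutes_compose[OF assms(1)] assms(2) by auto
next
  case (5 \<sigma>)
  then have "\<sigma> \<circ> Hilbert_Choice.inv \<tau> permutes A"
    using permutes_compose[OF permutes_inv[OF assms(1)]] by auto
  from assms(4)[OF this] show ?case
    using permutes_inverses[OF assms(1)] by (simp add: comp_def)
qed

text \<open>
  In the sum over permutations that defines a Pfaffian, the value 0 is taken at any of the
  \<open>2 * r\<close> positions, and all positions contribute the same amount: exchanging two
  whole pairs is an even permutation, and exchanging the members of a pair costs a sign that the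
  alternating matrix returns.
\<close>

lemma pfaffian_sum_fiber:
  fixes A :: "nat \<Rightarrow> nat \<Rightarrow> 'a::field_char_0"
  assumes anti: "\<And>i j. i < 2 * r \<Longrightarrow> j < 2 * r \<Longrightarrow> A i j = - A j i"
  defines "F \<equiv> \<lambda>\<sigma>. of_int (sign \<sigma>) * (\<Prod>i<r. A (\<sigma> (2 * i)) (\<sigma> (2 * i + 1)))"
  assumes k: "k < 2 * r"
  shows "(\<Sum>\<sigma> | \<sigma> permutes {..<2 * r} \<and> \<sigma> k = 0. F \<sigma>) = (\<Sum>\<sigma> | \<sigma> permutes {..<2 * r} \<and> \<sigma> 0 = 0. F \<sigma>)"
proof -
  have ev: "(\<Sum>\<sigma> | \<sigma> permutes {..<2 * r} \<and> \<sigma> (2 * i) = 0. F \<sigma>)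
      = (\<Sum>\<sigma> | \<sigma> permutes {..<2 * r} \<and> \<sigma> 0 = 0. F \<sigma>)" if i: "i < r" for i
  proof (rule sum_permutes_compose_fiber)
    let ?\<tau> = "transpose 0 (2 * i) \<circ> transpose 1 (2 * i + 1)"
    have p: "transpose 0 (2 * i) permutes {..<2 * r}" "transpose 1 (2 * i + 1) permutes {..<2 * r}"
      by (rule permutes_swap_id; use i in simp)+
    show "?\<tau> permutes {..<2 * r}" by (rule permutes_compose[OF p(2,1)])
    show "?\<tau> (2 * i) = 0" by (auto simp: transpose_def)
    show "0 \<in> {..<2 * r}" using i by simp
    fix \<sigma> assume s: "\<sigma> permutes {..<2 * r}"
    have "sign ?\<tau> = sign (transpose 0 (2 * i)) * sign (transpose 1 (2 * i + 1))"
      by (intro sign_compose permutation_swap_id)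
    also have "\<dots> = 1" by (auto simp: sign_swap_id)
    finally have t1: "sign ?\<tau> = 1" .
    have "sign (\<sigma> \<circ> ?\<tau>) = sign \<sigma> * sign ?\<tau>"
      using s \<open>?\<tau> permutes {..<2 * r}\<close>
      by (intro sign_compose) (auto simp: permutation_permutes intro: exI[of _ "{..<2 * r}"])
    then have sg: "sign (\<sigma> \<circ> ?\<tau>) = sign \<sigma>" using t1 by simp
    have pt: "transpose 0 i permutes {..<r}" by (rule permutes_swap_id) (use i in auto)
    have e: "?\<tau> (2 * j) = 2 * transpose 0 i j" "?\<tau> (2 * j + 1) = 2 * transpose 0 i j + 1" for j
      by (auto simp: transpose_def; presburger)+
    show "F (\<sigma> \<circ> ?\<tau>) = F \<sigma>"
      unfolding F_def sg
      using prod.permute[OF pt, of "\<lambda>i. A (\<sigma> (2 * i)) (\<sigma> (2 * i + 1))"] e by (simp add: comp_def)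
  qed
  show ?thesis
  proof (cases "even k")
    case True
    then show ?thesis using ev[of "k div 2"] k by auto
  next
    case False
    define i where "i = k div 2"
    have ki: "k = 2 * i + 1" "i < r" using False k by (auto simp: i_def elim!: oddE)
    let ?\<tau> = "transpose (2 * i) (2 * i + 1)"
    have "(\<Sum>\<sigma> | \<sigma> permutes {..<2 * r} \<and> \<sigma> k = 0. F \<sigma>)
        = (\<Sum>\<sigma> | \<sigma> permutes {..<2 * r} \<and> \<sigma> (2 * i) = 0. F \<sigma>)"
    proof (rule sum_permutes_compose_fiber)
      show t: "?\<tau> permutes {..<2 * r}" by (rule permutes_swap_id) (use ki in auto)
      show "?\<tau> k = 2 * i" by (simp add: ki)
      show "2 * i \<in> {..<2 * r}" using ki by simp
      fix \<sigma> assume s: "\<sigma> permutes {..<2 * r}"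
      have lt: "\<sigma> i < 2 * r" if "i < 2 * r" for i using permutes_in_image[OF s, of i] that by simp
      have "sign (\<sigma> \<circ> ?\<tau>) = sign \<sigma> * sign ?\<tau>"
        using s t
        by (intro sign_compose) (auto simp: permutation_permutes intro: exI[of _ "{..<2 * r}"])
      then have sg: "sign (\<sigma> \<circ> ?\<tau>) = - sign \<sigma>" by (simp add: sign_swap_id)
      have sp: "(\<Prod>j<r. f j) = f i * (\<Prod>j\<in>{..<r} - {i}. f j)" for f :: "nat \<Rightarrow> 'a"
        by (rule prod.remove) (use ki in auto)
      have "A (\<sigma> (2 * i + 1)) (\<sigma> (2 * i)) = - A (\<sigma> (2 * i)) (\<sigma> (2 * i + 1))"
        by (rule anti) (use lt ki in auto)
      moreover have "(\<Prod>j\<in>{..<r} - {i}. A ((\<sigma> \<circ> ?\<tau>) (2 * j)) ((\<sigma> \<circ> ?\<tau>) (2 * j + 1)))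
        = (\<Prod>j\<in>{..<r} - {i}. A (\<sigma> (2 * j)) (\<sigma> (2 * j + 1)))"
        by (rule prod.cong) (auto simp: transpose_def; presburger)+
      ultimately show "F (\<sigma> \<circ> ?\<tau>) = F \<sigma>"
        unfolding F_def sg sp by simp
    qed
    then show ?thesis using ev[OF ki(2)] by simp
  qed
qed

lemma sum_map_permutation:
  assumes f: "bij_betw f A B"
  shows "(\<Sum>\<sigma> | \<sigma> permutes B. F \<sigma>) = (\<Sum>\<sigma> | \<sigma> permutes A. F (map_permutation A f \<sigma>))"
proof (rule sum.reindex_bij_witness[where i = "map_permutation A f" and j = "map_permutation B (inv_into A f)"],
    goal_cases)
  case (1 \<sigma>)
  then show ?case
    by (intro map_permutation_compose_inv[OF bij_betw_inv_into[OF f]])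
      (auto simp: bij_betw_inv_into_right[OF f])
next
  case (2 \<sigma>)
  then show ?case using map_permutation_permutes[OF bij_betw_inv_into[OF f]] by simp
next
  case (3 \<sigma>)
  then show ?case
    by (intro map_permutation_compose_inv[OF f]) (auto simp: bij_betw_inv_into_left[OF f])
next
  case (4 \<sigma>)
  then show ?case using map_permutation_permutes[OF f] by simp
next
  case (5 \<sigma>)
  then have "map_permutation A f (map_permutation B (inv_into A f) \<sigma>) = \<sigma>"
    by (intro map_permutation_compose_inv[OF bij_betw_inv_into[OF f]])
      (auto simp: bij_betw_inv_into_right[OF f])
  then show ?case by simp
qed

text \<open>
  The expansion along the first row when that row has a single nonzero entry, next to the diagonal.
  By \<open>pfaffian_sum_fiber\<close> all positions of the value 0 may be moved to the front, and
  then the value 1 has to follow it.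
\<close>

theorem pfaffian_Suc:
  fixes A :: "nat \<Rightarrow> nat \<Rightarrow> 'a::field_char_0"
  assumes anti: "\<And>i j. i < 2 * Suc r \<Longrightarrow> j < 2 * Suc r \<Longrightarrow> A i j = - A j i"
    and zero: "\<And>j. 2 \<le> j \<Longrightarrow> j < 2 * Suc r \<Longrightarrow> A 0 j = 0"
  shows "pfaffian (Suc r) A = A 0 1 * pfaffian r (\<lambda>i j. A (i + 2) (j + 2))"
proof -
  define n where "n = 2 * Suc r"
  define F where "F \<sigma> = of_int (sign \<sigma>) * (\<Prod>i<Suc r. A (\<sigma> (2 * i)) (\<sigma> (2 * i + 1)))" for \<sigma>
  define G where "G \<sigma> = of_int (sign \<sigma>) * (\<Prod>i<r. A (\<sigma> (2 * i) + 2) (\<sigma> (2 * i + 1) + 2))" for \<sigma>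
  have fin: "finite {\<sigma>. \<sigma> permutes {..<n}}" by (rule finite_permutations) simp
  have "2 ^ Suc r * fact (Suc r) * pfaffian (Suc r) A = (\<Sum>\<sigma> | \<sigma> permutes {..<n}. F \<sigma>)"
    unfolding pfaffian_mult F_def n_def ..
  also have "\<dots> = (\<Sum>k<n. \<Sum>\<sigma>\<in>{\<sigma>\<in>{\<sigma>. \<sigma> permutes {..<n}}. Hilbert_Choice.inv \<sigma> 0 = k}. F \<sigma>)"
  proof (rule sum.group[symmetric])
    show "(\<lambda>\<sigma>. Hilbert_Choice.inv \<sigma> 0) ` {\<sigma>. \<sigma> permutes {..<n}} \<subseteq> {..<n}"
    proof safe
      fix \<sigma> assume "\<sigma> permutes {..<n}"
      then show "Hilbert_Choice.inv \<sigma> 0 < n"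
        using permutes_in_image[OF permutes_inv[of \<sigma> "{..<n}"], of 0] by (simp add: n_def)
    qed
  qed (use fin in auto)
  also have "\<dots> = (\<Sum>k<n. \<Sum>\<sigma> | \<sigma> permutes {..<n} \<and> \<sigma> k = 0. F \<sigma>)"
    by (intro sum.cong refl) (auto simp: permutes_inv_eq)
  also have "\<dots> = (\<Sum>k<n. \<Sum>\<sigma> | \<sigma> permutes {..<n} \<and> \<sigma> 0 = 0. F \<sigma>)"
    unfolding F_def n_def
    by (intro sum.cong refl pfaffian_sum_fiber anti) auto
  also have "\<dots> = 2 * (of_nat (Suc r) * (\<Sum>\<sigma> | \<sigma> permutes {..<n} \<and> \<sigma> 0 = 0. F \<sigma>))"
    by (simp add: n_def algebra_simps)
  also have "(\<Sum>\<sigma> | \<sigma> permutes {..<n} \<and> \<sigma> 0 = 0. F \<sigma>) = (\<Sum>\<sigma> | \<sigma> permutes {2..<n}. F \<sigma>)"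
  proof (rule sum.mono_neutral_right)
    show "finite {\<sigma>. \<sigma> permutes {..<n} \<and> \<sigma> 0 = 0}"
      by (rule finite_subset[OF _ fin]) auto
    show "{\<sigma>. \<sigma> permutes {2..<n}} \<subseteq> {\<sigma>. \<sigma> permutes {..<n} \<and> \<sigma> 0 = 0}"
      by (auto intro: permutes_subset permutes_not_in)
    show "\<forall>\<sigma>\<in>{\<sigma>. \<sigma> permutes {..<n} \<and> \<sigma> 0 = 0} - {\<sigma>. \<sigma> permutes {2..<n}}. F \<sigma> = 0"
    proof
      fix \<sigma> assume "\<sigma> \<in> {\<sigma>. \<sigma> permutes {..<n} \<and> \<sigma> 0 = 0} - {\<sigma>. \<sigma> permutes {2..<n}}"
      then have s: "\<sigma> permutes {..<n}" "\<sigma> 0 = 0" "\<not> \<sigma> permutes {2..<n}" by auto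
      have "\<sigma> 1 \<noteq> 1"
      proof
        assume "\<sigma> 1 = 1"
        then have "\<sigma> x = x" if "x \<in> {..<n} - {2..<n}" for x
          using that s(2) by (cases "x = 0"; cases "x = 1") auto
        then have "\<sigma> permutes {2..<n}" by (intro permutes_superset[OF s(1)]) auto
        with s(3) show False ..
      qed
      moreover have "\<sigma> 1 \<noteq> 0" using s(2) permutes_inj[OF s(1)] by (metis injD zero_neq_one)
      moreover have "\<sigma> 1 < n" using permutes_in_image[OF s(1), of 1] by (simp add: n_def)
      ultimately have "A (\<sigma> 0) (\<sigma> 1) = 0" using zero[of "\<sigma> 1"] s(2) by (simp add: n_def)
      then show "F \<sigma> = 0" by (simp add: F_def prod.lessThan_Suc_shift del: prod.lessThan_Suc)
    qed
  qed
  also have "\<dots> = (\<Sum>\<sigma> | \<sigma> permutes {..<2 * r}. A 0 1 * G \<sigma>)"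
  proof -
    let ?h = "map_permutation {..<2 * r} (\<lambda>i. i + 2)"
    have bb: "bij_betw (\<lambda>i. i + 2) {..<2 * r} {2..<n}"
      by (rule bij_betw_byWitness[where f' = "\<lambda>i. i - 2"]) (auto simp: n_def)
    have Fh: "F (?h \<sigma>) = A 0 1 * G \<sigma>" if s: "\<sigma> permutes {..<2 * r}" for \<sigma>
    proof -
      have ap: "?h \<sigma> (i + 2) = \<sigma> i + 2" if "i < 2 * r" for i
        using that by (subst map_permutation_apply) (auto simp: inj_on_def)
      have p: "?h \<sigma> permutes {2..<n}" by (rule map_permutation_permutes[OF bb s])
      have "?h \<sigma> 0 = 0" "?h \<sigma> 1 = 1" by (rule permutes_not_in[OF p]; simp)+
      moreover have "sign (?h \<sigma>) = sign \<sigma>"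
        using s by (intro sign_map_permutation) (auto simp: inj_on_def)
      moreover have "A (?h \<sigma> (2 * Suc i)) (?h \<sigma> (2 * Suc i + 1))
        = A (\<sigma> (2 * i) + 2) (\<sigma> (2 * i + 1) + 2)" if "i < r" for i
        using ap[of "2 * i"] ap[of "2 * i + 1"] that by simp
      ultimately show "F (?h \<sigma>) = A 0 1 * G \<sigma>"
        by (simp add: F_def G_def prod.lessThan_Suc_shift del: prod.lessThan_Suc)
    qed
    show ?thesis unfolding sum_map_permutation[OF bb] by (intro sum.cong refl Fh) simp
  qed
  also have "\<dots> = A 0 1 * (2 ^ r * fact r * pfaffian r (\<lambda>i j. A (i + 2) (j + 2)))"
    unfolding pfaffian_mult G_def sum_distrib_left ..
  finally have "2 ^ Suc r * fact (Suc r) * pfaffian (Suc r) A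
    = 2 ^ Suc r * fact (Suc r) * (A 0 1 * pfaffian r (\<lambda>i j. A (i + 2) (j + 2)))"
    by (simp add: algebra_simps)
  then show ?thesis by (simp del: fact_Suc power_Suc of_nat_Suc)
qed

lemma pf_list_Cons_Cons:
  assumes anti: "\<And>a b. A a b = - A b a" and zero: "\<And>z. z \<in> set zs \<Longrightarrow> A x z = 0"
    and even: "even (length zs)"
  shows "pf_list A (x # y # zs) = A x y * pf_list A zs"
proof -
  obtain r where r: "length zs = 2 * r" using even by (auto elim: evenE)
  have "pfaffian (Suc r) (\<lambda>i j. A ((x # y # zs) ! i) ((x # y # zs) ! j))
    = A x y * pfaffian r (\<lambda>i j. A ((x # y # zs) ! (i + 2)) ((x # y # zs) ! (j + 2)))"
  proof (subst pfaffian_Suc)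
    fix j assume "2 \<le> j" "j < 2 * Suc r"
    then have "(x # y # zs) ! j \<in> set zs" using r by (auto simp: nth_Cons' )
    then show "A ((x # y # zs) ! 0) ((x # y # zs) ! j) = 0" using zero by simp
  next
    fix i j show "A ((x # y # zs) ! i) ((x # y # zs) ! j) = - A ((x # y # zs) ! j) ((x # y # zs) ! i)"
      by (rule anti)
  qed simp
  then show ?thesis by (simp add: pf_list_def r)
qed

lemma pf_list_zero_row:
  assumes "x \<in> set xs" "even (length xs)" "\<And>z. z \<in> set xs \<Longrightarrow> A x z = 0 \<and> A z x = 0"
  shows "pf_list A xs = 0"
proof -
  obtain k where "k < length xs" "xs ! k = x" using assms(1) by (auto simp: in_set_conv_nth)
  then show ?thesis
    unfolding pf_list_def by (intro pfaffian_zero_row[of k]) (use assms in auto)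
qed

lemma pf_list_Nil: "pf_list A [] = 1"
  by (simp add: pf_list_def pfaffian_def)

lemma pf_list_map: "pf_list A (map f xs) = pf_list (\<lambda>a b. A (f a) (f b)) xs"
  unfolding pf_list_def length_map by (rule pfaffian_cong) auto

lemma prod_list_nth: "(\<Prod>i<length xs. f (xs ! i)) = prod_list (map f xs)"
  by (simp add: prod.list_conv_set_nth atLeast0LessThan)

lemma pf_list_scale:
  assumes "even (length xs)"
  shows "pf_list (\<lambda>a b. c * d a * d b * A a b) xs
    = c ^ (length xs div 2) * prod_list (map d xs) * pf_list A xs"
  using pfaffian_scale[of "length xs div 2" c "\<lambda>i. d (xs ! i)" "\<lambda>i j. A (xs ! i) (xs ! j)"] assms
  by (simp add: pf_list_def prod_list_nth)

section \<open>Pairs and singles\<close>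

text \<open>
  The alternating matrix on symbols \<open>Inl i\<close>, \<open>Inr i\<close> in which
  \<open>Inl i\<close> is coupled only to its partner \<open>Inr i\<close>, with weight
  \<open>\<epsilon> i\<close>, while the symbols \<open>Inr\<close> are coupled among each other by
  \<open>A\<close>.
\<close>

fun pairing :: "(nat \<Rightarrow> 'a) \<Rightarrow> (nat \<Rightarrow> nat \<Rightarrow> 'a) \<Rightarrow> nat + nat \<Rightarrow> nat + nat \<Rightarrow> 'a::field_char_0"
where
  "pairing \<epsilon> A (Inl i) (Inl j) = 0"
| "pairing \<epsilon> A (Inl i) (Inr j) = (if i = j then \<epsilon> i else 0)"
| "pairing \<epsilon> A (Inr i) (Inl j) = (if i = j then - \<epsilon> i else 0)"
| "pairing \<epsilon> A (Inr i) (Inr j) = A i j"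

definition in_pairs :: "('b \<Rightarrow> 'c) \<Rightarrow> ('b \<Rightarrow> 'c) \<Rightarrow> 'b list \<Rightarrow> 'c list" where
  "in_pairs p q xs = concat (map (\<lambda>i. [p i, q i]) xs)"

lemma in_pairs_simps [simp]:
  "in_pairs p q [] = []" "in_pairs p q (x # xs) = p x # q x # in_pairs p q xs"
  "map f (in_pairs p q xs) = in_pairs (f \<circ> p) (f \<circ> q) xs"
  "length (in_pairs p q xs) = 2 * length xs"
  "set (in_pairs p q xs) = p ` set xs \<union> q ` set xs"
  unfolding in_pairs_def by (induction xs) auto

lemma distinct_in_pairs_sum: "distinct (in_pairs Inl Inr xs) \<longleftrightarrow> distinct xs"
  by (induction xs) auto

text \<open>
  A symbol \<open>Inl i\<close> has only one possible partner, so the pairs split off one after the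
  other.
\<close>

lemma pf_list_pairing:
  assumes anti: "\<And>a b. A a b = - A b a" and "distinct xs" "set xs \<inter> set ys = {}"
    and even: "even (length ys)"
  shows "pf_list (pairing \<epsilon> A) (in_pairs Inl Inr xs @ map Inr ys)
    = prod_list (map \<epsilon> xs) * pf_list A ys"
  using assms(2,3)
proof (induction xs)
  case Nil
  then show ?case by (simp add: pf_list_map)
next
  case (Cons x xs)
  have anti': "pairing \<epsilon> A a b = - pairing \<epsilon> A b a" for a b
    by (cases a; cases b) (simp_all add: anti[symmetric])
  have "pf_list (pairing \<epsilon> A) (Inl x # Inr x # in_pairs Inl Inr xs @ map Inr ys)
    = pairing \<epsilon> A (Inl x) (Inr x) * pf_list (pairing \<epsilon> A) (in_pairs Inl Inr xs @ map Inr ys)"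
    by (rule pf_list_Cons_Cons[OF anti']) (use Cons even in auto)
  then show ?case using Cons by simp
qed

definition select :: "nat set \<Rightarrow> nat list \<Rightarrow> nat list" where
  "select K xs = filter (\<lambda>i. i \<in> K) xs"

lemma select_simps [simp]:
  "select K [] = []" "select K (x # xs) = (if x \<in> K then x # select K xs else select K xs)"
  "set (select K xs) = K \<inter> set xs"  "distinct xs \<Longrightarrow> distinct (select K xs)"
  "select K (xs @ ys) = select K xs @ select K ys"
  by (auto simp: select_def)

lemma prod_list_select:
  assumes "distinct xs" "K \<subseteq> set xs"
  shows "prod_list (map f (select K xs)) = prod f K"
  using prod.distinct_set_conv_list[of "select K xs" f] assms by (simp add: Int_absorb2)

lemma length_select: "distinct xs \<Longrightarrow> K \<subseteq> set xs \<Longrightarrow> length (select K xs) = card K"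
  using distinct_card[of "select K xs"] by (simp add: Int_absorb2)

text \<open>
  The minor summation formula for the matrix \<open>pairing\<close>. A set of symbols has a nonzero
  Pfaffian only if with \<open>Inl i\<close> it contains \<open>Inr i\<close>. It is then given by
  the set \<open>K\<close> of pairs and the set \<open>J\<close> of those \<open>i\<close> for which
  only \<open>Inr i\<close> is present.
\<close>

theorem sum_pairs_singles:
  fixes p q :: "nat \<Rightarrow> nat \<Rightarrow> 'a::field_char_0"
  assumes anti: "\<And>a b. A a b = - A b a" and xs: "distinct xs"
  shows "(\<Sum>(K, J) | K \<subseteq> set xs \<and> J \<subseteq> set xs \<and> K \<inter> J = {} \<and> 2 * card K + card J = 2 * r.
      (\<Prod>i\<in>K. \<epsilon> i) * pf_list A (select J xs) * rows_det (in_pairs p q (select K xs) @ map q (select J xs)))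
    = pfaffian r (\<lambda>c d. (\<Sum>i\<in>set xs. \<epsilon> i * (p i c * q i d - q i c * p i d))
        + (\<Sum>a\<in>set xs. \<Sum>b\<in>set xs. A a b * q a c * q b d))"
proof -
  let ?I = "set xs" and ?P = "pairing \<epsilon> A"
  define Z where "Z = ?I <+> ?I"
  define V where "V x = (case x of Inl i \<Rightarrow> p i | Inr i \<Rightarrow> q i)" for x
  define K where "K S = {i. Inl i \<in> S}" for S :: "(nat + nat) set"
  define J where "J S = {i. Inr i \<in> S \<and> Inl i \<notin> S}" for S :: "(nat + nat) set"
  define closed where "closed S \<longleftrightarrow> (\<forall>i. Inl i \<in> S \<longrightarrow> Inr i \<in> S)" for S :: "(nat + nat) set"
  \<comment> \<open>Sets with zero Pfaffian may be listed in any order.\<close>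
  define L where "L S = (if closed S then in_pairs Inl Inr (select (K S) xs) @ map Inr (select (J S) xs)
    else (SOME ys. distinct ys \<and> set ys = S))" for S
  have sub: "K S \<subseteq> ?I" "J S \<subseteq> ?I" if "S \<subseteq> Z" for S
    using that by (auto simp: K_def J_def Z_def)
  have finZ: "finite Z" by (simp add: Z_def)
  have L: "distinct (L S) \<and> set (L S) = S" if S: "S \<subseteq> Z" for S
  proof (cases "closed S")
    case True
    have "x \<in> Inl ` (K S) \<union> Inr ` (K S) \<union> Inr ` (J S) \<longleftrightarrow> x \<in> S" for x
      using True by (cases x) (auto simp: K_def J_def closed_def)
    then have "Inl ` (K S) \<union> Inr ` (K S) \<union> Inr ` (J S) = S" by blast
    moreover have "K S \<inter> J S = {}" by (auto simp: K_def J_def)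
    ultimately show ?thesis
      using True sub[OF S] xs
      by (auto simp: L_def distinct_in_pairs_sum distinct_map Int_absorb2)
  next
    case False
    have "\<exists>ys. distinct ys \<and> set ys = S"
      using finite_distinct_list[OF finite_subset[OF S finZ]] by blast
    then show ?thesis using someI_ex False by (simp add: L_def)
  qed
  have anti': "?P a b = - ?P b a" for a b
    by (cases a; cases b) (simp_all add: anti[symmetric])
  have cardS: "card (Inl ` K \<union> Inr ` (K \<union> J)) = 2 * card K + card J"
    if "K \<subseteq> ?I" "J \<subseteq> ?I" "K \<inter> J = {}" for K J :: "nat set"
  proof -
    have f: "finite K" "finite J" using that by (auto intro: finite_subset)
    have "card (Inl ` K \<union> Inr ` (K \<union> J) :: (nat + nat) set) = card (Inl ` K :: (nat + nat) set) + card (Inr ` (K \<union> J) :: (nat + nat) set)"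
      using f by (intro card_Un_disjoint) auto
    also have "\<dots> = card K + card (K \<union> J)" by (simp add: card_image)
    finally show ?thesis using f that by (simp add: card_Un_disjoint)
  qed
  have "pfaffian r (\<lambda>c d. \<Sum>a\<in>Z. \<Sum>b\<in>Z. ?P a b * V a c * V b d)
    = (\<Sum>S | S \<subseteq> Z \<and> card S = 2 * r. pf_list ?P (L S) * rows_det (map V (L S)))"
    using pfaffian_minor_sum[OF finZ, of r L ?P V] L by simp
  also have "\<dots> = (\<Sum>S | S \<subseteq> Z \<and> card S = 2 * r \<and> closed S. pf_list ?P (L S) * rows_det (map V (L S)))"
  proof (rule sum.mono_neutral_right)
    show "\<forall>S\<in>{S. S \<subseteq> Z \<and> card S = 2 * r} - {S. S \<subseteq> Z \<and> card S = 2 * r \<and> closed S}.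
      pf_list ?P (L S) * rows_det (map V (L S)) = 0"
    proof
      fix S assume "S \<in> {S. S \<subseteq> Z \<and> card S = 2 * r} - {S. S \<subseteq> Z \<and> card S = 2 * r \<and> closed S}"
      then have S: "S \<subseteq> Z" "card S = 2 * r" "\<not> closed S" by auto
      then obtain i where i: "Inl i \<in> S" "Inr i \<notin> S" by (auto simp: closed_def)
      have "?P (Inl i) z = 0" if "z \<in> S" for z using that i by (cases z) auto
      moreover have "even (length (L S))"
        using L[OF S(1)] S(2) distinct_card[of "L S"] by (metis dvd_triv_left)
      ultimately have "pf_list ?P (L S) = 0"
        using L[OF S(1)] i anti'[of _ "Inl i"]
        by (intro pf_list_zero_row[of "Inl i"]) auto
      then show "pf_list ?P (L S) * rows_det (map V (L S)) = 0" by simp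
    qed
  qed (use finZ in auto)
  also have "\<dots> = (\<Sum>(K, J) | K \<subseteq> ?I \<and> J \<subseteq> ?I \<and> K \<inter> J = {} \<and> 2 * card K + card J = 2 * r.
      (\<Prod>i\<in>K. \<epsilon> i) * pf_list A (select J xs) * rows_det (in_pairs p q (select K xs) @ map q (select J xs)))"
  proof (rule sum.reindex_bij_witness[where i = "\<lambda>(K, J). Inl ` K \<union> Inr ` (K \<union> J)"
        and j = "\<lambda>S. (K S, J S)"], goal_cases)
    case (1 S)
    have "x \<in> Inl ` (K S) \<union> Inr ` (K S \<union> J S) \<longleftrightarrow> x \<in> S" for x
      using 1 by (cases x) (auto simp: K_def J_def closed_def)
    then show ?case by auto
  next
    case (2 S)
    have "x \<in> Inl ` (K S) \<union> Inr ` (K S \<union> J S) \<longleftrightarrow> x \<in> S" for x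
      using 2 by (cases x) (auto simp: K_def J_def closed_def)
    then have "Inl ` (K S) \<union> Inr ` (K S \<union> J S) = S" by blast
    moreover have "K S \<inter> J S = {}" by (auto simp: K_def J_def)
    ultimately show ?case using 2 sub[of S] cardS[of "K S" "J S"] by auto
  next
    case (3 KJ)
    then show ?case by (auto simp: K_def J_def)
  next
    case (4 KJ)
    then show ?case using cardS[of "fst KJ" "snd KJ"] by (auto simp: Z_def closed_def)
  next
    case (5 S)
    then have S: "S \<subseteq> Z" "card S = 2 * r" "closed S" by auto
    have d: "K S \<inter> J S = {}" by (auto simp: K_def J_def)
    have "Inl ` (K S) \<union> Inr ` (K S \<union> J S) = set (L S)"
      using S(3) sub[OF S(1)] by (auto simp: L_def Int_absorb2)
    then have "2 * card (K S) + card (J S) = 2 * r"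
      using L[OF S(1)] S(2) cardS[of "K S" "J S"] sub[OF S(1)] d by simp
    then have "even (card (J S))" by presburger
    then have ev: "even (length (select (J S) xs))" using sub[OF S(1)] xs by (simp add: length_select)
    have "pf_list ?P (L S) = prod_list (map \<epsilon> (select (K S) xs)) * pf_list A (select (J S) xs)"
      using S(3) pf_list_pairing[of A "select (K S) xs" "select (J S) xs" \<epsilon>, OF anti] xs d ev
      by (auto simp: L_def)
    moreover have "V \<circ> Inl = p" "V \<circ> Inr = q" by (auto simp: V_def fun_eq_iff)
    then have "map V (L S) = in_pairs p q (select (K S) xs) @ map q (select (J S) xs)"
      using S(3) by (simp add: L_def)
    ultimately show ?case
      using sub[OF S(1)] xs by (simp add: prod_list_select)
  qed
  also have "(\<lambda>c d. \<Sum>a\<in>Z. \<Sum>b\<in>Z. ?P a b * V a c * V b d)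
    = (\<lambda>c d. (\<Sum>i\<in>set xs. \<epsilon> i * (p i c * q i d - q i c * p i d))
        + (\<Sum>a\<in>set xs. \<Sum>b\<in>set xs. A a b * q a c * q b d))"
    by (intro ext)
      (simp add: Z_def V_def sum.Plus if_distrib[of "\<lambda>x. x * _"] cong: if_cong,
       simp add: algebra_simps sum.distrib sum_subtractf sum_negf)
  finally show ?thesis ..
qed

section \<open>Signs of nested orders\<close>

text \<open>
  The order in which a decreasing list of integers shows pairs \<open>i, - i\<close> and singles
  \<open>- i\<close> for decreasing \<open>i\<close> in \<open>xs\<close>: positive members on the
  left, negative ones on the right, and \<open>zs\<close> in the middle.
\<close>

fun nested :: "nat set \<Rightarrow> nat set \<Rightarrow> (nat \<Rightarrow> 'c) \<Rightarrow> (nat \<Rightarrow> 'c) \<Rightarrow> 'c list \<Rightarrow> nat list \<Rightarrow> 'c list" where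
  "nested K J p q zs [] = zs"
| "nested K J p q zs (i # xs) =
    (if i \<in> K then p i # nested K J p q zs xs @ [q i]
     else if i \<in> J then nested K J p q zs xs @ [q i] else nested K J p q zs xs)"

text \<open>
  When the pairs are made adjacent from the outside inwards, the right member of a pair passes whole
  pairs, which costs no sign, the singles inside, and the \<open>z\<close> rows in the middle; a
  single passes the latter two as well.
\<close>

fun crossings :: "nat set \<Rightarrow> nat set \<Rightarrow> nat \<Rightarrow> nat list \<Rightarrow> nat" where
  "crossings K J z [] = 0"
| "crossings K J z (i # xs) =
    (if i \<in> K \<or> i \<in> J then z + length (select J xs) else 0) + crossings K J z xs"

lemma length_nested:
  "K \<inter> J = {} \<Longrightarrow> length (nested K J p q zs xs) = 2 * length (select K xs) + length (select J xs) + length zs"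
  by (induction xs) (auto simp: disjoint_iff)

text \<open>
  The outermost entry is treated first, so that the induction hypothesis applies to the nested rest
  with one or two more rows in front or one more row behind it.
\<close>

lemma rows_det_nested:
  assumes "K \<inter> J = {}"
  shows "rows_det (us @ nested K J p q zs xs @ vs) = (- 1) ^ crossings K J (length zs) xs
    * rows_det (us @ in_pairs p q (select K xs) @ map q (select J xs) @ zs @ vs)"
proof (induction xs arbitrary: us vs)
  case (Cons i xs)
  consider "i \<in> K" "i \<notin> J" | "i \<notin> K" "i \<in> J" | "i \<notin> K" "i \<notin> J" using assms by blast
  then show ?case
  proof cases
    case 1
    have "rows_det (us @ nested K J p q zs (i # xs) @ vs) = rows_det ((us @ [p i]) @ nested K J p q zs xs @ q i # vs)"
      using 1 by simp
    also have "\<dots> = (- 1) ^ length (nested K J p q zs xs) * rows_det ((us @ [p i, q i]) @ nested K J p q zs xs @ vs)"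
      using rows_det_move[of "us @ [p i]" "q i" "nested K J p q zs xs" vs]
      by (simp add: power_mult_distrib[symmetric] mult.assoc[symmetric])
    finally show ?thesis
      using 1 Cons[of "us @ [p i, q i]" vs] length_nested[OF assms, of p q zs xs]
      by (simp add: power_add power_mult mult_ac)
  next
    case 2
    have "rows_det (us @ nested K J p q zs (i # xs) @ vs) = rows_det (us @ nested K J p q zs xs @ q i # vs)"
      using 2 by simp
    also have "\<dots> = (- 1) ^ crossings K J (length zs) xs
      * rows_det ((us @ in_pairs p q (select K xs)) @ (map q (select J xs) @ zs) @ q i # vs)"
      using Cons[of us "q i # vs"] by simp
    also have "rows_det ((us @ in_pairs p q (select K xs)) @ (map q (select J xs) @ zs) @ q i # vs)
      = (- 1) ^ (length (select J xs) + length zs) *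
        rows_det ((us @ in_pairs p q (select K xs)) @ q i # (map q (select J xs) @ zs) @ vs)"
      using rows_det_move[of "us @ in_pairs p q (select K xs)" "q i" "map q (select J xs) @ zs" vs]
      by (simp add: power_mult_distrib[symmetric] mult.assoc[symmetric])
    finally show ?thesis using 2 by (simp add: power_add mult_ac)
  next
    case 3
    then show ?thesis using Cons[of us vs] by simp
  qed
qed simp

section \<open>Generating series\<close>

text \<open>
  The exponential generating function that defines both \<open>h_n\<close> and \<open>q_n\<close>;
  the coefficient \<open>t 0\<close> is ignored.
\<close>

definition exp_series :: "(nat \<Rightarrow> 'a::field_char_0) \<Rightarrow> 'a fps" where
  "exp_series t = fps_exp 1 oo Abs_fps (\<lambda>n. if n = 0 then 0 else t n)"

lemma h_fun_exp_series: "h_fun t k = (if k < 0 then 0 else fps_nth (exp_series t) (nat k))"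
  by (simp add: h_fun_def exp_series_def)

lemma q_fun_exp_series: "q_fun s k = fps_nth (exp_series (\<lambda>n. if odd n then s n else 0)) k"
  unfolding q_fun_def exp_series_def
  by (rule arg_cong[where f = "\<lambda>T. fps_nth (fps_exp 1 oo T) k"]) (auto simp: fps_eq_iff)

lemma exp_series_cong: "(\<And>n. n > 0 \<Longrightarrow> a n = b n) \<Longrightarrow> exp_series a = exp_series b"
  unfolding exp_series_def
  by (rule arg_cong[where f = "\<lambda>T. fps_exp 1 oo T"]) (auto simp: fps_eq_iff)

lemma exp_series_0: "exp_series (\<lambda>_. 0) = 1"
proof -
  have "Abs_fps (\<lambda>n. if n = 0 then 0 else 0 :: 'a) = 0" by (simp add: fps_eq_iff)
  then show ?thesis by (simp add: exp_series_def)
qed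

text \<open>
  Both sides solve the same linear differential equation with the same constant term, so their
  quotient has derivative 0.
\<close>

lemma exp_series_add: "exp_series (\<lambda>n. a n + b n) = exp_series a * exp_series b"
proof -
  let ?T = "\<lambda>t. Abs_fps (\<lambda>n. if n = 0 then 0 else t n) :: 'a fps"
  have T: "?T (\<lambda>n. a n + b n) = ?T a + ?T b" by (auto simp: fps_eq_iff)
  have d: "fps_deriv (exp_series t) = fps_deriv (?T t) * exp_series t" for t :: "nat \<Rightarrow> 'a"
    unfolding exp_series_def by (subst fps_compose_deriv) (auto simp: mult.commute)
  define R where "R = exp_series (\<lambda>n. a n + b n)"
  define S where "S = exp_series a * exp_series b"
  have R0: "fps_nth R 0 = 1" "fps_nth S 0 = 1" by (simp_all add: R_def S_def exp_series_def)
  have dR: "fps_deriv R = fps_deriv (?T a + ?T b) * R"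
    unfolding R_def d T ..
  have dS: "fps_deriv S = fps_deriv (?T a + ?T b) * S"
    unfolding S_def by (simp add: d algebra_simps)
  have "fps_deriv (S * inverse R) = 0"
  proof -
    have "fps_deriv (S * inverse R) = fps_deriv S * inverse R + S * fps_deriv (inverse R)"
      by (simp add: algebra_simps)
    also have "fps_deriv (inverse R) = - fps_deriv R * (inverse R)\<^sup>2"
      by (rule fps_inverse_deriv) (simp add: R0)
    also have "fps_deriv S * inverse R + S * (- fps_deriv R * (inverse R)\<^sup>2)
        = fps_deriv (?T a + ?T b) * S * inverse R * (1 - R * inverse R)"
      unfolding dR dS by (simp add: algebra_simps power2_eq_square)
    also have "R * inverse R = 1"
      by (simp add: R0 inverse_mult_eq_1' )
    finally show ?thesis by simp
  qed
  then have "S * inverse R = fps_const (fps_nth (S * inverse R) 0)"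
    by (metis fps_deriv_eq_0_iff)
  also have "\<dots> = 1" by (simp add: R0)
  finally have "S * inverse R * R = R" by simp
  then show ?thesis
    unfolding R_def[symmetric] S_def[symmetric] by (simp add: mult.assoc inverse_mult_eq_1 R0)
qed

lemma exp_series_alternate: "fps_nth (exp_series (\<lambda>n. (- 1) ^ n * t n)) k = (- 1) ^ k * fps_nth (exp_series t) k"
proof -
  let ?T = "Abs_fps (\<lambda>n. if n = 0 then 0 else t n)"
  have "exp_series t oo (- fps_X) = fps_exp 1 oo (?T oo (- fps_X))"
    unfolding exp_series_def by (subst fps_compose_assoc) auto
  also have "?T oo (- fps_X) = Abs_fps (\<lambda>n. if n = 0 then 0 else (- 1) ^ n * t n)"
    by (auto simp: fps_eq_iff fps_compose_uminus')
  finally show ?thesis by (simp add: exp_series_def fps_compose_uminus' fps_eq_iff)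
qed

lemma fps_nth_compose_X_square:
  "fps_nth (f oo (fps_X\<^sup>2 :: 'a::field_char_0 fps)) n = (if even n then fps_nth f (n div 2) else 0)"
proof -
  have "fps_nth (f oo (fps_X\<^sup>2 :: 'a fps)) n = (\<Sum>i = 0..n. if i = n div 2 \<and> even n then fps_nth f i else 0)"
    unfolding fps_compose_nth power_mult[symmetric] fps_X_power_nth
    by (intro sum.cong refl) auto
  then show ?thesis by (simp add: sum.delta')
qed

lemma exp_series_double:
  "fps_nth (exp_series (\<lambda>n. if even n then t (n div 2) else 0)) k = (if even k then fps_nth (exp_series t) (k div 2) else 0)"
proof -
  let ?T = "Abs_fps (\<lambda>n. if n = 0 then 0 else t n)"
  have "exp_series t oo (fps_X\<^sup>2) = fps_exp 1 oo (?T oo (fps_X\<^sup>2))"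
    unfolding exp_series_def by (subst fps_compose_assoc) auto
  also have "?T oo (fps_X\<^sup>2) = Abs_fps (\<lambda>n. if n = 0 then 0 else if even n then t (n div 2) else 0)"
    by (auto simp: fps_eq_iff fps_nth_compose_X_square)
  finally have "exp_series (\<lambda>n. if even n then t (n div 2) else 0) = exp_series t oo (fps_X\<^sup>2)"
    by (simp add: exp_series_def)
  then show ?thesis by (simp add: fps_nth_compose_X_square)
qed

text \<open>
  In the exponent of \<open>H(- z) * H(z)\<close> the terms of odd degree cancel and those of
  even degree double. This accounts for \<open>2 t^(2)\<close> in the theorem and, for exponents
  with odd terms only, for \<open>q(z) * q(- z) = 1\<close>.
\<close>

lemma alternating_convolution:
  "(\<Sum>j\<le>n. (- 1) ^ j * fps_nth (exp_series t) j * fps_nth (exp_series t) (n - j))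
    = fps_nth (exp_series (\<lambda>n. if even n then 2 * t n else 0)) n"
proof -
  have "exp_series (\<lambda>n. if even n then 2 * t n else 0)
    = exp_series (\<lambda>n. (- 1) ^ n * t n) * exp_series t"
    by (subst exp_series_add[symmetric]) (auto intro: exp_series_cong)
  then show ?thesis
    by (simp add: fps_mult_nth exp_series_alternate atLeast0AtMost)
qed

lemma h_fun_neg: "k < 0 \<Longrightarrow> h_fun t k = 0"
  by (simp add: h_fun_def)

lemma h_fun_convolution:
  "(\<Sum>j\<le>n. (- 1) ^ j * h_fun t (int j) * h_fun t (int n - int j))
    = fps_nth (exp_series (\<lambda>n. if even n then 2 * t n else 0)) n"
proof -
  have "(\<Sum>j\<le>n. (- 1) ^ j * h_fun t (int j) * h_fun t (int n - int j))
    = (\<Sum>j\<le>n. (- 1) ^ j * fps_nth (exp_series t) j * fps_nth (exp_series t) (n - j))"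
    by (intro sum.cong refl) (auto simp: h_fun_exp_series nat_diff_distrib)
  then show ?thesis by (simp add: alternating_convolution)
qed

lemma q_fun_convolution: "(\<Sum>j\<le>n. (- 1) ^ j * q_fun s j * q_fun s (n - j)) = (if n = 0 then 1 else 0)"
proof -
  have "exp_series (\<lambda>n. if even n then 2 * (if odd n then s n else 0) else 0) = 1"
    by (subst exp_series_0[symmetric]) (rule exp_series_cong, auto)
  then show ?thesis by (simp add: q_fun_exp_series alternating_convolution)
qed

lemma q_fun_0: "q_fun s 0 = 1"
  by (simp add: q_fun_exp_series exp_series_def)

lemma q_fun_zero: "q_fun (\<lambda>_. 0) n = (if n = 0 then 1 else 0)"
  by (simp add: q_fun_exp_series exp_series_0)

text \<open>
  The family \<open>u\<close> of the theorem. Its series is \<open>H(z) * q(- z)\<close>.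
\<close>

definition twist :: "(nat \<Rightarrow> 'a::field_char_0) \<Rightarrow> (nat \<Rightarrow> 'a) \<Rightarrow> nat \<Rightarrow> 'a" where
  "twist s t = (\<lambda>j. if even j then t j else t j - s j)"

lemma h_fun_twist:
  assumes "k \<le> int N"
  shows "h_fun (twist s t) k = (\<Sum>i\<le>N. (- 1) ^ i * q_fun s i * h_fun t (k - int i))"
proof (cases "k < 0")
  case True
  then show ?thesis by (simp add: h_fun_neg)
next
  case False
  have "exp_series (twist s t) = exp_series (\<lambda>n. (- 1) ^ n * (if odd n then s n else 0)) * exp_series t"
    by (subst exp_series_add[symmetric]) (auto intro!: exp_series_cong simp: twist_def)
  then have "h_fun (twist s t) k = (\<Sum>i\<le>nat k. (- 1) ^ i * q_fun s i * fps_nth (exp_series t) (nat k - i))"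
    using False by (simp add: h_fun_exp_series fps_mult_nth exp_series_alternate q_fun_exp_series atLeast0AtMost)
  also have "\<dots> = (\<Sum>i\<le>nat k. (- 1) ^ i * q_fun s i * h_fun t (k - int i))"
    using False by (intro sum.cong refl) (auto simp: h_fun_exp_series nat_diff_distrib')
  also have "\<dots> = (\<Sum>i\<le>N. (- 1) ^ i * q_fun s i * h_fun t (k - int i))"
    using assms by (intro sum.mono_neutral_left) (auto simp: h_fun_neg)
  finally show ?thesis .
qed

lemma h_fun_twist_convolution:
  "(\<Sum>j\<le>n. (- 1) ^ j * h_fun (twist s t) (int j) * h_fun (twist s t) (int n - int j))
    = (\<Sum>j\<le>n. (- 1) ^ j * h_fun t (int j) * h_fun t (int n - int j))"
  unfolding h_fun_convolution by (auto intro!: arg_cong[where f = "\<lambda>F. fps_nth F n"] exp_series_cong simp: twist_def)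

section \<open>Two-row Schur Q-functions\<close>

text \<open>
  The sum in the definition of \<open>Q_{a,b}\<close>, kept for all \<open>a\<close> and
  \<open>b\<close>. In this form the two cases of \<open>Q_{a,b}\<close> become one antisymmetric
  expression.
\<close>

definition Q_half :: "(nat \<Rightarrow> 'a::field_char_0) \<Rightarrow> nat \<Rightarrow> nat \<Rightarrow> 'a" where
  "Q_half s a b = (\<Sum>i = 1..b. (- 1) ^ i * q_fun s (a + i) * q_fun s (b - i))"

text \<open>
  The two half sums and the middle term together make up a coefficient of
  \<open>q(z) * q(- z) = 1\<close>.
\<close>

lemma Q_half_add:
  assumes "a + b > 0"
  shows "Q_half s a b + q_fun s a * q_fun s b + Q_half s b a = 0"
proof -
  let ?f = "\<lambda>j. (- 1) ^ j * q_fun s j * q_fun s (a + b - j)"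
  have "(\<Sum>j\<le>a + b. ?f j) = (\<Sum>j<a. ?f j) + ?f a + (\<Sum>j\<in>{a<..a + b}. ?f j)"
  proof -
    have "{..a + b} = ({..<a} \<union> {a}) \<union> {a<..a + b}" by auto
    then show ?thesis by (simp add: sum.union_disjoint disjoint_iff)
  qed
  also have "(\<Sum>j<a. ?f j) = (- 1) ^ a * Q_half s b a"
    unfolding Q_half_def sum_distrib_left
  proof (rule sum.reindex_bij_witness[where i = "\<lambda>i. a - i" and j = "\<lambda>j. a - j"], goal_cases)
    case (5 j)
    then have "j \<le> a" by simp
    then obtain k where "a = j + k" using le_Suc_ex by blast
    then show ?case by (simp add: power_add mult_ac add_ac)
  qed auto
  also have "(\<Sum>j\<in>{a<..a + b}. ?f j) = (- 1) ^ a * Q_half s a b"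
    unfolding Q_half_def sum_distrib_left
  proof (rule sum.reindex_bij_witness[where i = "\<lambda>i. a + i" and j = "\<lambda>j. j - a"], goal_cases)
    case (5 j)
    then have "a \<le> j" by simp
    then obtain k where "j = a + k" using le_Suc_ex by blast
    then show ?case by (simp add: power_add mult_ac)
  qed auto
  also have "(\<Sum>j\<le>a + b. ?f j) = 0" using q_fun_convolution[of s "a + b"] assms by simp
  finally have "(- 1) ^ a * (Q_half s a b + q_fun s a * q_fun s b + Q_half s b a) = 0"
    by (simp add: algebra_simps)
  then show ?thesis by simp
qed

lemma Q2_half: "Q2 s a b = Q_half s a b - Q_half s b a"
proof -
  consider "a = b" | "a > b" | "a < b" by linarith
  then show ?thesis
  proof cases
    case 2
    then have "Q_half s a b + q_fun s a * q_fun s b + Q_half s b a = 0" by (intro Q_half_add) simp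
    then have "Q_half s b a = - (Q_half s a b + q_fun s a * q_fun s b)" by (simp only: add_eq_0_iff)
    then show ?thesis using \<open>a > b\<close>
      unfolding Q2_def Q_pos_def Q_half_def[symmetric] by simp
  next
    case 3
    then have "Q_half s b a + q_fun s b * q_fun s a + Q_half s a b = 0" by (intro Q_half_add) simp
    then have "Q_half s a b = - (Q_half s b a + q_fun s b * q_fun s a)" by (simp only: add_eq_0_iff)
    then show ?thesis using \<open>a < b\<close>
      unfolding Q2_def Q_pos_def Q_half_def[symmetric] by simp
  qed (simp add: Q2_def)
qed

lemma Q_half_rec: "Q_half s a (Suc b) + Q_half s (Suc a) b = - q_fun s (Suc a) * q_fun s b"
proof -
  have "Q_half s a (Suc b) = - q_fun s (Suc a) * q_fun s b
      + (\<Sum>i = Suc 1..Suc b. (- 1) ^ i * q_fun s (a + i) * q_fun s (Suc b - i))"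
    unfolding Q_half_def by (subst sum.atLeast_Suc_atMost) simp_all
  also have "(\<Sum>i = Suc 1..Suc b. (- 1) ^ i * q_fun s (a + i) * q_fun s (Suc b - i)) = - Q_half s (Suc a) b"
    unfolding Q_half_def by (subst sum.shift_bounds_cl_Suc_ivl) (simp add: sum_negf)
  finally show ?thesis by simp
qed

text \<open>
  The coefficientwise form of
  \<open>(z + w) * Q(z, w) = (z - w) * (q(z) * q(w) - 1)\<close>, away from the axes.
\<close>

lemma Q2_rec: "Q2 s a (Suc b) + Q2 s (Suc a) b = q_fun s a * q_fun s (Suc b) - q_fun s (Suc a) * q_fun s b"
  using Q_half_rec[of s a b] Q_half_rec[of s b a] unfolding Q2_half by (simp add: algebra_simps)

lemma Q2_anti: "Q2 s a b = - Q2 s b a"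
  by (simp add: Q2_def)

lemma Q2_0_right: "Q2 s a 0 = (if a = 0 then 0 else q_fun s a)"
  by (simp add: Q2_def Q_pos_def q_fun_0)

lemma Q2_zero: "Q2 (\<lambda>_. 0) a b = 0"
  by (auto simp: Q2_def Q_pos_def q_fun_zero)

section \<open>The alternating form of a sequence\<close>

text \<open>
  With \<open>V_x = (h (x + c))_c\<close>, this is the \<open>c, d\<close> entry of the 2-form
  \<open>\<Sum>i. (- 1)^(i + 1) V_i \<and> V_{- i}\<close>. If \<open>h\<close> vanishes at
  negative arguments, the cutoff \<open>N\<close> does not matter once it is at least
  \<open>c\<close> and \<open>d\<close>.
\<close>

definition skew_form :: "nat \<Rightarrow> (int \<Rightarrow> 'a::field_char_0) \<Rightarrow> int \<Rightarrow> int \<Rightarrow> 'a" where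
  "skew_form N h c d = (\<Sum>i\<le>N. (- 1) ^ Suc i * (h (c + int i) * h (d - int i) - h (c - int i) * h (d + int i)))"

text \<open>
  In the notation above, the \<open>c, d\<close> entry of
  \<open>\<Sum>a b. (- 1)^(a + b) Q a b (V_{- a} \<otimes> V_{- b})\<close>.
\<close>

definition Q_form :: "nat \<Rightarrow> (nat \<Rightarrow> nat \<Rightarrow> 'a) \<Rightarrow> (int \<Rightarrow> 'a::field_char_0) \<Rightarrow> int \<Rightarrow> int \<Rightarrow> 'a" where
  "Q_form N Q h c d = (\<Sum>a\<le>N. \<Sum>b\<le>N. (- 1) ^ (a + b) * Q a b * h (c - int a) * h (d - int b))"

lemma sum_alternating_telescope:
  "(\<Sum>i\<le>N. (- 1) ^ Suc i * (f i + f (Suc i))) = - f 0 + (- 1) ^ Suc N * (f (Suc N) :: 'a::comm_ring_1)"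
  by (induction N) (auto simp: algebra_simps)

text \<open>
  The two shifted sums interlace and telescope, so the form satisfies a recursion whose right hand
  side involves only four values of \<open>h\<close>.
\<close>

lemma skew_form_shift:
  assumes h: "\<And>k. k < 0 \<Longrightarrow> h k = 0" and "c \<le> int N" "d \<le> int N"
  shows "skew_form N h (c - 1) d + skew_form N h c (d - 1) = h c * h (d - 1) - h (c - 1) * h d"
proof -
  let ?f = "\<lambda>i. h (c - 1 + int i) * h (d - int i)" and ?g = "\<lambda>i. h (c - int i) * h (d - 1 + int i)"
  have "skew_form N h (c - 1) d + skew_form N h c (d - 1)
    = (\<Sum>i\<le>N. (- 1) ^ Suc i * (?f i + ?f (Suc i))) - (\<Sum>i\<le>N. (- 1) ^ Suc i * (?g i + ?g (Suc i)))"
    unfolding skew_form_def sum.distrib[symmetric] sum_subtractf[symmetric]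
    by (intro sum.cong refl) (simp add: algebra_simps)
  also have "\<dots> = h c * h (d - 1) - h (c - 1) * h d"
    unfolding sum_alternating_telescope[of ?f N] sum_alternating_telescope[of ?g N] using assms by simp
  finally show ?thesis .
qed

text \<open>
  For a negative first argument only one of the two products survives, and the sum over
  \<open>i\<close> is a complete alternating convolution.
\<close>

lemma skew_form_neg:
  assumes h: "\<And>k. k < 0 \<Longrightarrow> h k = 0" and "k > 0" "d \<le> int N"
  shows "skew_form N h (- int k) d
    = (if d < int k then 0 else (- 1) ^ Suc k * (\<Sum>j\<le>nat (d - int k). (- 1) ^ j * h (int j) * h (d - int k - int j)))"
    (is "_ = ?R")
proof -
  have "skew_form N h (- int k) d = (\<Sum>i\<le>N. (- 1) ^ Suc i * (h (int i - int k) * h (d - int i)))"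
    unfolding skew_form_def using assms(1,2) by (intro sum.cong refl) simp
  also have "\<dots> = ?R"
  proof (cases "d < int k")
    case True
    then have "h (int i - int k) * h (d - int i) = 0" for i
      using h[of "int i - int k"] h[of "d - int i"] by (cases "i < k") auto
    then show ?thesis using True by (simp only: if_True mult_zero_right sum.neutral_const)
  next
    case False
    have z: "h (int i - int k) * h (d - int i) = 0" if "i \<notin> {k..nat d}" for i
      using that h[of "int i - int k"] h[of "d - int i"] by (cases "i < k") auto
    have "(\<Sum>i\<le>N. (- 1) ^ Suc i * (h (int i - int k) * h (d - int i)))
      = (\<Sum>i\<in>{k..nat d}. (- 1) ^ Suc i * (h (int i - int k) * h (d - int i)))"
    proof (rule sum.mono_neutral_right)
      show "{k..nat d} \<subseteq> {..N}" using assms by auto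
      show "\<forall>i\<in>{..N} - {k..nat d}. (- 1) ^ Suc i * (h (int i - int k) * h (d - int i)) = 0"
        using z by (metis DiffE mult_zero_right)
    qed simp
    also have "\<dots> = (\<Sum>j\<le>nat (d - int k). (- 1) ^ Suc k * ((- 1) ^ j * h (int j) * h (d - int k - int j)))"
    proof (rule sum.reindex_bij_witness[where i = "\<lambda>j. j + k" and j = "\<lambda>i. i - k"], goal_cases)
      case (5 i)
      then have "k \<le> i" by simp
      then obtain j where "i = k + j" using le_Suc_ex by blast
      then show ?case by (simp add: power_add mult_ac diff_diff_eq)
    qed (use False in auto)
    finally show ?thesis using False by (simp add: sum_distrib_left)
  qed
  finally show ?thesis .
qed

lemma skew_form_mono:
  assumes h: "\<And>k. k < 0 \<Longrightarrow> h k = 0" and "c \<le> int N" "d \<le> int N" "N \<le> N'"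
  shows "skew_form N' h c d = skew_form N h c d"
  unfolding skew_form_def using assms by (intro sum.mono_neutral_right) auto

lemma Q_form_mono:
  assumes h: "\<And>k. k < 0 \<Longrightarrow> h k = 0" and "c \<le> int N" "d \<le> int N" "N \<le> N'"
  shows "Q_form N' Q h c d = Q_form N Q h c d"
proof -
  have "Q_form N' Q h c d = (\<Sum>a\<le>N'. \<Sum>b\<le>N. (- 1) ^ (a + b) * Q a b * h (c - int a) * h (d - int b))"
    unfolding Q_form_def using assms by (intro sum.cong refl sum.mono_neutral_right) auto
  also have "\<dots> = Q_form N Q h c d"
    unfolding Q_form_def using assms by (intro sum.mono_neutral_right) auto
  finally show ?thesis .
qed

lemma sum_shift_mult:
  assumes h: "\<And>k. k < 0 \<Longrightarrow> h k = 0" and "c \<le> int N"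
  shows "(\<Sum>a\<le>N. F a * h (c - 1 - int a)) = (\<Sum>a\<le>N. (if a = 0 then 0 else F (a - 1) * h (c - int a) :: 'a::comm_ring_1))"
proof -
  have "(\<Sum>a\<le>N. F a * h (c - 1 - int a)) = (\<Sum>a\<le>Suc N. (if a = 0 then 0 else F (a - 1) * h (c - int a)))"
    by (subst sum.atMost_Suc_shift) (simp add: algebra_simps)
  also have "\<dots> = (\<Sum>a\<le>N. (if a = 0 then 0 else F (a - 1) * h (c - int a)))"
    using assms by simp
  finally show ?thesis .
qed

text \<open>
  The counterpart of the telescoping recursion. Moving the shifts from \<open>h\<close> to the
  coefficients produces \<open>Q (a - 1) b + Q a (b - 1)\<close>, which factors by the
  recursion for \<open>Q\<close>; the correction terms at
  \<open>(a, b) = (1, 0), (0, 1)\<close> account for the terms in \<open>h\<close>.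
\<close>

lemma Q_form_shift:
  fixes h g :: "int \<Rightarrow> 'a::field_char_0"
  assumes h: "\<And>k. k < 0 \<Longrightarrow> h k = 0" and c: "c \<le> int N" and d: "d \<le> int N" and N: "N \<ge> 1"
    and g: "\<And>k. k \<le> int N \<Longrightarrow> g k = (\<Sum>i\<le>N. (- 1) ^ i * q_fun s i * h (k - int i))"
  shows "Q_form N (Q2 s) h (c - 1) d + Q_form N (Q2 s) h c (d - 1)
    = g (c - 1) * g d - g c * g (d - 1) - h (c - 1) * h d + h c * h (d - 1)"
proof -
  let ?F = "\<lambda>a b. (- 1) ^ (a + b) * h (c - int a) * h (d - int b)"
  let ?q = "q_fun s"
  have 1: "Q_form N (Q2 s) h (c - 1) d = - (\<Sum>a\<le>N. \<Sum>b\<le>N. (if a = 0 then 0 else Q2 s (a - 1) b * ?F a b))"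
  proof -
    have "Q_form N (Q2 s) h (c - 1) d
      = (\<Sum>a\<le>N. (\<Sum>b\<le>N. (- 1) ^ (a + b) * Q2 s a b * h (d - int b)) * h (c - 1 - int a))"
      unfolding Q_form_def by (simp add: sum_distrib_left sum_distrib_right mult_ac)
    also have "\<dots> = (\<Sum>a\<le>N. if a = 0 then 0 else
      (\<Sum>b\<le>N. (- 1) ^ (a - 1 + b) * Q2 s (a - 1) b * h (d - int b)) * h (c - int a))"
      by (rule sum_shift_mult[OF h c])
    also have "\<dots> = (\<Sum>a\<le>N. - (\<Sum>b\<le>N. (if a = 0 then 0 else Q2 s (a - 1) b * ?F a b)))"
    proof (intro sum.cong refl)
      fix a show "(if a = 0 then 0 else
          (\<Sum>b\<le>N. (- 1) ^ (a - 1 + b) * Q2 s (a - 1) b * h (d - int b)) * h (c - int a))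
        = - (\<Sum>b\<le>N. (if a = 0 then 0 else Q2 s (a - 1) b * ?F a b))"
        by (cases a) (simp_all add: sum_distrib_left sum_distrib_right sum_negf mult_ac)
    qed
    finally show ?thesis by (simp only: sum_negf)
  qed
  have 2: "Q_form N (Q2 s) h c (d - 1) = - (\<Sum>a\<le>N. \<Sum>b\<le>N. (if b = 0 then 0 else Q2 s a (b - 1) * ?F a b))"
  proof -
    have "Q_form N (Q2 s) h c (d - 1)
      = (\<Sum>a\<le>N. \<Sum>b\<le>N. ((- 1) ^ (a + b) * Q2 s a b * h (c - int a)) * h (d - 1 - int b))"
      by (simp only: Q_form_def)
    also have "\<dots> = (\<Sum>a\<le>N. \<Sum>b\<le>N. if b = 0 then 0 else
      ((- 1) ^ (a + (b - 1)) * Q2 s a (b - 1) * h (c - int a)) * h (d - int b))"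
      by (intro sum.cong refl sum_shift_mult[OF h d])
    also have "\<dots> = (\<Sum>a\<le>N. \<Sum>b\<le>N. - (if b = 0 then 0 else Q2 s a (b - 1) * ?F a b))"
    proof (intro sum.cong refl)
      fix a b show "(if b = 0 then 0 else
      ((- 1) ^ (a + (b - 1)) * Q2 s a (b - 1) * h (c - int a)) * h (d - int b))
        = - (if b = 0 then 0 else Q2 s a (b - 1) * ?F a b)"
        by (cases b) (simp_all add: mult_ac)
    qed
    finally show ?thesis by (simp only: sum_negf)
  qed
  let ?x = "\<lambda>a. if a = 0 then 0 else ?q (a - 1)"
  have G: "(if a = 0 then 0 else Q2 s (a - 1) b) + (if b = 0 then 0 else Q2 s a (b - 1))
    = ?x a * ?q b - ?q a * ?x b - (if a = 1 then 1 else 0) * (if b = 0 then 1 else 0)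
      + (if a = 0 then 1 else 0) * (if b = 1 then 1 else 0)" for a b
  proof (cases a)
    case 0
    then show ?thesis using Q2_0_right[of s "b - 1"] Q2_anti[of s 0 "b - 1"]
      by (cases b) (auto simp: q_fun_0)
  next
    case (Suc a')
    then show ?thesis using Q2_0_right[of s a'] Q2_rec[of s a' "b - 1"]
      by (cases b) (auto simp: q_fun_0)
  qed
  have S: "(\<Sum>a\<le>N. \<Sum>b\<le>N. x a * y b * ?F a b)
    = (\<Sum>a\<le>N. (- 1) ^ a * x a * h (c - int a)) * (\<Sum>b\<le>N. (- 1) ^ b * y b * h (d - int b))"
    for x y :: "nat \<Rightarrow> 'a"
    by (simp add: sum_product power_add mult_ac)
  have x: "(\<Sum>a\<le>N. (- 1) ^ a * ?x a * h (k - int a)) = - g (k - 1)" if "k \<le> int N" for k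
  proof -
    have "g (k - 1) = (\<Sum>i\<le>N. (- 1) ^ i * ?q i * h (k - 1 - int i))"
      using that by (intro g) simp
    also have "\<dots> = (\<Sum>a\<le>N. if a = 0 then 0 else (- 1) ^ (a - 1) * ?q (a - 1) * h (k - int a))"
      by (rule sum_shift_mult[OF h that])
    also have "\<dots> = (\<Sum>a\<le>N. - ((- 1) ^ a * ?x a * h (k - int a)))"
    proof (intro sum.cong refl)
      fix a show "(if a = 0 then 0 else (- 1) ^ (a - 1) * ?q (a - 1) * h (k - int a))
        = - ((- 1) ^ a * ?x a * h (k - int a))" by (cases a) simp_all
    qed
    finally show ?thesis by (simp only: sum_negf minus_minus)
  qed
  have i0: "(\<Sum>a\<le>N. (- 1) ^ a * (if a = 0 then 1 else 0) * h (k - int a)) = h k" for k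
    by (simp add: if_distrib[of "\<lambda>x. _ * x"] if_distrib[of "\<lambda>x. x * _"] cong: if_cong)
  have i1: "(\<Sum>a\<le>N. (- 1) ^ a * (if a = 1 then 1 else 0) * h (k - int a)) = - h (k - 1)" for k
    using N by (simp add: if_distrib[of "\<lambda>x. _ * x"] if_distrib[of "\<lambda>x. x * _"] cong: if_cong)
  have "Q_form N (Q2 s) h (c - 1) d + Q_form N (Q2 s) h c (d - 1)
    = - (\<Sum>a\<le>N. \<Sum>b\<le>N. ((if a = 0 then 0 else Q2 s (a - 1) b) + (if b = 0 then 0 else Q2 s a (b - 1))) * ?F a b)"
    unfolding 1 2 sum_negf[symmetric] sum.distrib[symmetric]
    by (intro sum.cong refl) (simp add: algebra_simps)
  also have "\<dots> = - (- g (c - 1) * g d - g c * (- g (d - 1)) - (- h (c - 1)) * h d + h c * (- h (d - 1)))"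
    unfolding G left_diff_distrib distrib_right sum.distrib sum_subtractf S
    unfolding x[OF c] x[OF d] i0 i1 g[OF c, symmetric] g[OF d, symmetric] ..
  finally show ?thesis by simp
qed

text \<open>
  The heart of the second part: the forms in \<open>t\<close> and \<open>s\<close> combine to the
  form in \<open>u\<close> alone. The difference \<open>D\<close> of both sides satisfies
  \<open>D (c - 1) d + D c (d - 1) = 0\<close>, so it suffices to know it for negative
  \<open>c\<close>. There the terms in \<open>Q\<close> vanish and the alternating forms are the
  convolutions of \<open>h(t)\<close> and \<open>h(u)\<close>, which agree because
  \<open>q(z) * q(- z) = 1\<close>.
\<close>

theorem skew_form_twist:
  fixes t s :: "nat \<Rightarrow> 'a::field_char_0"
  assumes "c \<le> int N" "d \<le> int N"
  shows "skew_form N (h_fun (twist s t)) c d = skew_form N (h_fun t) c d - Q_form N (Q2 s) (h_fun t) c d"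
proof -
  let ?h = "h_fun t" and ?g = "h_fun (twist s t)"
  define D where "D N c d = skew_form N ?h c d - Q_form N (Q2 s) ?h c d - skew_form N ?g c d" for N c d
  note neg = h_fun_neg[of _ t] h_fun_neg[of _ "twist s t"]
  have mono: "D N' c d = D N c d" if "c \<le> int N" "d \<le> int N" "N \<le> N'" for N N' c d
    unfolding D_def using that
    by (simp add: skew_form_mono[where h = ?h, OF neg(1) that] skew_form_mono[where h = ?g, OF neg(2) that] Q_form_mono[where h = ?h, OF neg(1) that])
  have rec: "D N (c - 1) d + D N c (d - 1) = 0" if "c \<le> int N" "d \<le> int N" "N \<ge> 1" for N c d
  proof -
    have s1: "skew_form N ?h (c - 1) d + skew_form N ?h c (d - 1) = ?h c * ?h (d - 1) - ?h (c - 1) * ?h d"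
      by (rule skew_form_shift[OF neg(1) that(1,2)])
    have s2: "skew_form N ?g (c - 1) d + skew_form N ?g c (d - 1) = ?g c * ?g (d - 1) - ?g (c - 1) * ?g d"
      by (rule skew_form_shift[OF neg(2) that(1,2)])
    have s3: "Q_form N (Q2 s) ?h (c - 1) d + Q_form N (Q2 s) ?h c (d - 1)
      = ?g (c - 1) * ?g d - ?g c * ?g (d - 1) - ?h (c - 1) * ?h d + ?h c * ?h (d - 1)"
      by (rule Q_form_shift[OF neg(1) that h_fun_twist])
    have "D N (c - 1) d + D N c (d - 1) = (skew_form N ?h (c - 1) d + skew_form N ?h c (d - 1))
      - (Q_form N (Q2 s) ?h (c - 1) d + Q_form N (Q2 s) ?h c (d - 1))
      - (skew_form N ?g (c - 1) d + skew_form N ?g c (d - 1))"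
      by (simp add: D_def)
    also have "\<dots> = 0" unfolding s1 s2 s3 by simp
    finally show ?thesis .
  qed
  have base: "D N (- int k) d = 0" if "k > 0" "d \<le> int N" for N k d
  proof -
    have "Q_form N (Q2 s) ?h (- int k) d = 0"
      unfolding Q_form_def using that by (simp add: h_fun_neg)
    moreover have "skew_form N ?h (- int k) d = skew_form N ?g (- int k) d"
    proof -
      have e: "skew_form N (h_fun v) (- int k) d = (if d < int k then 0 else (- 1) ^ Suc k *
          (\<Sum>j\<le>nat (d - int k). (- 1) ^ j * h_fun v (int j) * h_fun v (d - int k - int j)))"
        for v :: "nat \<Rightarrow> 'a"
        by (rule skew_form_neg[OF h_fun_neg that])
      show ?thesis
      proof (cases "d < int k")
        case True
        then show ?thesis by (simp add: e)
      next
        case False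
        then obtain n where n: "d - int k = int n" using zero_le_imp_eq_int[of "d - int k"] by auto
        show ?thesis unfolding e n nat_int h_fun_twist_convolution ..
      qed
    qed
    ultimately show ?thesis unfolding D_def by simp
  qed
  have main: "D N (int k - 1) d = 0" if "int k + d \<le> int N" "d \<le> int N" "k \<le> N" for N k d
    using that
  proof (induction k arbitrary: d)
    case 0
    then show ?case using base[of 1 d N] by simp
  next
    case (Suc k)
    have "D N (int k - 1) (d + 1) = 0" by (rule Suc.IH) (use Suc.prems in auto)
    moreover have "D N (int k - 1) (d + 1) + D N (int k) d = 0"
      using rec[of "int k" N "d + 1"] Suc.prems by simp
    ultimately show ?case by simp
  qed
  have "D N c d = 0"
  proof (cases "c < 0")
    case True
    then show ?thesis using base[of "nat (- c)" d N] assms by simp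
  next
    case False
    \<comment> \<open>Large enough for the descent from \<open>c\<close> to \<open>- 1\<close>, which raises \<open>d\<close> by as much.\<close>
    define N' where "N' = N + nat (c + 1) + nat (c + 1 + d)"
    have "D N' (int (nat (c + 1)) - 1) d = 0"
      by (rule main) (use assms False in \<open>auto simp: N'_def\<close>)
    then show ?thesis using mono[OF assms, of N'] False by (simp add: N'_def)
  qed
  then show ?thesis unfolding D_def by (simp add: algebra_simps)
qed

section \<open>Schur functions of 3-bar quotients\<close>

text \<open>
  Either the last column is zero above the corner, or the last row is zero left of it.
\<close>

lemma rows_det_append_last:
  assumes "(\<forall>v\<in>set vs. v (length vs) = 0) \<or> (\<forall>c<length vs. w c = 0)"
  shows "rows_det (vs @ [w]) = rows_det vs * w (length vs)"
proof -
  let ?n = "length vs"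
  let ?A = "mat ?n ?n (\<lambda>(i, j). (vs ! i) j)" and ?D = "mat 1 1 (\<lambda>_. w ?n)"
  let ?B = "mat ?n 1 (\<lambda>(i, j). (vs ! i) ?n)" and ?C = "mat 1 ?n (\<lambda>(i, j). w j)"
  have "mat (length (vs @ [w])) (length (vs @ [w])) (\<lambda>(i, j). ((vs @ [w]) ! i) j) = four_block_mat ?A ?B ?C ?D"
    by (rule eq_matI) (auto simp: nth_append less_Suc_eq)
  then have "rows_det (vs @ [w]) = det (four_block_mat ?A ?B ?C ?D)" by (simp add: rows_det_def)
  also have "\<dots> = det ?A * det ?D"
    using assms
  proof
    assume "\<forall>v\<in>set vs. v ?n = 0"
    then have "?B = 0\<^sub>m ?n 1" by (intro eq_matI) auto
    then show ?thesis by (intro det_four_block_mat_upper_right_zero[of _ ?n _ 1]) auto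
  next
    assume "\<forall>c<?n. w c = 0"
    then have "?C = 0\<^sub>m 1 ?n" by (intro eq_matI) auto
    then show ?thesis by (intro det_four_block_mat_lower_left_zero[of _ ?n _ 1]) auto
  qed
  also have "det ?D = w ?n" by (subst det_single) auto
  finally show ?thesis by (simp add: rows_det_def)
qed

lemma schur_rows_det: "schur \<nu> t = rows_det (map (\<lambda>i c. h_fun t (int (\<nu> ! i) + int c - int i)) [0..<length \<nu>])"
  unfolding schur_def rows_det_def by (intro arg_cong[where f = det]) (auto intro!: cong_mat)

lemma schur_append_zero: "schur (\<nu> @ [0]) t = schur \<nu> t"
proof -
  let ?V = "map (\<lambda>i c. h_fun t (int (\<nu> ! i) + int c - int i)) [0..<length \<nu>]"
  let ?w = "\<lambda>c. h_fun t (int c - int (length \<nu>))"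
  have "map (\<lambda>i c. h_fun t (int ((\<nu> @ [0]) ! i) + int c - int i)) [0..<length (\<nu> @ [0])] = ?V @ [?w]"
    by (auto simp: nth_append)
  then have "schur (\<nu> @ [0]) t = rows_det (?V @ [?w])" by (simp only: schur_rows_det)
  also have "\<dots> = rows_det ?V * ?w (length ?V)" by (rule rows_det_append_last) (simp add: h_fun_neg)
  also have "?w (length ?V) = 1" by (simp add: h_fun_exp_series exp_series_def)
  finally show ?thesis by (simp add: schur_rows_det)
qed

lemma schur_append_zeros: "schur (\<nu> @ replicate k 0) t = schur \<nu> t"
proof (induction k)
  case (Suc k)
  have "\<nu> @ replicate (Suc k) 0 = (\<nu> @ replicate k 0) @ [0]"
    by (simp add: replicate_append_same)
  then show ?case using Suc schur_append_zero[of "\<nu> @ replicate k 0" t] by simp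
qed simp

lemma decreasing_nonneg_split:
  assumes "sorted_wrt (\<ge>) xs" "\<And>x. x \<in> set xs \<Longrightarrow> x \<ge> (0::int)"
  shows "\<exists>k. xs = filter (\<lambda>x. x \<noteq> 0) xs @ replicate k 0"
  using assms
proof (induction xs)
  case (Cons x xs)
  show ?case
  proof (cases "x = 0")
    case True
    then have "\<forall>y\<in>set (x # xs). y = 0" using Cons.prems by fastforce
    then have "x # xs = replicate (length (x # xs)) 0" by (metis replicate_eqI)
    moreover have "filter (\<lambda>x. x \<noteq> 0) (x # xs) = []" using \<open>\<forall>y\<in>set (x # xs). y = 0\<close> by (auto simp: filter_empty_conv)
    ultimately show ?thesis by (metis append_Nil)
  next
    case False
    then show ?thesis using Cons by auto
  qed
qed simp

text \<open>
  The Jacobi--Trudi determinant in terms of Maya positions: the row of a position \<open>x\<close>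
  no longer refers to its place in the list, and the column shift depends only on the number of
  parts in each residue class.
\<close>

lemma schur_quotient1:
  assumes "strict_partition \<nu>" "admissible k \<nu>"
    and d: "int (length (residue_parts 1 \<nu>)) - int (length (residue_parts 2 \<nu>)) = d"
  shows "schur (quotient1 \<nu>) t = rows_det (map (\<lambda>x c. h_fun t (x + int c + 1 - d)) (maya k \<nu>))"
proof -
  let ?q = "quotient1_int k \<nu>"
  have nonneg: "x \<ge> 0" if "x \<in> set ?q" for x using quotient1_int_nonneg[OF assms(1,2) that] .
  obtain j where j: "?q = filter (\<lambda>x. x \<noteq> 0) ?q @ replicate j 0"
    using decreasing_nonneg_split[OF quotient1_int_decreasing[OF assms(1)] nonneg] by blast
  have "schur (quotient1 \<nu>) t = schur (quotient1 \<nu> @ replicate j 0) t" by (simp add: schur_append_zeros)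
  also have "quotient1 \<nu> @ replicate j 0 = map nat ?q"
    unfolding quotient1_eq[OF assms(1,2)] by (subst (2) j) simp
  also have "schur (map nat ?q) t = rows_det (map (\<lambda>x c. h_fun t (x + int c + 1 - d)) (maya k \<nu>))"
    unfolding schur_rows_det
  proof (intro arg_cong[where f = rows_det] nth_equalityI)
    fix i assume "i < length (map (\<lambda>i c. h_fun t (int (map nat ?q ! i) + int c - int i)) [0..<length (map nat ?q)])"
    then have i: "i < length ?q" by simp
    then have i': "i < length (maya k \<nu>)" by (simp add: quotient1_int_def)
    have "?q ! i \<ge> 0" using nonneg i by simp
    moreover have "?q ! i = maya k \<nu> ! i - (d - 1 - int i)"
      using i' unfolding d[symmetric] by (simp add: quotient1_int_def)
    ultimately show "map (\<lambda>i c. h_fun t (int (map nat ?q ! i) + int c - int i)) [0..<length (map nat ?q)] ! i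
      = map (\<lambda>x c. h_fun t (x + int c + 1 - d)) (maya k \<nu>) ! i"
      using i i' by (auto intro!: ext arg_cong[where f = "h_fun t"])
  qed (simp add: quotient1_int_def)
  finally show ?thesis .
qed

lemma residue_parts_simps [simp]:
  "residue_parts a [] = []"
  "residue_parts a (p # \<nu>) = (if p mod 3 = a then p # residue_parts a \<nu> else residue_parts a \<nu>)"
  "residue_parts a (\<mu> @ \<nu>) = residue_parts a \<mu> @ residue_parts a \<nu>"
  "set (residue_parts a \<nu>) = {p \<in> set \<nu>. p mod 3 = a}"
  by (auto simp: residue_parts_def)

text \<open>
  A part \<open>3 * k + 2\<close> removes the new position \<open>- (k + 1)\<close>.
\<close>

lemma maya_Suc_Cons_2: "maya (Suc k) ((3 * k + 2) # \<nu>) = maya k \<nu>"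
proof -
  have 1: "- ((int (3 * k + 2) + 1) div 3) = - int (Suc k)" by simp
  have "filter (\<lambda>b. b \<notin> insert (- int (Suc k)) X) (map (\<lambda>i. - int i) [1..<Suc k + 1])
    = filter (\<lambda>b. b \<notin> X) (map (\<lambda>i. - int i) [1..<k + 1])" for X
  proof -
    have "map (\<lambda>i. - int i) [1..<Suc k + 1] = map (\<lambda>i. - int i) [1..<k + 1] @ [- int (Suc k)]" by simp
    then have "filter (\<lambda>b. b \<notin> insert (- int (Suc k)) X) (map (\<lambda>i. - int i) [1..<Suc k + 1])
      = filter (\<lambda>b. b \<notin> insert (- int (Suc k)) X) (map (\<lambda>i. - int i) [1..<k + 1])" by simp
    also have "\<dots> = filter (\<lambda>b. b \<notin> X) (map (\<lambda>i. - int i) [1..<k + 1])"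
      by (rule filter_cong) auto
    finally show ?thesis .
  qed
  then show ?thesis by (simp add: maya_def mod_Suc 1 del: upt_Suc)
qed

lemma maya_Suc_Cons:
  assumes "3 * k + 2 \<notin> set \<nu>" "p mod 3 \<noteq> 2"
  shows "maya (Suc k) (p # \<nu>) = (if p mod 3 = 1 then [(int p - 1) div 3] else []) @ maya k \<nu> @ [- int (Suc k)]"
proof -
  have "- int (Suc k) \<notin> (\<lambda>p. - ((int p + 1) div 3)) ` set (residue_parts 2 \<nu>)"
  proof
    assume "- int (Suc k) \<in> (\<lambda>p. - ((int p + 1) div 3)) ` set (residue_parts 2 \<nu>)"
    then obtain x where "x \<in> set \<nu>" "x mod 3 = 2" "int (Suc k) = (int x + 1) div 3" by auto
    moreover from this(2,3) have "x = 3 * k + 2" by presburger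
    ultimately show False using assms(1) by simp
  qed
  then show ?thesis using assms(2) by (simp add: maya_def)
qed

section \<open>The statistic g\<close>

text \<open>
  The statistic \<open>g\<close> with the presence of the additional part 0 as a separate parameter,
  since the parity of the length changes when the first part is removed.
\<close>

definition g_padded :: "bool \<Rightarrow> nat list \<Rightarrow> nat" where
  "g_padded b \<nu> = (\<Sum>p \<leftarrow> residue_parts 0 \<nu> @ (if b then [0] else []).
     length (filter (\<lambda>q. q > p) (residue_parts 1 \<nu>)))"

lemma g_stat_padded: "g_stat \<nu> = g_padded (odd (length \<nu>)) \<nu>"
  by (simp add: g_stat_def g_padded_def pad_even_def)

lemma g_padded_Cons:
  assumes "\<And>x. x \<in> set \<nu> \<Longrightarrow> x < p"
  shows "g_padded b (p # \<nu>) = g_padded b \<nu> + (if p mod 3 = 1 then length (residue_parts 0 \<nu>) + of_bool b else 0)"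
proof -
  consider "p mod 3 = 1" | "p mod 3 = 0" | "p mod 3 = 2" by linarith
  then show ?thesis
  proof cases
    case 1
    let ?l = "residue_parts 0 \<nu> @ (if b then [0] else [])"
    have "p > x" if "x \<in> set ?l" for x
      using that assms 1 by (auto split: if_splits intro: Nat.gr0I)
    then have eq: "map (\<lambda>x. length (filter (\<lambda>q. q > x) (p # residue_parts 1 \<nu>))) ?l
      = map (\<lambda>x. length (filter (\<lambda>q. q > x) (residue_parts 1 \<nu>)) + 1) ?l"
      by (intro map_cong refl) simp
    have "g_padded b (p # \<nu>) = sum_list (map (\<lambda>x. length (filter (\<lambda>q. q > x) (p # residue_parts 1 \<nu>))) ?l)"
      using 1 by (simp add: g_padded_def)
    also have "\<dots> = (\<Sum>x\<leftarrow>?l. length (filter (\<lambda>q. q > x) (residue_parts 1 \<nu>)) + 1)"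
      unfolding eq ..
    also have "\<dots> = g_padded b \<nu> + length ?l"
      unfolding sum_list_addf g_padded_def by (simp add: sum_list_triv)
    finally show ?thesis using 1 by simp
  next
    case 2
    have "filter (\<lambda>q. q > p) (residue_parts 1 \<nu>) = []" using assms by (fastforce simp: filter_empty_conv)
    then show ?thesis using 2 by (simp add: g_padded_def)
  qed (simp add: g_padded_def)
qed

section \<open>Growth of a core in one color\<close>

text \<open>
  The index list \<open>m, \<dots>, 1\<close>, in the order of the rows of the core.
\<close>

primrec down :: "nat \<Rightarrow> nat list" where
  "down 0 = []"
| "down (Suc m) = Suc m # down m"

lemma set_down [simp]: "set (down m) = {1..m}"
  by (induction m) auto

lemma distinct_down [simp]: "distinct (down m)"
  by (induction m) auto

lemma rev_upt_down: "rev [1..<Suc m] = down m"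
  by (induction m) auto

lemma core_int: "core (int m) = map (\<lambda>i. 3 * i - 2) (down m)"
  using rev_upt_down[of m] by (simp add: core_def)

lemma core_minus: "core (- int m) = map (\<lambda>i. 3 * i - 1) (down m)"
  using rev_upt_down[of m] by (cases "m = 0") (auto simp: core_def)

definition grows_in_color :: "nat \<Rightarrow> nat list \<Rightarrow> nat list \<Rightarrow> bool" where
  "grows_in_color a cs \<nu> \<longleftrightarrow>
    diagram cs \<subseteq> diagram \<nu> \<and> (\<forall>x\<in>diagram \<nu> - diagram cs. color x = a)"

lemma diagram_Nil [simp]: "diagram [] = {}"
  by (simp add: diagram_def)

lemma diagram_Cons [simp]:
  "(0, j) \<in> diagram (p # \<nu>) \<longleftrightarrow> 1 \<le> j \<and> j \<le> p"
  "(Suc i, j) \<in> diagram (p # \<nu>) \<longleftrightarrow> (i, j) \<in> diagram \<nu>"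
  by (auto simp: diagram_def)

lemma all_cells_iff: "(\<forall>x. P x) \<longleftrightarrow> (\<forall>j. P (0, j)) \<and> (\<forall>i j. P (Suc i, j :: nat))"
  by (metis not0_implies_Suc surj_pair)

text \<open>
  The rows of a diagram grow independently of each other, because the color of a cell depends only
  on its column.
\<close>

lemma grows_in_color_Cons:
  assumes "c > 0"
  shows "grows_in_color a (c # cs) \<mu> \<longleftrightarrow>
    (\<exists>p \<nu>. \<mu> = p # \<nu> \<and> c \<le> p \<and> (\<forall>j\<in>{c<..p}. color (0, j) = a) \<and> grows_in_color a cs \<nu>)"
proof (cases \<mu>)
  case Nil
  have "(0, c) \<in> diagram (c # cs)" using assms by simp
  then have "diagram (c # cs) \<noteq> {}" by blast
  then show ?thesis using Nil by (simp add: grows_in_color_def)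
next
  case (Cons p \<nu>)
  have all: "grows_in_color a \<alpha> \<beta> \<longleftrightarrow> (\<forall>x. (x \<in> diagram \<alpha> \<longrightarrow> x \<in> diagram \<beta>)
      \<and> (x \<in> diagram \<beta> \<and> x \<notin> diagram \<alpha> \<longrightarrow> color x = a))" for \<alpha> \<beta>
    unfolding grows_in_color_def subset_iff by blast
  have "color (Suc i, j) = color (i, j)" for i j by (simp add: color_def)
  then have "(\<forall>i j. ((Suc i, j) \<in> diagram (c # cs) \<longrightarrow> (Suc i, j) \<in> diagram (p # \<nu>))
      \<and> ((Suc i, j) \<in> diagram (p # \<nu>) \<and> (Suc i, j) \<notin> diagram (c # cs) \<longrightarrow> color (Suc i, j) = a))
    \<longleftrightarrow> grows_in_color a cs \<nu>"
    unfolding all[of cs] by simp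
  moreover have "(\<forall>j. ((0, j) \<in> diagram (c # cs) \<longrightarrow> (0, j) \<in> diagram (p # \<nu>))
      \<and> ((0, j) \<in> diagram (p # \<nu>) \<and> (0, j) \<notin> diagram (c # cs) \<longrightarrow> color (0, j) = a))
    \<longleftrightarrow> c \<le> p \<and> (\<forall>j\<in>{c<..p}. color (0, j) = a)"
    using assms by (auto simp: not_le)
  ultimately show ?thesis unfolding Cons all[of "c # cs"] by (subst all_cells_iff) auto
qed

lemma I_set_iff: "\<mu> \<in> I_set a n r \<longleftrightarrow>
    strict_partition \<mu> \<and> grows_in_color a (core r) \<mu> \<and> sum_list \<mu> = sum_list (core r) + n"
  by (auto simp: I_set_def grows_in_color_def)

lemma strict_partition_Cons:
  "strict_partition (p # \<nu>) \<longleftrightarrow> p > 0 \<and> (\<forall>x\<in>set \<nu>. x < p) \<and> strict_partition \<nu>"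
  by (auto simp: strict_partition_def)

lemma strict_partition_Nil [simp]: "strict_partition []"
  by (simp add: strict_partition_def)

lemma color_row_0: "(\<forall>j\<in>{3 * m + 2<..p}. color (0, j) = 0) \<longleftrightarrow> p \<le> 3 * m + 4"
proof
  assume h: "\<forall>j\<in>{3 * m + 2<..p}. color (0, j) = 0"
  show "p \<le> 3 * m + 4"
  proof (rule ccontr)
    assume "\<not> p \<le> 3 * m + 4"
    then have "color (0, 3 * m + 5) = 0" using h by simp
    moreover have "(3 * m + 5) mod 3 = 2" by presburger
    ultimately show False by (simp add: color_def)
  qed
next
  assume p: "p \<le> 3 * m + 4"
  have "j mod 3 \<noteq> 2" if "3 * m + 2 < j" "j \<le> 3 * m + 4" for j using that by presburger
  then show "\<forall>j\<in>{3 * m + 2<..p}. color (0, j) = 0" using p by (auto simp: color_def)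
qed

lemma color_row_1: "(\<forall>j\<in>{3 * m + 1<..p}. color (0, j) = 1) \<longleftrightarrow> p \<le> 3 * m + 2"
proof
  assume h: "\<forall>j\<in>{3 * m + 1<..p}. color (0, j) = 1"
  show "p \<le> 3 * m + 2"
  proof (rule ccontr)
    assume "\<not> p \<le> 3 * m + 2"
    then have "color (0, 3 * m + 3) = 1" using h by simp
    moreover have "(3 * m + 3) mod 3 = 0" by presburger
    ultimately show False by (simp add: color_def)
  qed
next
  assume p: "p \<le> 3 * m + 2"
  have "j mod 3 = 2" if "3 * m + 1 < j" "j \<le> 3 * m + 2" for j using that by presburger
  then show "\<forall>j\<in>{3 * m + 1<..p}. color (0, j) = 1" using p by (auto simp: color_def)
qed

lemma grows_from_Nil_0:
  "strict_partition \<mu> \<and> grows_in_color 0 [] \<mu> \<longleftrightarrow> \<mu> = [] \<or> \<mu> = [1]"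
proof
  assume h: "strict_partition \<mu> \<and> grows_in_color 0 [] \<mu>"
  show "\<mu> = [] \<or> \<mu> = [1]"
  proof (cases \<mu>)
    case (Cons p \<nu>)
    have "p \<le> 1"
    proof (rule ccontr)
      assume "\<not> p \<le> 1"
      then have "(0, 2) \<in> diagram \<mu>" using Cons by (simp add: diagram_def)
      then show False using h by (auto simp: grows_in_color_def color_def)
    qed
    moreover have "p > 0" using h Cons by (simp add: strict_partition_Cons)
    moreover have "\<nu> = []"
    proof (cases \<nu>)
      case (Cons q \<nu>')
      then have "0 < q" "q < p" using h \<open>\<mu> = p # \<nu>\<close> by (simp_all add: strict_partition_Cons)
      then show ?thesis using \<open>p \<le> 1\<close> by simp
    qed simp
    ultimately show ?thesis using Cons by simp
  qed simp
qed (auto simp: grows_in_color_def color_def diagram_def strict_partition_def)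

lemma grows_from_Nil_1: "strict_partition \<mu> \<and> grows_in_color 1 [] \<mu> \<longleftrightarrow> \<mu> = []"
proof
  assume h: "strict_partition \<mu> \<and> grows_in_color 1 [] \<mu>"
  show "\<mu> = []"
  proof (cases \<mu>)
    case (Cons p \<nu>)
    then have "(0, 1) \<in> diagram \<mu>" using h by (auto simp: diagram_def strict_partition_Cons)
    then show ?thesis using h by (auto simp: grows_in_color_def color_def)
  qed simp
qed (auto simp: grows_in_color_def)

section \<open>Parametrization of the index sets\<close>

text \<open>
  The partitions in \<open>I_0(c_{- m})\<close>. The part \<open>3 * i - 1\<close> of the core
  grows by 2 if \<open>i\<close> is in \<open>K\<close>, by 1 if \<open>i\<close> is in
  \<open>J\<close> and not at all otherwise; \<open>e\<close> says whether there is a new part 1.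
\<close>

primrec bar0 :: "nat set \<Rightarrow> nat set \<Rightarrow> bool \<Rightarrow> nat \<Rightarrow> nat list" where
  "bar0 K J e 0 = (if e then [1] else [])"
| "bar0 K J e (Suc m) =
    (if Suc m \<in> K then 3 * m + 4 else if Suc m \<in> J then 3 * m + 3 else 3 * m + 2) # bar0 K J e m"

text \<open>
  The partitions in \<open>I_1(c_m)\<close>: the part \<open>3 * i - 2\<close> of the core stays
  for \<open>i\<close> in \<open>K\<close> and grows by 1 otherwise.
\<close>

primrec bar1 :: "nat set \<Rightarrow> nat \<Rightarrow> nat list" where
  "bar1 K 0 = []"
| "bar1 K (Suc m) = (if Suc m \<in> K then 3 * m + 1 else 3 * m + 2) # bar1 K m"

lemma bar0_le: "x \<in> set (bar0 K J e m) \<Longrightarrow> 0 < x \<and> x \<le> 3 * m + 1"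
  by (induction m) (auto split: if_splits)

lemma bar1_le: "x \<in> set (bar1 K m) \<Longrightarrow> 0 < x \<and> x < 3 * m"
  by (induction m) (auto split: if_splits)

lemma strict_bar0: "strict_partition (bar0 K J e m)"
proof (induction m)
  case (Suc m)
  have "x < 3 * m + 2" if "x \<in> set (bar0 K J e m)" for x using bar0_le[OF that] by simp
  then show ?case using Suc by (fastforce simp: strict_partition_Cons)
qed (simp add: strict_partition_Cons)

lemma strict_bar1: "strict_partition (bar1 K m)"
proof (induction m)
  case (Suc m)
  have "x < 3 * m + 1" if "x \<in> set (bar1 K m)" for x using bar1_le[OF that] by simp
  then show ?case using Suc by (fastforce simp: strict_partition_Cons)
qed simp

lemma bar0_cong:
  assumes "\<And>i. 1 \<le> i \<Longrightarrow> i \<le> m \<Longrightarrow> (i \<in> K \<longleftrightarrow> i \<in> K') \<and> (i \<in> J \<longleftrightarrow> i \<in> J')"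
  shows "bar0 K J e m = bar0 K' J' e m"
  using assms by (induction m) simp_all

lemma bar1_cong:
  assumes "\<And>i. 1 \<le> i \<Longrightarrow> i \<le> m \<Longrightarrow> (i \<in> K \<longleftrightarrow> i \<in> K')"
  shows "bar1 K m = bar1 K' m"
  using assms by (induction m) simp_all

lemma grows_in_color_0_Cons:
  "grows_in_color 0 ((3 * m + 2) # cs) \<mu> \<longleftrightarrow>
    (\<exists>p \<nu>. \<mu> = p # \<nu> \<and> 3 * m + 2 \<le> p \<and> p \<le> 3 * m + 4 \<and> grows_in_color 0 cs \<nu>)"
  using grows_in_color_Cons[of "3 * m + 2" 0 cs \<mu>] unfolding color_row_0 by simp

lemma grows_in_color_1_Cons:
  "grows_in_color 1 ((3 * m + 1) # cs) \<mu> \<longleftrightarrow>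
    (\<exists>p \<nu>. \<mu> = p # \<nu> \<and> 3 * m + 1 \<le> p \<and> p \<le> 3 * m + 2 \<and> grows_in_color 1 cs \<nu>)"
  using grows_in_color_Cons[of "3 * m + 1" 1 cs \<mu>] unfolding color_row_1 by simp

lemma grows_bar0:
  "strict_partition \<mu> \<and> grows_in_color 0 (core (- int m)) \<mu> \<longleftrightarrow>
    (\<exists>K J e. K \<subseteq> {1..m} \<and> J \<subseteq> {1..m} \<and> K \<inter> J = {} \<and> \<mu> = bar0 K J e m)"
  unfolding core_minus
proof (induction m arbitrary: \<mu>)
  case 0
  show ?case using grows_from_Nil_0[of \<mu>] by (simp add: ex_bool_eq disj_commute)
next
  case (Suc m)
  have c: "map (\<lambda>i. 3 * i - 1) (down (Suc m)) = (3 * m + 2) # map (\<lambda>i. 3 * i - 1) (down m)" by simp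
  show ?case
  proof
    assume \<mu>0: "strict_partition \<mu> \<and> grows_in_color 0 (map (\<lambda>i. 3 * i - 1) (down (Suc m))) \<mu>"
    then obtain p \<nu> where \<mu>: "\<mu> = p # \<nu>" and p: "3 * m + 2 \<le> p" "p \<le> 3 * m + 4"
      and g: "grows_in_color 0 (map (\<lambda>i. 3 * i - 1) (down m)) \<nu>"
      unfolding c grows_in_color_0_Cons by blast
    have "strict_partition \<nu>" using \<mu>0 \<mu> by (simp add: strict_partition_Cons)
    from iffD1[OF Suc.IH conjI[OF this g]] obtain K J e where KJ: "K \<subseteq> {1..m}" "J \<subseteq> {1..m}" "K \<inter> J = {}" and \<nu>: "\<nu> = bar0 K J e m"
      by (elim exE conjE)
    define K' where "K' = (if p = 3 * m + 4 then insert (Suc m) K else K)"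
    define J' where "J' = (if p = 3 * m + 3 then insert (Suc m) J else J)"
    have s: "Suc m \<notin> K" "Suc m \<notin> J" using KJ by auto
    have "bar0 K' J' e m = bar0 K J e m" by (rule bar0_cong) (auto simp: K'_def J'_def)
    then have "\<mu> = bar0 K' J' e (Suc m)" using p s \<mu> \<nu> by (auto simp: K'_def J'_def)
    moreover have "K' \<subseteq> {1..Suc m}" "J' \<subseteq> {1..Suc m}" "K' \<inter> J' = {}"
      using KJ s by (auto simp: K'_def J'_def)
    ultimately show "\<exists>K J e. K \<subseteq> {1..Suc m} \<and> J \<subseteq> {1..Suc m} \<and> K \<inter> J = {} \<and> \<mu> = bar0 K J e (Suc m)"
      by (intro exI[of _ K'] exI[of _ J'] exI[of _ e] conjI)
  next
    assume "\<exists>K J e. K \<subseteq> {1..Suc m} \<and> J \<subseteq> {1..Suc m} \<and> K \<inter> J = {} \<and> \<mu> = bar0 K J e (Suc m)"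
    then obtain K J e where \<mu>: "\<mu> = bar0 K J e (Suc m)" and d: "K \<inter> J = {}" by (elim exE conjE)
    have "bar0 K J e m = bar0 (K \<inter> {1..m}) (J \<inter> {1..m}) e m" by (rule bar0_cong) auto
    moreover have "(K \<inter> {1..m}) \<inter> (J \<inter> {1..m}) = {}" using d by auto
    ultimately have "\<exists>K' J' e'. K' \<subseteq> {1..m} \<and> J' \<subseteq> {1..m} \<and> K' \<inter> J' = {} \<and> bar0 K J e m = bar0 K' J' e' m"
      by (intro exI[of _ "K \<inter> {1..m}"] exI[of _ "J \<inter> {1..m}"] exI[of _ e]) simp
    from conjunct2[OF iffD2[OF Suc.IH this]]
    have "grows_in_color 0 (map (\<lambda>i. 3 * i - 1) (down m)) (bar0 K J e m)" .
    then have "grows_in_color 0 (map (\<lambda>i. 3 * i - 1) (down (Suc m))) \<mu>"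
      unfolding c \<mu> grows_in_color_0_Cons by simp
    then show "strict_partition \<mu> \<and> grows_in_color 0 (map (\<lambda>i. 3 * i - 1) (down (Suc m))) \<mu>"
      using strict_bar0 \<mu> by blast
  qed
qed

lemma grows_bar1:
  "strict_partition \<mu> \<and> grows_in_color 1 (core (int m)) \<mu> \<longleftrightarrow> (\<exists>K. K \<subseteq> {1..m} \<and> \<mu> = bar1 K m)"
  unfolding core_int
proof (induction m arbitrary: \<mu>)
  case 0
  show ?case using grows_from_Nil_1[of \<mu>] by auto
next
  case (Suc m)
  have c: "map (\<lambda>i. 3 * i - 2) (down (Suc m)) = (3 * m + 1) # map (\<lambda>i. 3 * i - 2) (down m)" by simp
  show ?case
  proof
    assume \<mu>0: "strict_partition \<mu> \<and> grows_in_color 1 (map (\<lambda>i. 3 * i - 2) (down (Suc m))) \<mu>"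
    then obtain p \<nu> where \<mu>: "\<mu> = p # \<nu>" and p: "3 * m + 1 \<le> p" "p \<le> 3 * m + 2"
      and g: "grows_in_color 1 (map (\<lambda>i. 3 * i - 2) (down m)) \<nu>"
      unfolding c grows_in_color_1_Cons by blast
    have "strict_partition \<nu>" using \<mu>0 \<mu> by (simp add: strict_partition_Cons)
    from iffD1[OF Suc.IH conjI[OF this g]] obtain K where K: "K \<subseteq> {1..m}" and \<nu>: "\<nu> = bar1 K m"
      by (elim exE conjE)
    define K' where "K' = (if p = 3 * m + 1 then insert (Suc m) K else K)"
    have s: "Suc m \<notin> K" using K by auto
    have "bar1 K' m = bar1 K m" by (rule bar1_cong) (auto simp: K'_def)
    then have "\<mu> = bar1 K' (Suc m)" using p s \<mu> \<nu> by (auto simp: K'_def)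
    moreover have "K' \<subseteq> {1..Suc m}" using K by (auto simp: K'_def)
    ultimately show "\<exists>K. K \<subseteq> {1..Suc m} \<and> \<mu> = bar1 K (Suc m)" by blast
  next
    assume "\<exists>K. K \<subseteq> {1..Suc m} \<and> \<mu> = bar1 K (Suc m)"
    then obtain K where \<mu>: "\<mu> = bar1 K (Suc m)" by blast
    have "bar1 K m = bar1 (K \<inter> {1..m}) m" by (rule bar1_cong) auto
    then have "grows_in_color 1 (map (\<lambda>i. 3 * i - 2) (down m)) (bar1 K m)"
      using Suc.IH[of "bar1 K m"] by (metis inf_le2)
    then have "grows_in_color 1 (map (\<lambda>i. 3 * i - 2) (down (Suc m))) \<mu>"
      unfolding c \<mu> grows_in_color_1_Cons by simp
    then show "strict_partition \<mu> \<and> grows_in_color 1 (map (\<lambda>i. 3 * i - 2) (down (Suc m))) \<mu>"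
      using strict_bar1 \<mu> by blast
  qed
qed

lemma sum_list_bar0:
  "K \<inter> J = {} \<Longrightarrow> sum_list (bar0 K J e m) =
    sum_list (core (- int m)) + 2 * length (select K (down m)) + length (select J (down m)) + of_bool e"
  unfolding core_minus by (induction m) auto

lemma sum_list_bar1:
  "sum_list (bar1 K m) + length (select K (down m)) = sum_list (core (int m)) + m"
  unfolding core_int by (induction m) auto

lemma mem_bar0:
  assumes "K \<inter> J = {}" "1 \<le> i" "i \<le> m"
  shows "3 * i + 1 \<in> set (bar0 K J e m) \<longleftrightarrow> i \<in> K" "3 * i \<in> set (bar0 K J e m) \<longleftrightarrow> i \<in> J"
proof -
  have "(3 * i + 1 \<in> set (bar0 K J e m) \<longleftrightarrow> i \<in> K) \<and> (3 * i \<in> set (bar0 K J e m) \<longleftrightarrow> i \<in> J)"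
    using assms
  proof (induction m)
    case (Suc m)
    show ?case
    proof (cases "i = Suc m")
      case True
      then have "3 * i + 1 \<notin> set (bar0 K J e m)" "3 * i \<notin> set (bar0 K J e m)"
        by (auto dest: bar0_le)
      then show ?thesis using True Suc.prems by auto
    next
      case False
      have "3 * i \<noteq> 3 * m + 2" "3 * i + 1 \<noteq> 3 * m + 2" "3 * i + 1 \<noteq> 3 * m + 3" "3 * i \<noteq> 3 * m + 4"
        by presburger+
      then show ?thesis using Suc False by auto
    qed
  qed simp
  then show "3 * i + 1 \<in> set (bar0 K J e m) \<longleftrightarrow> i \<in> K" "3 * i \<in> set (bar0 K J e m) \<longleftrightarrow> i \<in> J" by auto
qed

lemma one_mem_bar0: "1 \<in> set (bar0 K J e m) \<longleftrightarrow> e"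
  by (induction m) auto

lemma mem_bar1: "1 \<le> i \<Longrightarrow> i \<le> m \<Longrightarrow> 3 * i - 2 \<in> set (bar1 K m) \<longleftrightarrow> i \<in> K"
proof (induction m)
  case (Suc m)
  show ?case
  proof (cases "i = Suc m")
    case True
    then have "3 * i - 2 \<notin> set (bar1 K m)" by (auto dest: bar1_le)
    then show ?thesis using True by auto
  next
    case False
    have "3 * i - 2 \<noteq> 3 * m + 2" "3 * i - 2 \<noteq> 3 * m + 1" using False Suc.prems by presburger+
    then show ?thesis using Suc False by auto
  qed
qed simp

lemma sum_I_set_0:
  "(\<Sum>\<mu>\<in>I_set 0 n (- int m). F \<mu>) =
    (\<Sum>(K, J, e) | K \<subseteq> {1..m} \<and> J \<subseteq> {1..m} \<and> K \<inter> J = {} \<and> 2 * card K + card J + of_bool e = n.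
      F (bar0 K J e m))"
proof -
  let ?P = "{(K, J, e). K \<subseteq> {1..m} \<and> J \<subseteq> {1..m} \<and> K \<inter> J = {} \<and> 2 * card K + card J + of_bool e = n}"
  let ?b = "\<lambda>(K, J, e). bar0 K J e m"
  have inj: "inj_on ?b ?P"
  proof (rule inj_onI)
    fix x y assume "x \<in> ?P" "y \<in> ?P" "?b x = ?b y"
    moreover obtain K J e K' J' e' where x: "x = (K, J, e)" and y: "y = (K', J', e')" by (metis prod_cases3)
    ultimately have s: "K \<subseteq> {1..m}" "J \<subseteq> {1..m}" "K \<inter> J = {}" "K' \<subseteq> {1..m}" "J' \<subseteq> {1..m}" "K' \<inter> J' = {}"
      and eq: "bar0 K J e m = bar0 K' J' e' m" by auto
    have "i \<in> K \<longleftrightarrow> i \<in> K'" if "1 \<le> i \<and> i \<le> m" for i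
      using mem_bar0(1)[of K J i m e] mem_bar0(1)[of K' J' i m e'] s that eq by simp
    moreover have "i \<in> J \<longleftrightarrow> i \<in> J'" if "1 \<le> i \<and> i \<le> m" for i
      using mem_bar0(2)[of K J i m e] mem_bar0(2)[of K' J' i m e'] s that eq by simp
    moreover have "e = e'" using one_mem_bar0[of K J e m] one_mem_bar0[of K' J' e' m] eq by simp
    moreover have "i \<notin> K \<and> i \<notin> K' \<and> i \<notin> J \<and> i \<notin> J'" if "\<not> (1 \<le> i \<and> i \<le> m)" for i
      using s that by (metis atLeastAtMost_iff subsetD)
    ultimately have "K = K' \<and> J = J' \<and> e = e'" by blast
    then show "x = y" unfolding x y by simp
  qed
  have size: "2 * card K + card J + of_bool e = n \<longleftrightarrow> sum_list (bar0 K J e m) = sum_list (core (- int m)) + n"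
    if "K \<subseteq> {1..m}" "J \<subseteq> {1..m}" "K \<inter> J = {}" for K J e
    using that by (simp add: sum_list_bar0 length_select)
  have img: "?b ` ?P = I_set 0 n (- int m)"
  proof (rule equalityI; rule subsetI)
    fix \<mu> assume "\<mu> \<in> ?b ` ?P"
    then obtain K J e where "\<mu> = bar0 K J e m"
      and s: "K \<subseteq> {1..m}" "J \<subseteq> {1..m}" "K \<inter> J = {}" and c: "2 * card K + card J + of_bool e = n"
      by (elim imageE) (simp add: case_prod_unfold)
    have "\<exists>K' J' e'. K' \<subseteq> {1..m} \<and> J' \<subseteq> {1..m} \<and> K' \<inter> J' = {} \<and> \<mu> = bar0 K' J' e' m"
      by (intro exI[of _ K] exI[of _ J] exI[of _ e] conjI) fact+
    from iffD2[OF grows_bar0 this] show "\<mu> \<in> I_set 0 n (- int m)"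
      unfolding I_set_iff using size[OF s] c \<open>\<mu> = bar0 K J e m\<close> by simp
  next
    fix \<mu> assume \<mu>: "\<mu> \<in> I_set 0 n (- int m)"
    then have "strict_partition \<mu> \<and> grows_in_color 0 (core (- int m)) \<mu>" unfolding I_set_iff by simp
    from iffD1[OF grows_bar0 this] obtain K J e where e: "\<mu> = bar0 K J e m"
      and s: "K \<subseteq> {1..m}" "J \<subseteq> {1..m}" "K \<inter> J = {}"
      by (elim exE conjE)
    have "2 * card K + card J + of_bool e = n" using size[OF s] \<mu> e unfolding I_set_iff by simp
    then show "\<mu> \<in> ?b ` ?P" using e s by (intro image_eqI[of _ _ "(K, J, e)"]) simp_all
  qed
  have "(\<Sum>\<mu>\<in>I_set 0 n (- int m). F \<mu>) = (\<Sum>x\<in>?P. F (?b x))"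
    unfolding img[symmetric] by (rule sum.reindex[OF inj, unfolded comp_def])
  then show ?thesis by (simp add: case_prod_unfold)
qed

lemma sum_I_set_1:
  assumes "n \<le> m"
  shows "(\<Sum>\<mu>\<in>I_set 1 n (int m). F \<mu>) = (\<Sum>K | K \<subseteq> {1..m} \<and> card K = m - n. F (bar1 K m))"
proof -
  let ?P = "{K. K \<subseteq> {1..m} \<and> card K = m - n}"
  have inj: "inj_on (\<lambda>K. bar1 K m) ?P"
  proof (rule inj_onI)
    fix K K' assume s: "K \<in> ?P" "K' \<in> ?P" "bar1 K m = bar1 K' m"
    have "i \<in> K \<longleftrightarrow> i \<in> K'" if "1 \<le> i \<and> i \<le> m" for i
      using mem_bar1[of i m K] mem_bar1[of i m K'] s that by simp
    moreover have "i \<notin> K \<and> i \<notin> K'" if "\<not> (1 \<le> i \<and> i \<le> m)" for i using s(1,2) that by auto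
    ultimately show "K = K'" by blast
  qed
  have size: "card K = m - n \<longleftrightarrow> sum_list (bar1 K m) = sum_list (core (int m)) + n" if "K \<subseteq> {1..m}" for K
  proof -
    have "card K \<le> m" using card_mono[OF _ that] by simp
    then show ?thesis using sum_list_bar1[of K m] assms that by (simp add: length_select) linarith
  qed
  have img: "(\<lambda>K. bar1 K m) ` ?P = I_set 1 n (int m)"
  proof (rule equalityI; rule subsetI)
    fix \<mu> assume "\<mu> \<in> (\<lambda>K. bar1 K m) ` ?P"
    then obtain K where K: "\<mu> = bar1 K m" "K \<subseteq> {1..m}" "card K = m - n" by blast
    then have "\<exists>K. K \<subseteq> {1..m} \<and> \<mu> = bar1 K m" by blast
    from iffD2[OF grows_bar1 this] show "\<mu> \<in> I_set 1 n (int m)"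
      unfolding I_set_iff using size[OF K(2)] K by simp
  next
    fix \<mu> assume \<mu>: "\<mu> \<in> I_set 1 n (int m)"
    then have "strict_partition \<mu> \<and> grows_in_color 1 (core (int m)) \<mu>" unfolding I_set_iff by simp
    from iffD1[OF grows_bar1 this] obtain K where K: "\<mu> = bar1 K m" "K \<subseteq> {1..m}"
      by (elim exE conjE)
    have "card K = m - n" using size[OF K(2)] \<mu> K unfolding I_set_iff by simp
    then show "\<mu> \<in> (\<lambda>K. bar1 K m) ` ?P" using K by (intro image_eqI[of _ _ K]) simp_all
  qed
  show ?thesis
    unfolding img[symmetric] by (rule sum.reindex[OF inj, unfolded comp_def])
qed

section \<open>Quotients and signs of the parametrized partitions\<close>

lemma admissible_bar0: "admissible m (bar0 K J e m)"
  unfolding admissible_def by (auto dest!: bar0_le)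

lemma admissible_bar1: "admissible m (bar1 K m)"
  unfolding admissible_def by (auto dest!: bar1_le)

lemma mod3_simps [simp]:
  "(3 * m + 1) mod 3 = Suc 0" "(3 * m + 2) mod 3 = 2" "(3 * m + 3) mod 3 = 0" "(3 * m + 4) mod 3 = (Suc 0::nat)"
  "Suc (3 * m) mod 3 = Suc 0" "Suc (Suc (3 * m)) mod 3 = 2"
  by presburger+

lemma residue_parts_bar0:
  assumes "K \<inter> J = {}"
  shows "length (residue_parts 1 (bar0 K J e m)) = length (select K (down m)) + of_bool e"
    and "quotient0 (bar0 K J e m) = select J (down m)"
    and "length (residue_parts 0 (bar0 K J e m)) = length (select J (down m))"
    and "length (residue_parts 2 (bar0 K J e m)) + length (select K (down m)) + length (select J (down m)) = m"
    and "length (bar0 K J e m) = m + of_bool e"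
  using assms by (induction m) (auto simp: quotient0_def)

lemma residue_parts_bar1:
  "length (residue_parts 1 (bar1 K m)) = length (select K (down m))"
  "length (residue_parts 2 (bar1 K m)) + length (select K (down m)) = m"
  by (induction m) auto

text \<open>
  The part \<open>3 * i + 1\<close> shows as the positions \<open>i\<close> and
  \<open>- i\<close>, the part \<open>3 * i\<close> only as \<open>- i\<close>, the part
  \<open>3 * i - 1\<close> not at all, and the part 1 is the position 0.
\<close>

lemma maya_bar0:
  assumes "K \<inter> J = {}"
  shows "maya m (bar0 K J e m) = nested K J int (\<lambda>i. - int i) (if e then [0] else []) (down m)"
proof (induction m)
  case 0
  show ?case by (simp add: maya_def)
next
  case (Suc m)
  have n: "3 * m + 2 \<notin> set (bar0 K J e m)" by (auto dest: bar0_le)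
  consider "Suc m \<in> K" "Suc m \<notin> J" | "Suc m \<notin> K" "Suc m \<in> J" | "Suc m \<notin> K" "Suc m \<notin> J" using assms by blast
  then show ?case
  proof cases
    case 1
    have "(int (3 * m + 4) - 1) div 3 = int (Suc m)" by simp
    then show ?thesis using 1 Suc maya_Suc_Cons[OF n, of "3 * m + 4"] by simp
  next
    case 2
    then show ?thesis using Suc maya_Suc_Cons[OF n, of "3 * m + 3"] by simp
  next
    case 3
    then show ?thesis using Suc maya_Suc_Cons_2[of m "bar0 K J e m"] by simp
  qed
qed

lemma maya_bar1: "maya m (bar1 K m) = nested K {} (\<lambda>i. int i - 1) (\<lambda>i. - int i) [] (down m)"
proof (induction m)
  case 0
  show ?case by (simp add: maya_def)
next
  case (Suc m)
  have n: "3 * m + 2 \<notin> set (bar1 K m)" by (auto dest: bar1_le)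
  show ?case
  proof (cases "Suc m \<in> K")
    case True
    then show ?thesis using Suc maya_Suc_Cons[OF n, of "3 * m + 1"] by simp
  next
    case False
    then show ?thesis using Suc maya_Suc_Cons_2[of m "bar1 K m"] by simp
  qed
qed

lemma nested_map: "map f (nested K J p q zs xs) = nested K J (f \<circ> p) (f \<circ> q) (map f zs) xs"
  by (induction xs) auto

text \<open>
  The sign \<open>\<delta>_0\<close> together with the sign of the reordering of rows is, up to a
  sign that depends on \<open>m\<close> only, a product of local factors over \<open>K\<close> and
  \<open>J\<close> and a factor that depends only on the size of \<open>J\<close> and on the flags.
  In the application \<open>w\<close> is \<open>m\<close>, and \<open>b\<close> says whether the
  part 0 is appended.
\<close>

lemma stats_parity_bar0:
  assumes d: "K \<inter> J = {}" and w: "even (of_bool b + of_bool e + w)"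
  shows "even (f_stat (bar0 K J e m) + g_padded b (bar0 K J e m) + w * h_stat (bar0 K J e m)
      + crossings K J (of_bool e) (down m)
    + ((\<Sum>i\<leftarrow>down m. i + 1 + w) + (\<Sum>i\<leftarrow>select K (down m). i + 1) + sum_list (select J (down m))
      + length (select J (down m)) * (of_bool e + 1 + w) + (\<Sum>k<length (select J (down m)). k)
      + of_bool (b \<and> e)))"
proof (induction m)
  case 0
  show ?case by (simp add: f_stat_def h_stat_def g_padded_def)
next
  case (Suc m)
  have lt: "x < 3 * m + 2" if "x \<in> set (bar0 K J e m)" for x using bar0_le[OF that] by simp
  have g: "g_padded b (p # bar0 K J e m) = g_padded b (bar0 K J e m)
      + (if p mod 3 = 1 then length (select J (down m)) + of_bool b else 0)" if "p \<ge> 3 * m + 2" for p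
    using g_padded_Cons[of "bar0 K J e m" p b] lt that residue_parts_bar0(3)[OF d, of e m] by fastforce
  consider "Suc m \<in> K" "Suc m \<notin> J" | "Suc m \<notin> K" "Suc m \<in> J" | "Suc m \<notin> K" "Suc m \<notin> J" using d by blast
  then show ?case
  proof cases
    case 1
    have eqs: "f_stat (bar0 K J e (Suc m)) = f_stat (bar0 K J e m)"
      "g_padded b (bar0 K J e (Suc m)) = g_padded b (bar0 K J e m) + (length (select J (down m)) + of_bool b)"
      "h_stat (bar0 K J e (Suc m)) = h_stat (bar0 K J e m)"
      "crossings K J (of_bool e) (down (Suc m)) = of_bool e + length (select J (down m)) + crossings K J (of_bool e) (down m)"
      "(\<Sum>i\<leftarrow>down (Suc m). i + 1 + w) = Suc m + 1 + w + (\<Sum>i\<leftarrow>down m. i + 1 + w)"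
      "(\<Sum>i\<leftarrow>select K (down (Suc m)). i + 1) = Suc m + 1 + (\<Sum>i\<leftarrow>select K (down m). i + 1)"
      "select J (down (Suc m)) = select J (down m)"
      using 1 by (simp_all add: f_stat_def h_stat_def g)
    have step: "even (F + G + H + C + (D + KS + JS + P + T + B)) \<Longrightarrow> even (ob + oe + w) \<Longrightarrow>
      even (F + (G + (j + ob)) + H + (oe + j + C) + ((Suc m + 1 + w + D) + (Suc m + 1 + KS) + JS + P + T + B))"
      for F G H C D KS JS P T B ob oe j :: nat
    proof -
      assume a: "even (F + G + H + C + (D + KS + JS + P + T + B))" "even (ob + oe + w)"
      have "F + (G + (j + ob)) + H + (oe + j + C) + ((Suc m + 1 + w + D) + (Suc m + 1 + KS) + JS + P + T + B)
        = (F + G + H + C + (D + KS + JS + P + T + B)) + (ob + oe + w) + 2 * (j + m + 2)" by simp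
      then show ?thesis using dvd_add[OF dvd_add[OF a] dvd_triv_left] by (rule ssubst)
    qed
    show ?thesis unfolding eqs by (rule step[OF Suc w])
  next
    case 2
    have eqs: "f_stat (bar0 K J e (Suc m)) = f_stat (bar0 K J e m)"
      "g_padded b (bar0 K J e (Suc m)) = g_padded b (bar0 K J e m)"
      "h_stat (bar0 K J e (Suc m)) = h_stat (bar0 K J e m)"
      "crossings K J (of_bool e) (down (Suc m)) = of_bool e + length (select J (down m)) + crossings K J (of_bool e) (down m)"
      "(\<Sum>i\<leftarrow>down (Suc m). i + 1 + w) = Suc m + 1 + w + (\<Sum>i\<leftarrow>down m. i + 1 + w)"
      "select K (down (Suc m)) = select K (down m)"
      "sum_list (select J (down (Suc m))) = Suc m + sum_list (select J (down m))"
      "length (select J (down (Suc m))) * (of_bool e + 1 + w)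
        = of_bool e + 1 + w + length (select J (down m)) * (of_bool e + 1 + w)"
      "(\<Sum>k<length (select J (down (Suc m))). k) = (\<Sum>k<length (select J (down m)). k) + length (select J (down m))"
      using 2 by (simp_all add: f_stat_def h_stat_def g)
    have step: "even (F + G + H + C + (D + KS + JS + P + T + B)) \<Longrightarrow>
      even (F + G + H + (oe + j + C) + ((Suc m + 1 + w + D) + KS + (Suc m + JS) + (oe + 1 + w + P) + (T + j) + B))"
      for F G H C D KS JS P T B oe j :: nat
    proof -
      assume a: "even (F + G + H + C + (D + KS + JS + P + T + B))"
      have "F + G + H + (oe + j + C) + ((Suc m + 1 + w + D) + KS + (Suc m + JS) + (oe + 1 + w + P) + (T + j) + B)
        = (F + G + H + C + (D + KS + JS + P + T + B)) + 2 * (oe + j + m + 2 + w)" by simp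
      then show ?thesis using dvd_add[OF a dvd_triv_left] by (rule ssubst)
    qed
    show ?thesis unfolding eqs by (rule step[OF Suc])
  next
    case 3
    have eqs: "f_stat (bar0 K J e (Suc m)) = 3 * m + 2 + f_stat (bar0 K J e m)"
      "g_padded b (bar0 K J e (Suc m)) = g_padded b (bar0 K J e m)"
      "w * h_stat (bar0 K J e (Suc m)) = w + w * h_stat (bar0 K J e m)"
      "crossings K J (of_bool e) (down (Suc m)) = crossings K J (of_bool e) (down m)"
      "(\<Sum>i\<leftarrow>down (Suc m). i + 1 + w) = Suc m + 1 + w + (\<Sum>i\<leftarrow>down m. i + 1 + w)"
      "select K (down (Suc m)) = select K (down m)" "select J (down (Suc m)) = select J (down m)"
      using 3 by (simp_all add: f_stat_def h_stat_def g)
    have step: "even (F + G + H + C + (D + KS + JS + P + T + B)) \<Longrightarrow>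
      even (3 * m + 2 + F + G + (w + H) + C + ((Suc m + 1 + w + D) + KS + JS + P + T + B))"
      for F G H C D KS JS P T B :: nat
    proof -
      assume a: "even (F + G + H + C + (D + KS + JS + P + T + B))"
      have "3 * m + 2 + F + G + (w + H) + C + ((Suc m + 1 + w + D) + KS + JS + P + T + B)
        = (F + G + H + C + (D + KS + JS + P + T + B)) + 2 * (2 * m + 2 + w)" by simp
      then show ?thesis using dvd_add[OF a dvd_triv_left] by (rule ssubst)
    qed
    show ?thesis unfolding eqs by (rule step[OF Suc])
  qed
qed

section \<open>Color 1\<close>

corollary sum_pairs:
  fixes p q :: "nat \<Rightarrow> nat \<Rightarrow> 'a::field_char_0"
  assumes xs: "distinct xs"
  shows "(\<Sum>K | K \<subseteq> set xs \<and> card K = r. (\<Prod>i\<in>K. \<epsilon> i) * rows_det (in_pairs p q (select K xs)))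
    = pfaffian r (\<lambda>c d. \<Sum>i\<in>set xs. \<epsilon> i * (p i c * q i d - q i c * p i d))"
proof -
  let ?A = "\<lambda>_ _ :: nat. 0 :: 'a"
  let ?F = "\<lambda>K J. (\<Prod>i\<in>K. \<epsilon> i) * pf_list ?A (select J xs) * rows_det (in_pairs p q (select K xs) @ map q (select J xs))"
  let ?P = "{(K, J). K \<subseteq> set xs \<and> J \<subseteq> set xs \<and> K \<inter> J = {} \<and> 2 * card K + card J = 2 * r}"
  have "pfaffian r (\<lambda>c d. \<Sum>i\<in>set xs. \<epsilon> i * (p i c * q i d - q i c * p i d)) = (\<Sum>(K, J)\<in>?P. ?F K J)"
    using sum_pairs_singles[where A = ?A and r = r and \<epsilon> = \<epsilon> and p = p and q = q, OF _ xs] by simp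
  also have "\<dots> = (\<Sum>(K, J)\<in>{(K, J). K \<subseteq> set xs \<and> J = {} \<and> card K = r}. ?F K J)"
  proof (rule sum.mono_neutral_right)
    have "?P \<subseteq> Pow (set xs) \<times> Pow (set xs)" by auto
    then show "finite ?P" by (rule finite_subset) simp
    show "\<forall>x\<in>?P - {(K, J). K \<subseteq> set xs \<and> J = {} \<and> card K = r}. (case x of (K, J) \<Rightarrow> ?F K J) = 0"
    proof
      fix KJ assume KJ: "KJ \<in> ?P - {(K, J). K \<subseteq> set xs \<and> J = {} \<and> card K = r}"
      obtain K J where [simp]: "KJ = (K, J)" by (rule prod.exhaust)
      have *: "K \<subseteq> set xs" "J \<subseteq> set xs" "2 * card K + card J = 2 * r"
        "\<not> (K \<subseteq> set xs \<and> J = {} \<and> card K = r)"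
        using KJ by auto
      then have "J \<noteq> {}" by auto
      then obtain x where x: "x \<in> set (select J xs)" using *(2) by auto
      have "even (card J)" using *(3) by presburger
      then have "even (length (select J xs))" using xs *(2) by (simp add: length_select)
      with x have "pf_list ?A (select J xs) = 0" by (rule pf_list_zero_row) simp
      then show "(case KJ of (K, J) \<Rightarrow> ?F K J) = 0" by simp
    qed
  qed auto
  also have "\<dots> = (\<Sum>K | K \<subseteq> set xs \<and> card K = r. (\<Prod>i\<in>K. \<epsilon> i) * rows_det (in_pairs p q (select K xs)))"
  proof (rule sum.reindex_bij_witness[where i = "\<lambda>K. (K, {})" and j = fst], goal_cases)
    case (5 KJ)
    have "select {} xs = []" by (simp add: select_def)
    then show ?case using 5 by (auto simp: pf_list_Nil)
  qed auto
  finally show ?thesis by simp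
qed

lemma in_pairs_upt: "in_pairs p q [0..<r] = map (\<lambda>j. if even j then p (j div 2) else q (j div 2)) [0..<2 * r]"
proof (induction r)
  case (Suc r)
  have "in_pairs p q (xs @ ys) = in_pairs p q xs @ in_pairs p q ys" for xs ys :: "nat list"
    by (simp add: in_pairs_def)
  moreover have "[0..<2 * Suc r] = [0..<2 * r] @ [2 * r, 2 * r + 1]" by simp
  ultimately show ?case using Suc by simp
qed simp

text \<open>
  A matrix that is the identity on the even rows and columns and \<open>M\<close> on the odd ones,
  interleaved. Only permutations that fix the even numbers contribute, and these are the
  permutations of the odd numbers.
\<close>

lemma rows_det_interleaved_identity:
  fixes M :: "nat \<Rightarrow> nat \<Rightarrow> 'a::field_char_0"
  shows "rows_det (in_pairs (\<lambda>i c. if c = 2 * i then 1 else 0) (\<lambda>i c. if odd c then M i (c div 2) else 0) [0..<r])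
    = rows_det (map M [0..<r])"
proof -
  define f where "f j = (if even j then (\<lambda>c. if c = 2 * (j div 2) then 1 else 0)
    else (\<lambda>c. if odd c then M (j div 2) (c div 2) else 0 :: 'a))" for j :: nat
  define F where "F \<sigma> = of_int (sign \<sigma>) * (\<Prod>j<2 * r. f j (\<sigma> j))" for \<sigma>
  let ?o = "\<lambda>i. 2 * i + 1 :: nat"
  let ?O = "?o ` {..<r}"
  have "rows_det (in_pairs (\<lambda>i c. if c = 2 * i then 1 else 0) (\<lambda>i c. if odd c then M i (c div 2) else 0) [0..<r])
    = (\<Sum>\<sigma> | \<sigma> permutes {..<2 * r}. F \<sigma>)"
    unfolding in_pairs_upt rows_det_leibniz F_def f_def ..
  also have "\<dots> = (\<Sum>\<sigma> | \<sigma> permutes ?O. F \<sigma>)"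
  proof (rule sum.mono_neutral_right)
    show "finite {\<sigma>. \<sigma> permutes {..<2 * r}}" by (rule finite_permutations) simp
    have O: "?O \<subseteq> {..<2 * r}" by auto
    show "{\<sigma>. \<sigma> permutes ?O} \<subseteq> {\<sigma>. \<sigma> permutes {..<2 * r}}"
      using permutes_subset[OF _ O] by blast
    show "\<forall>\<sigma>\<in>{\<sigma>. \<sigma> permutes {..<2 * r}} - {\<sigma>. \<sigma> permutes ?O}. F \<sigma> = 0"
    proof
      fix \<sigma> assume "\<sigma> \<in> {\<sigma>. \<sigma> permutes {..<2 * r}} - {\<sigma>. \<sigma> permutes ?O}"
      then have s: "\<sigma> permutes {..<2 * r}" "\<not> \<sigma> permutes ?O" by auto
      have "\<exists>x\<in>{..<2 * r} - ?O. \<sigma> x \<noteq> x"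
      proof (rule ccontr)
        assume "\<not> ?thesis"
        then have "\<sigma> permutes ?O" by (intro permutes_superset[OF s(1)]) blast
        with s(2) show False ..
      qed
      then obtain x where x: "x < 2 * r" "x \<notin> ?O" "\<sigma> x \<noteq> x" by auto
      have "even x"
      proof (rule ccontr)
        assume "odd x"
        then have "x = ?o (x div 2)" "x div 2 < r" using x(1) by auto
        then have "x \<in> ?O" by blast
        with x(2) show False ..
      qed
      then have "f x (\<sigma> x) = 0" using x(3) by (simp add: f_def)
      then have "(\<Prod>j<2 * r. f j (\<sigma> j)) = 0" using x(1) by (intro prod_zero) auto
      then show "F \<sigma> = 0" unfolding F_def by (simp only: mult_zero_right)
    qed
  qed
  also have "\<dots> = (\<Sum>\<sigma> | \<sigma> permutes {..<r}. of_int (sign \<sigma>) * (\<Prod>i<r. M i (\<sigma> i)))"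
  proof -
    let ?h = "map_permutation {..<r} ?o"
    have bb: "bij_betw ?o {..<r} ?O" by (auto simp: bij_betw_def inj_on_def)
    have Fh: "F (?h \<sigma>) = of_int (sign \<sigma>) * (\<Prod>i<r. M i (\<sigma> i))" if s: "\<sigma> permutes {..<r}" for \<sigma>
    proof -
      have p: "?h \<sigma> permutes ?O" by (rule map_permutation_permutes[OF bb s])
      have ev: "?h \<sigma> (2 * i) = 2 * i" for i by (rule permutes_not_in[OF p]) (auto; presburger)
      have od: "?h \<sigma> (?o i) = ?o (\<sigma> i)" if "i < r" for i
        using that by (subst map_permutation_apply) (auto simp: inj_on_def)
      have sg: "sign (?h \<sigma>) = sign \<sigma>" by (rule sign_map_permutation[OF _ s]) (auto simp: inj_on_def)
      have "(\<Prod>j<2 * r. f j (?h \<sigma> j)) = (\<Prod>i<r. f (2 * i) (?h \<sigma> (2 * i)) * f (?o i) (?h \<sigma> (?o i)))"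
        by (rule prod_lessThan_double)
      also have "\<dots> = (\<Prod>i<r. M i (\<sigma> i))"
      proof (rule prod.cong[OF refl])
        fix i assume "i \<in> {..<r}"
        then have "f (?o i) (?h \<sigma> (?o i)) = M i (\<sigma> i)" unfolding od[OF \<open>i \<in> {..<r}\<close>[unfolded lessThan_iff]] by (simp add: f_def)
        moreover have "f (2 * i) (?h \<sigma> (2 * i)) = 1" unfolding ev by (simp add: f_def)
        ultimately show "f (2 * i) (?h \<sigma> (2 * i)) * f (?o i) (?h \<sigma> (?o i)) = M i (\<sigma> i)" by (simp only: mult_1_left)
      qed
      finally show ?thesis unfolding F_def sg by simp
    qed
    show ?thesis unfolding sum_map_permutation[OF bb] by (intro sum.cong refl Fh) simp
  qed
  finally show ?thesis unfolding rows_det_leibniz .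
qed

text \<open>
  A checkerboard matrix is the sum over \<open>i\<close> of the 2-forms
  \<open>e_{2 i} \<and> M_i\<close>, where \<open>e\<close> denotes unit vectors and
  \<open>M_i\<close> is the \<open>i\<close>-th row of \<open>M\<close> put on the odd columns. The
  formula for sums over pairs then has the single summand in which all pairs are used.
\<close>

lemma pfaffian_checkerboard:
  fixes M :: "nat \<Rightarrow> nat \<Rightarrow> 'a::field_char_0"
  shows "pfaffian r (\<lambda>c d. if even c \<and> odd d then M (c div 2) (d div 2)
      else if odd c \<and> even d then - M (d div 2) (c div 2) else 0) = rows_det (map M [0..<r])"
proof -
  let ?p = "\<lambda>i c. if c = 2 * i then 1 else 0 :: 'a" and ?q = "\<lambda>i c. if odd c then M i (c div 2) else 0"
  have half: "(\<Sum>i\<in>set [0..<r]. ?p i c * ?q i d) = (if even c then ?q (c div 2) d else 0)" if "c < 2 * r" for c d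
  proof -
    have "(\<Sum>i\<in>set [0..<r]. ?p i c * ?q i d) = (\<Sum>i<r. if i = c div 2 \<and> even c then ?q i d else 0)"
      by (rule sum.cong) auto
    then show ?thesis using that by (cases "even c") (auto simp: sum.delta)
  qed
  have K: "{K. K \<subseteq> set [0..<r] \<and> card K = r} = {set [0..<r]}"
    using card_subset_eq[of "set [0..<r]"] by auto
  have d: "select (set [0..<r]) [0..<r] = [0..<r]" by (simp add: select_def)
  have "rows_det (map M [0..<r]) = rows_det (in_pairs ?p ?q [0..<r])" by (rule rows_det_interleaved_identity[symmetric])
  also have "\<dots> = (\<Sum>K | K \<subseteq> set [0..<r] \<and> card K = r. (\<Prod>i\<in>K. 1) * rows_det (in_pairs ?p ?q (select K [0..<r])))"
    unfolding K by (simp only: d sum.insert sum.empty finite.emptyI empty_iff prod.neutral_const mult_1_left add_0_right not_False_eq_True)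
  also have "\<dots> = pfaffian r (\<lambda>c d. \<Sum>i\<in>set [0..<r]. 1 * (?p i c * ?q i d - ?q i c * ?p i d))"
    by (rule sum_pairs) simp
  also have "\<dots> = pfaffian r (\<lambda>c d. if even c \<and> odd d then M (c div 2) (d div 2)
      else if odd c \<and> even d then - M (d div 2) (c div 2) else 0)"
  proof (rule pfaffian_cong)
    fix c d assume "c < 2 * r" "d < 2 * r"
    have "(\<Sum>i\<in>set [0..<r]. 1 * (?p i c * ?q i d - ?q i c * ?p i d))
      = (\<Sum>i\<in>set [0..<r]. ?p i c * ?q i d) - (\<Sum>i\<in>set [0..<r]. ?p i d * ?q i c)"
      by (simp only: mult_1_left sum_subtractf mult.commute[of "?q _ c"])
    also have "\<dots> = (if even c then ?q (c div 2) d else 0) - (if even d then ?q (d div 2) c else 0)"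
      unfolding half[OF \<open>c < 2 * r\<close>] half[OF \<open>d < 2 * r\<close>] ..
    finally show "(\<Sum>i\<in>set [0..<r]. 1 * (?p i c * ?q i d - ?q i c * ?p i d))
      = (if even c \<and> odd d then M (c div 2) (d div 2)
      else if odd c \<and> even d then - M (d div 2) (c div 2) else 0)" by simp
  qed
  finally show ?thesis ..
qed

lemma rows_det_cmult: "rows_det (map (\<lambda>i c. a * f i c) [0..<r]) = a ^ r * rows_det (map f [0..<r])"
  unfolding rows_det_leibniz by (simp add: prod.distrib sum_distrib_left mult_ac)

lemma rows_det_rev: "rows_det (us @ rev vs @ ws) = (- 1) ^ (\<Sum>i<length vs. i) * rows_det (us @ vs @ ws)"
proof (induction vs arbitrary: ws)
  case (Cons v vs)
  have "rows_det (us @ rev (v # vs) @ ws) = (- 1) ^ (\<Sum>i<length vs. i) * rows_det (us @ vs @ v # ws)"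
    using Cons[of "v # ws"] by simp
  also have "rows_det (us @ vs @ v # ws) = (- 1) ^ length vs * rows_det (us @ v # vs @ ws)"
    using rows_det_move[of us v vs ws] by (simp add: power_mult_distrib[symmetric] mult.assoc[symmetric])
  finally show ?case by (simp add: power_add mult_ac)
qed simp

lemma sum_lessThan_add: "(\<Sum>i<n + r. i) = (\<Sum>i<n. i) + (\<Sum>i<r. i) + n * (r :: nat)"
  by (induction r) (auto simp: algebra_simps)

lemma choose_two_sum: "n choose 2 = (\<Sum>i<n. i)"
  by (induction n) (auto simp: numeral_2_eq_2)

lemma f_stat_parity_bar1:
  "even (f_stat (bar1 K m) + (\<Sum>i\<leftarrow>select K (down m). i - 1) + (\<Sum>i<m. i))"
proof (induction m)
  case 0
  show ?case by (simp add: f_stat_def)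
next
  case (Suc m)
  have step: "even (F + D + T) \<Longrightarrow> even (3 * m + 2 + F + D + (T + m))" "even (F + D + T) \<Longrightarrow> even (F + (m + D) + (T + m))"
    for F D T :: nat by presburger+
  show ?case
  proof (cases "Suc m \<in> K")
    case True
    then have eqs: "f_stat (bar1 K (Suc m)) = f_stat (bar1 K m)"
      "(\<Sum>i\<leftarrow>select K (down (Suc m)). i - 1) = m + (\<Sum>i\<leftarrow>select K (down m). i - 1)"
      by (simp_all add: f_stat_def)
    show ?thesis unfolding eqs sum.lessThan_Suc by (rule step(2)[OF Suc])
  next
    case False
    then have eqs: "f_stat (bar1 K (Suc m)) = 3 * m + 2 + f_stat (bar1 K m)"
      "(\<Sum>i\<leftarrow>select K (down (Suc m)). i - 1) = (\<Sum>i\<leftarrow>select K (down m). i - 1)"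
      by (simp_all add: f_stat_def)
    show ?thesis unfolding eqs sum.lessThan_Suc by (rule step(1)[OF Suc])
  qed
qed

lemma power_sum_list: "(a :: 'a::comm_monoid_mult) ^ (\<Sum>i\<leftarrow>xs. f i) = prod_list (map (\<lambda>i. a ^ f i) xs)"
  by (induction xs) (auto simp: power_add)

lemma neg_one_power_cong: "even (a + b) \<Longrightarrow> (- 1 :: 'a::ring_1) ^ a = (- 1) ^ b"
  by (auto simp: minus_one_power_iff)

lemma crossings_no_singles: "crossings K {} 0 xs = 0"
proof (induction xs)
  case (Cons x xs)
  have "select {} xs = []" by (simp add: select_def)
  then show ?case using Cons by simp
qed simp

text \<open>
  The positions \<open>i\<close> and \<open>- 1 - i\<close> together run through an integer
  interval around 0 that is long enough to contain the complete alternating convolution.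
\<close>

lemma alternating_sum_convolution:
  fixes h :: "int \<Rightarrow> 'a::field_char_0"
  assumes h: "\<And>k. k < 0 \<Longrightarrow> h k = 0" and "c \<le> int N" "d \<le> int N"
  shows "(\<Sum>i<N. (- 1) ^ i * (h (c + int i) * h (d - 1 - int i) - h (c - 1 - int i) * h (d + int i)))
    = (if c + d - 1 < 0 then 0 else (if even c then 1 else - 1) *
        (\<Sum>j\<le>nat (c + d - 1). (- 1) ^ j * h (int j) * h (c + d - 1 - int j)))" (is "_ = ?R")
proof -
  define E where "E a = (if even (a - c) then 1 else - 1) * (h a * h (c + d - 1 - a))" for a
  have 1: "(\<Sum>i<N. (- 1) ^ i * (h (c + int i) * h (d - 1 - int i))) = (\<Sum>a\<in>{c..<c + int N}. E a)"
    by (rule sum.reindex_bij_witness[where i = "\<lambda>a. nat (a - c)" and j = "\<lambda>i. c + int i"])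
      (auto simp: E_def minus_one_power_iff algebra_simps)
  have 2: "(\<Sum>i<N. (- 1) ^ i * (h (c - 1 - int i) * h (d + int i))) = (\<Sum>a\<in>{c - int N..<c}. - E a)"
    by (rule sum.reindex_bij_witness[where i = "\<lambda>a. nat (c - 1 - a)" and j = "\<lambda>i. c - 1 - int i"])
      (auto simp: E_def minus_one_power_iff algebra_simps)
  have "(\<Sum>i<N. (- 1) ^ i * (h (c + int i) * h (d - 1 - int i) - h (c - 1 - int i) * h (d + int i)))
    = (\<Sum>i<N. (- 1) ^ i * (h (c + int i) * h (d - 1 - int i))) - (\<Sum>i<N. (- 1) ^ i * (h (c - 1 - int i) * h (d + int i)))"
    unfolding right_diff_distrib sum_subtractf ..
  also have "\<dots> = (\<Sum>a\<in>{c - int N..<c}. E a) + (\<Sum>a\<in>{c..<c + int N}. E a)"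
    unfolding 1 2 sum_negf by simp
  also have "\<dots> = (\<Sum>a\<in>{c - int N..<c + int N}. E a)"
  proof -
    have "{c - int N..<c + int N} = {c - int N..<c} \<union> {c..<c + int N}" by auto
    then show ?thesis by (simp add: sum.union_disjoint disjoint_iff)
  qed
  also have "\<dots> = (\<Sum>a\<in>{0..c + d - 1}. E a)"
  proof (rule sum.mono_neutral_right)
    show "\<forall>a\<in>{c - int N..<c + int N} - {0..c + d - 1}. E a = 0"
    proof
      fix a assume "a \<in> {c - int N..<c + int N} - {0..c + d - 1}"
      then have "a < 0 \<or> c + d - 1 - a < 0" by auto
      then show "E a = 0" using h unfolding E_def by auto
    qed
  qed (use assms in auto)
  also have "\<dots> = ?R"
  proof (cases "c + d - 1 < 0")
    case True
    then show ?thesis by simp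
  next
    case False
    have "(\<Sum>a\<in>{0..c + d - 1}. E a)
      = (\<Sum>j\<le>nat (c + d - 1). (if even c then 1 else - 1) * ((- 1) ^ j * h (int j) * h (c + d - 1 - int j)))"
      by (rule sum.reindex_bij_witness[where i = int and j = nat])
        (use False in \<open>auto simp: E_def minus_one_power_iff even_nat_iff\<close>)
    then show ?thesis using False by (simp add: sum_distrib_left)
  qed
  finally show ?thesis .
qed

lemma h_fun_alternating_sum:
  fixes t :: "nat \<Rightarrow> 'a::field_char_0"
  assumes "c \<le> int N" "d \<le> int N"
  shows "(\<Sum>i<N. (- 1) ^ i * (h_fun t (c + int i) * h_fun t (d - 1 - int i) - h_fun t (c - 1 - int i) * h_fun t (d + int i)))
    = (if even (c + d) then 0 else (if even c then 1 else - 1) * h_fun (\<lambda>j. 2 * t (2 * j)) ((c + d - 1) div 2))"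
proof (cases "c + d - 1 < 0")
  case True
  then show ?thesis
    using alternating_sum_convolution[of "h_fun t" c N d, OF h_fun_neg assms] by (simp add: h_fun_neg)
next
  case False
  then obtain k where k: "c + d - 1 = int k" using zero_le_imp_eq_int[of "c + d - 1"] by auto
  let ?t = "\<lambda>j. 2 * t (2 * j)"
  have "exp_series (\<lambda>n. if even n then 2 * t n else 0) = exp_series (\<lambda>n. if even n then ?t (n div 2) else 0)"
    by (rule exp_series_cong) auto
  then have "(\<Sum>j\<le>k. (- 1) ^ j * h_fun t (int j) * h_fun t (int k - int j))
    = fps_nth (exp_series (\<lambda>n. if even n then ?t (n div 2) else 0)) k"
    by (simp only: h_fun_convolution)
  also have "\<dots> = (if even k then fps_nth (exp_series ?t) (k div 2) else 0)"
    by (rule exp_series_double)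
  also have "\<dots> = (if even (c + d) then 0 else h_fun ?t ((c + d - 1) div 2))"
  proof -
    have "even (c + d) \<longleftrightarrow> odd k" using k by presburger
    moreover have "h_fun ?t ((c + d - 1) div 2) = fps_nth (exp_series ?t) (k div 2)"
      unfolding k by (simp add: h_fun_exp_series nat_div_distrib)
    ultimately show ?thesis by simp
  qed
  finally have "(\<Sum>j\<le>k. (- 1) ^ j * h_fun t (int j) * h_fun t (int k - int j))
    = (if even (c + d) then 0 else h_fun ?t ((c + d - 1) div 2))" .
  then show ?thesis
    using alternating_sum_convolution[of "h_fun t" c N d, OF h_fun_neg assms] False k by simp
qed

text \<open>
  All Maya positions come in pairs \<open>i - 1, - i\<close>. The Pfaffian that results from the
  summation has a checkerboard matrix, because the alternating convolution of \<open>h\<close>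
  vanishes in odd degree.
\<close>

theorem sum_color_1:
  fixes t :: "nat \<Rightarrow> 'a::field_char_0"
  assumes "n \<le> m"
  shows "(\<Sum>\<mu>\<in>I_set 1 n (int m). delta1 n \<mu> * schur (quotient1 \<mu>) t)
    = schur (rectangle (m - n) n) (\<lambda>j. 2 * t (2 * j))"
proof -
  define r where "r = m - n"
  have m: "m = n + r" using assms by (simp add: r_def)
  define d where "d = int r - int n"
  define row where "row x c = h_fun t (x + int c + 1 - d)" for x c
  define p where "p i = row (int i - 1)" for i :: nat
  define q where "q i = row (- int i)" for i :: nat
  define w :: 'a where "w = (- 1) ^ ((\<Sum>i<m. i) + (n choose 2))"
  let ?t = "\<lambda>j. 2 * t (2 * j)"
  let ?B = "\<lambda>c e. \<Sum>i\<in>{1..m}. (- 1) ^ (i - 1) * (p i c * q i e - q i c * p i e)"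
  let ?X = "map (\<lambda>i j. h_fun ?t (int i + int j + 1 - d)) [0..<r]" and ?Y = "map (\<lambda>i j. h_fun ?t (int n + int j - int i)) [0..<r]"
  let ?M = "\<lambda>i j. (- 1) ^ (m + 1) * h_fun ?t (int i + int j + 1 - d)"
  have term_eq: "delta1 n (bar1 K m) * schur (quotient1 (bar1 K m)) t
    = w * ((\<Prod>i\<in>K. (- 1) ^ (i - 1)) * rows_det (in_pairs p q (select K (down m))))"
    if K: "K \<subseteq> {1..m}" "card K = r" for K
  proof -
    have len: "length (select K (down m)) = r" using K by (simp add: length_select)
    have "schur (quotient1 (bar1 K m)) t = rows_det (map row (maya m (bar1 K m)))"
      unfolding row_def
      by (rule schur_quotient1[OF strict_bar1 admissible_bar1])
        (use residue_parts_bar1[where K = K and m = m] len m in \<open>simp add: d_def\<close>)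
    also have "map row (maya m (bar1 K m)) = nested K {} p q [] (down m)"
    proof -
      have "row \<circ> (\<lambda>i. int i - 1) = p" "row \<circ> (\<lambda>i. - int i) = q" by (auto simp: fun_eq_iff p_def q_def)
      then show ?thesis unfolding maya_bar1 nested_map by simp
    qed
    also have "rows_det (nested K {} p q [] (down m)) = rows_det (in_pairs p q (select K (down m)))"
    proof -
      have "select {} (down m) = []" by (simp add: select_def)
      then show ?thesis using rows_det_nested[of K "{}" "[]" p q "[]" "down m" "[]"] by (simp add: crossings_no_singles)
    qed
    finally have sch: "schur (quotient1 (bar1 K m)) t = rows_det (in_pairs p q (select K (down m)))" .
    have "(\<Prod>i\<in>K. (- 1 :: 'a) ^ (i - 1)) = prod_list (map (\<lambda>i. (- 1) ^ (i - 1)) (select K (down m)))"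
      using K by (simp add: prod_list_select)
    also have "\<dots> = (- 1) ^ (\<Sum>i\<leftarrow>select K (down m). i - 1)" by (rule power_sum_list[symmetric])
    finally have pr: "(\<Prod>i\<in>K. (- 1 :: 'a) ^ (i - 1)) = (- 1) ^ (\<Sum>i\<leftarrow>select K (down m). i - 1)" .
    have "delta1 n (bar1 K m) = w * (- 1) ^ (\<Sum>i\<leftarrow>select K (down m). i - 1)"
      unfolding delta1_def w_def power_add[symmetric]
    proof (rule neg_one_power_cong)
      show "even (f_stat (bar1 K m) + (n choose 2) + ((\<Sum>i<m. i) + (n choose 2) + (\<Sum>i\<leftarrow>select K (down m). i - 1)))"
        using f_stat_parity_bar1[of K m] by presburger
    qed
    then show ?thesis unfolding sch pr by simp
  qed
  have "(\<Sum>\<mu>\<in>I_set 1 n (int m). delta1 n \<mu> * schur (quotient1 \<mu>) t)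
    = (\<Sum>K | K \<subseteq> {1..m} \<and> card K = r. w * ((\<Prod>i\<in>K. (- 1) ^ (i - 1)) * rows_det (in_pairs p q (select K (down m)))))"
    unfolding sum_I_set_1[OF assms] r_def[symmetric] by (rule sum.cong) (auto simp: term_eq)
  also have "\<dots> = w * pfaffian r (\<lambda>c e. ?B c e)"
    unfolding sum_distrib_left[symmetric] sum_pairs[OF distinct_down[of m], unfolded set_down] ..
  also have "pfaffian r (\<lambda>c e. ?B c e)
    = pfaffian r (\<lambda>c e. if even c \<and> odd e then ?M (c div 2) (e div 2)
      else if odd c \<and> even e then - ?M (e div 2) (c div 2) else 0)"
  proof (rule pfaffian_cong)
    fix c e assume ce: "c < 2 * r" "e < 2 * r"
    let ?c = "int c + 1 - d" and ?e = "int e + 1 - d"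
    have le: "?c \<le> int m" "?e \<le> int m" using ce m by (auto simp: d_def)
    have "?B c e
      = (\<Sum>i<m. (- 1) ^ i * (h_fun t (?c + int i) * h_fun t (?e - 1 - int i) - h_fun t (?c - 1 - int i) * h_fun t (?e + int i)))"
      by (rule sum.reindex_bij_witness[where i = Suc and j = "\<lambda>i. i - 1"])
        (auto simp: p_def q_def row_def algebra_simps)
    also have "\<dots> = (if even (?c + ?e) then 0 else (if even ?c then 1 else - 1) * h_fun ?t ((?c + ?e - 1) div 2))"
      by (rule h_fun_alternating_sum[OF le])
    also have "\<dots> = (if even c \<and> odd e then ?M (c div 2) (e div 2)
      else if odd c \<and> even e then - ?M (e div 2) (c div 2) else 0)"
    proof -
      have p1: "even (?c + ?e) \<longleftrightarrow> (even c \<longleftrightarrow> even e)" by presburger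
      have p2: "even ?c \<longleftrightarrow> even (c + (m + 1))" unfolding d_def m by presburger
      consider "even c" "even e" | "odd c" "odd e" | "even c" "odd e" | "odd c" "even e" by blast
      then show ?thesis
      proof cases
        case 3
        then obtain i j where ij: "c = 2 * i" "e = 2 * j + 1" by (metis evenE oddE)
        have half: "(?c + ?e - 1) div 2 = int (c div 2) + int (e div 2) + 1 - d" unfolding ij by simp
        show ?thesis unfolding half using 3 p1 p2 by (simp add: minus_one_power_iff)
      next
        case 4
        then obtain i j where ij: "e = 2 * i" "c = 2 * j + 1" by (metis evenE oddE)
        have half: "(?c + ?e - 1) div 2 = int (e div 2) + int (c div 2) + 1 - d" unfolding ij by simp
        show ?thesis unfolding half using 4 p1 p2 by (simp add: minus_one_power_iff)
      qed (use p1 in auto)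
    qed
    finally show "?B c e
      = (if even c \<and> odd e then ?M (c div 2) (e div 2)
      else if odd c \<and> even e then - ?M (e div 2) (c div 2) else 0)" .
  qed
  also have "\<dots> = rows_det (map ?M [0..<r])"
    by (rule pfaffian_checkerboard)
  also have "\<dots> = ((- 1) ^ (m + 1)) ^ r * rows_det (?X)"
    by (rule rows_det_cmult)
  also have "?X
    = rev (?Y)"
  proof (rule nth_equalityI)
    fix i assume "i < length (?X)"
    then have "i < r" by simp
    then show "?X ! i
      = rev (?Y) ! i"
      by (auto simp: rev_nth d_def fun_eq_iff of_nat_diff algebra_simps)
  qed simp
  also have "rows_det (rev (?Y))
    = (- 1) ^ (\<Sum>i<r. i) * schur (replicate r n) ?t"
  proof -
    have "schur (replicate r n) ?t = rows_det (?Y)"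
      unfolding schur_rows_det by (intro arg_cong[where f = rows_det]) auto
    then show ?thesis using rows_det_rev[of "[]" "?Y" "[]"] by simp
  qed
  also have "w * (((- 1) ^ (m + 1)) ^ r * ((- 1) ^ (\<Sum>i<r. i) * schur (replicate r n) ?t)) = schur (replicate r n) ?t"
  proof -
    have "even ((\<Sum>i<m. i) + (n choose 2) + (m + 1) * r + (\<Sum>i<r. i))"
    proof -
      have e: "(\<Sum>i<m. i) + (n choose 2) + (m + 1) * r + (\<Sum>i<r. i)
        = 2 * ((\<Sum>i<n. i) + (\<Sum>i<r. i) + n * r) + r * (r + 1)"
        unfolding m sum_lessThan_add choose_two_sum by (simp add: algebra_simps)
      show ?thesis unfolding e by simp
    qed
    then have sgn: "w * ((- 1) ^ (m + 1)) ^ r * (- 1) ^ (\<Sum>i<r. i) = 1"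
      unfolding w_def power_mult[symmetric] power_add[symmetric] by (simp only: minus_one_power_iff if_True)
    show ?thesis unfolding mult.assoc[symmetric] sgn by (rule mult_1_left)
  qed
  also have "schur (replicate r n) ?t = schur (rectangle (m - n) n) ?t"
    using schur_append_zeros[of "[]" r ?t] by (cases "n = 0") (simp_all add: rectangle_def r_def[symmetric])
  finally show ?thesis .
qed

section \<open>Color 0\<close>

lemma rows_det_cong:
  assumes len: "length us = length vs"
    and eq: "\<And>c. c < length vs \<Longrightarrow> map (\<lambda>v. v c) us = map (\<lambda>v. v c) vs"
  shows "rows_det us = rows_det vs"
proof -
  have "(us ! i) c = (vs ! i) c" if "i < length vs" "c < length vs" for i c
    using arg_cong[OF eq[OF that(2)], of "\<lambda>l. l ! i"] that(1) len by simp
  then show ?thesis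
    unfolding rows_det_def using len by (intro arg_cong[where f = det] cong_mat) auto
qed

lemma rows_det_zero_last_column:
  assumes "length vs = Suc n" "\<forall>v\<in>set vs. v n = 0"
  shows "rows_det vs = 0"
proof -
  obtain us w where "vs = us @ [w]" using assms(1) by (cases vs rule: rev_cases) auto
  then show ?thesis using assms rows_det_append_last[of us w] by simp
qed

lemma even_triangle: "even ((\<Sum>i<2 * k. i) + k)" "even ((\<Sum>i<2 * k + 1. i) + (k :: nat))"
  by (induction k) auto

lemma schur_Q_pf_list: "schur_Q \<nu> s = pf_list (Q2 s) (pad_even \<nu>)"
  by (simp add: schur_Q_def pf_list_def)

lemma schur_Q_zero: "schur_Q \<nu> (\<lambda>_. 0) = (if \<nu> = [] then 1 else 0)"
proof (cases "\<nu> = []")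
  case True
  then show ?thesis by (simp add: schur_Q_pf_list pad_even_def pf_list_Nil)
next
  case False
  then have "hd \<nu> \<in> set (pad_even \<nu>)" "even (length (pad_even \<nu>))" by (auto simp: pad_even_def)
  then have "pf_list (Q2 (\<lambda>_. 0 :: 'a)) (pad_even \<nu>) = 0"
    by (rule pf_list_zero_row) (simp add: Q2_zero)
  then show ?thesis using False by (simp add: schur_Q_pf_list)
qed

text \<open>
  The coupling of the rows \<open>V_{- a}\<close> and \<open>V_{- b}\<close>; the signs are those
  in \<open>Q_form\<close> with the minus sign with which that form enters
  \<open>skew_form_twist\<close>.
\<close>

definition Q_sign :: "(nat \<Rightarrow> 'a::field_char_0) \<Rightarrow> nat \<Rightarrow> nat \<Rightarrow> 'a" where
  "Q_sign s a b = - 1 * (- 1) ^ a * (- 1) ^ b * Q2 s a b"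

lemma Q_sign_anti: "Q_sign s a b = - Q_sign s b a"
  using Q2_anti[of s a b] by (simp add: Q_sign_def)

lemma pf_list_Q_sign:
  assumes "even (length xs)"
  shows "pf_list (Q_sign s) xs = (- 1) ^ (length xs div 2 + sum_list xs) * pf_list (Q2 s) xs"
proof -
  have "prod_list (map (\<lambda>a. (- 1 :: 'a) ^ a) xs) = (- 1) ^ sum_list xs"
    using power_sum_list[of "- 1 :: 'a" "\<lambda>i. i" xs] by simp
  then show ?thesis
    using pf_list_scale[OF assms, of "- 1" "\<lambda>a. (- 1) ^ a" "Q2 s"]
    by (simp add: Q_sign_def[abs_def] power_add)
qed

text \<open>
  The row of the Maya position \<open>x\<close> in the determinant of \<open>S_{\<mu>[1]}\<close>;
  \<open>d\<close> is the difference of the numbers of parts congruent to 1 and to 2.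
\<close>

definition schur_row :: "(nat \<Rightarrow> 'a::field_char_0) \<Rightarrow> int \<Rightarrow> int \<Rightarrow> nat \<Rightarrow> 'a" where
  "schur_row t d x c = h_fun t (x + int c + 1 - d)"

lemma schur_quotient1_bar0:
  fixes t :: "nat \<Rightarrow> 'a::field_char_0"
  assumes K: "K \<subseteq> {1..m}" "J \<subseteq> {1..m}" "K \<inter> J = {}" and n: "2 * card K + card J + of_bool e = n"
  defines "rw \<equiv> schur_row t (int n - int m)"
  shows "schur (quotient1 (bar0 K J e m)) t = (- 1) ^ crossings K J (of_bool e) (down m) *
    rows_det (in_pairs (\<lambda>i. rw (int i)) (\<lambda>i. rw (- int i)) (select K (down m))
      @ map (\<lambda>i. rw (- int i)) (select J (down m)) @ (if e then [rw 0] else []))"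
proof -
  have len: "length (select K (down m)) = card K" "length (select J (down m)) = card J"
    using K by (simp_all add: length_select)
  have "length (residue_parts 1 (bar0 K J e m)) = card K + of_bool e"
    "length (residue_parts 2 (bar0 K J e m)) + card K + card J = m"
    using residue_parts_bar0(1,4)[OF K(3), of e m] unfolding len by auto
  then have charge: "int (length (residue_parts 1 (bar0 K J e m))) - int (length (residue_parts 2 (bar0 K J e m)))
      = int n - int m"
    using n by linarith
  have "schur (quotient1 (bar0 K J e m)) t = rows_det (map rw (maya m (bar0 K J e m)))"
    unfolding rw_def schur_row_def[abs_def] by (rule schur_quotient1[OF strict_bar0 admissible_bar0 charge])
  also have "map rw (maya m (bar0 K J e m))
    = nested K J (\<lambda>i. rw (int i)) (\<lambda>i. rw (- int i)) (if e then [rw 0] else []) (down m)"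
    unfolding maya_bar0[OF K(3)] nested_map by (simp add: comp_def)
  also have "rows_det \<dots> = (- 1) ^ crossings K J (of_bool e) (down m) *
    rows_det (in_pairs (\<lambda>i. rw (int i)) (\<lambda>i. rw (- int i)) (select K (down m))
      @ map (\<lambda>i. rw (- int i)) (select J (down m)) @ (if e then [rw 0] else []))"
    using rows_det_nested[OF K(3), of "[]" "\<lambda>i. rw (int i)" "\<lambda>i. rw (- int i)" "if e then [rw 0] else []" "down m" "[]"]
    by (cases e) simp_all
  finally show ?thesis .
qed

text \<open>
  One summand of the second part, with its rows in the order pairs, singles, position 0. For even
  \<open>n\<close> the position 0 is a single like the others: an additional part 0 is appended to
  \<open>\<mu>[0]\<close> precisely when the part 1 is present. For odd \<open>n\<close> the part 0
  is appended precisely when the part 1 is absent.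
\<close>

lemma signed_term_bar0:
  fixes t s :: "nat \<Rightarrow> 'a::field_char_0"
  assumes K: "K \<subseteq> {1..m}" "J \<subseteq> {1..m}" "K \<inter> J = {}" and n: "2 * card K + card J + of_bool e = n"
  defines "rw \<equiv> schur_row t (int n - int m)" and "k \<equiv> length (pad_even (select J (down m))) div 2"
  shows "delta0 m (bar0 K J e m) * schur_Q (quotient0 (bar0 K J e m)) s * schur (quotient1 (bar0 K J e m)) t
    = (- 1) ^ ((\<Sum>i\<leftarrow>down m. i + 1 + m) + (if even n then 0 else m + 1)) *
      ((\<Prod>i\<in>K. (- 1) ^ Suc i) * pf_list (Q_sign s) (pad_even (select J (down m))) *
       ((if odd n \<and> \<not> e then - 1 else 1) *
        rows_det (in_pairs (\<lambda>i. rw (int i)) (\<lambda>i. rw (- int i)) (select K (down m))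
          @ map (\<lambda>i. rw (- int i)) (select J (down m)) @ (if e then [rw 0] else []))))"
proof -
  let ?\<mu> = "bar0 K J e m" and ?j = "length (select J (down m))"
  define b where "b = odd (m + of_bool e)"
  define C where "C = crossings K J (of_bool e) (down m)"
  define D where "D = rows_det (in_pairs (\<lambda>i. rw (int i)) (\<lambda>i. rw (- int i)) (select K (down m))
          @ map (\<lambda>i. rw (- int i)) (select J (down m)) @ (if e then [rw 0] else []))"
  define F where "F = f_stat ?\<mu>"
  define G where "G = g_padded b ?\<mu>"
  define H where "H = h_stat ?\<mu>"
  define T where "T = (\<Sum>i<?j. i)"
  define S where "S = (\<Sum>i\<leftarrow>down m. i + 1 + m)"
  define KS where "KS = (\<Sum>i\<leftarrow>select K (down m). i + 1)"
  define JS where "JS = sum_list (select J (down m))"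
  define N where "N = (if even n then 0 else m + 1)"
  have lj: "?j = card J" using K by (simp add: length_select)
  have par: "odd n \<longleftrightarrow> odd (?j + of_bool e)" unfolding n[symmetric] lj by simp
  have g: "g_stat ?\<mu> = G"
    unfolding g_stat_padded G_def b_def by (simp only: residue_parts_bar0(5)[OF K(3)])
  have "even (of_bool b + of_bool e + m)" by (auto simp: b_def)
  from stats_parity_bar0[OF K(3) this]
  have st: "even (F + G + m * H + C + (S + KS + JS + ?j * (of_bool e + 1 + m) + T + of_bool (b \<and> e)))"
    unfolding F_def G_def H_def C_def S_def KS_def JS_def T_def by simp
  have mH: "even (m * H) \<longleftrightarrow> even (if even m then 0 else H)" by simp
  have tail: "even (?j * (of_bool e + 1 + m) + T + of_bool (b \<and> e) + (N + k + of_bool (odd n \<and> \<not> e)))"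
  proof -
    have tri: "even (T + ?j div 2)" using even_triangle[of "?j div 2"] unfolding T_def
      by (cases "even ?j") (auto elim!: evenE oddE)
    have k: "k = ?j div 2 + of_bool (odd ?j)"
      unfolding k_def pad_even_def by (auto elim!: oddE)
    show ?thesis using tri par unfolding k N_def b_def by (cases e; cases "even m"; cases "even ?j") auto
  qed
  have pad: "even (length (pad_even (select J (down m))))" "sum_list (pad_even (select J (down m))) = JS"
    by (auto simp: pad_even_def JS_def)
  have pr: "(\<Prod>i\<in>K. (- 1 :: 'a) ^ Suc i) = (- 1) ^ KS"
  proof -
    have "(\<Prod>i\<in>K. (- 1 :: 'a) ^ Suc i) = prod_list (map (\<lambda>i. (- 1) ^ Suc i) (select K (down m)))"
      using K by (simp only: prod_list_select distinct_down set_down)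
    then show ?thesis using power_sum_list[of "- 1 :: 'a" "\<lambda>i. i + 1" "select K (down m)"] by (simp add: KS_def)
  qed
  have sch: "schur (quotient1 ?\<mu>) t = (- 1) ^ C * D"
    unfolding C_def D_def rw_def by (rule schur_quotient1_bar0[OF K n])
  have "(if odd n \<and> \<not> e then - 1 else 1 :: 'a) = (- 1) ^ (of_bool (odd n \<and> \<not> e) :: nat)" by auto
  then have "(- 1) ^ (S + N) * ((\<Prod>i\<in>K. (- 1) ^ Suc i) * pf_list (Q_sign s) (pad_even (select J (down m))) *
       ((if odd n \<and> \<not> e then - 1 else 1) * D))
    = (- 1) ^ (S + N + KS + (k + JS) + of_bool (odd n \<and> \<not> e)) * (pf_list (Q2 s) (pad_even (select J (down m))) * D)"
    unfolding pr pf_list_Q_sign[OF pad(1)] pad(2) k_def[symmetric] power_add by (simp only: mult_ac)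
  also have "(- 1 :: 'a) ^ (S + N + KS + (k + JS) + of_bool (odd n \<and> \<not> e)) = (- 1) ^ (F + G + (if even m then 0 else H) + C)"
  proof (rule neg_one_power_cong)
    have comb: "even (x + h + c + (y + z)) \<Longrightarrow> (even h \<longleftrightarrow> even h') \<Longrightarrow> even (z + u) \<Longrightarrow>
      even (y + u + (x + h' + c))" for x h h' c y z u :: nat by (simp only: even_add)
    have "even (F + G + m * H + C + (S + KS + JS + (?j * (of_bool e + 1 + m) + T + of_bool (b \<and> e))))"
      using st by (simp only: add.assoc)
    from comb[OF this mH tail]
    show "even (S + N + KS + (k + JS) + of_bool (odd n \<and> \<not> e) + (F + G + (if even m then 0 else H) + C))"
      by (simp only: add_ac)
  qed
  also have "(- 1) ^ (F + G + (if even m then 0 else H) + C) * (pf_list (Q2 s) (pad_even (select J (down m))) * D)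
    = delta0 m ?\<mu> * schur_Q (quotient0 ?\<mu>) s * schur (quotient1 ?\<mu>) t"
    unfolding delta0_def g F_def[symmetric] H_def[symmetric] schur_Q_pf_list residue_parts_bar0(2)[OF K(3)]
      sch power_add
    by (simp only: mult_ac)
  finally show ?thesis unfolding S_def N_def D_def ..
qed

text \<open>
  The matrix whose Pfaffian is, up to sign, the left hand side of the second part. For odd
  \<open>n\<close> the size \<open>n + 1\<close> exceeds the number of columns by one, and the
  last row and column are a border.
\<close>

definition skew_matrix :: "nat \<Rightarrow> nat \<Rightarrow> (nat \<Rightarrow> 'a::field_char_0) \<Rightarrow> nat \<Rightarrow> nat \<Rightarrow> 'a" where
  "skew_matrix m n u c d =
     (let col = (\<lambda>c. int c + 1 - (int n - int m)) in
      if c < n \<and> d < n then skew_form m (h_fun u) (col c) (col d)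
      else if c < n then h_fun u (col c)
      else if d < n then - h_fun u (col d) else 0)"

text \<open>
  The position 0 is treated as index 0: if present it is a single. An index 0 among the pairs would
  repeat the row of the position 0.
\<close>

lemma sum_I_set_0_even:
  fixes t s :: "nat \<Rightarrow> 'a::field_char_0"
  assumes n: "n = 2 * r"
  shows "(\<Sum>\<mu>\<in>I_set 0 n (- int m). delta0 m \<mu> * schur_Q (quotient0 \<mu>) s * schur (quotient1 \<mu>) t)
    = (- 1) ^ (\<Sum>i\<leftarrow>down m. i + 1 + m) * pfaffian r (skew_matrix m n (twist s t))"
proof -
  define rw where "rw = schur_row t (int n - int m)"
  let ?xs = "down m @ [0]"
  let ?p = "\<lambda>i. rw (int i)" and ?q = "\<lambda>i. rw (- int i)"
  let ?B = "\<lambda>c d. (\<Sum>i\<in>set ?xs. (- 1) ^ Suc i * (?p i c * ?q i d - ?q i c * ?p i d))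
        + (\<Sum>a\<in>set ?xs. \<Sum>b\<in>set ?xs. Q_sign s a b * ?q a c * ?q b d)"
  let ?T = "\<lambda>K J e. delta0 m (bar0 K J e m) * schur_Q (quotient0 (bar0 K J e m)) s * schur (quotient1 (bar0 K J e m)) t"
  let ?c = "(- 1) ^ (\<Sum>i\<leftarrow>down m. i + 1 + m) :: 'a"
  define X where "X K J = (\<Prod>i\<in>K. (- 1) ^ Suc i) * pf_list (Q_sign s) (select J ?xs) *
    rows_det (in_pairs ?p ?q (select K ?xs) @ map ?q (select J ?xs))" for K J
  have xs: "distinct ?xs" "set ?xs = {..m}" by auto
  let ?P = "{(K, J). K \<subseteq> set ?xs \<and> J \<subseteq> set ?xs \<and> K \<inter> J = {} \<and> 2 * card K + card J = 2 * r}"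
  let ?R = "{(K, J, e). K \<subseteq> {1..m} \<and> J \<subseteq> {1..m} \<and> K \<inter> J = {} \<and> 2 * card K + card J + of_bool e = n}"
  let ?J = "\<lambda>J e. if e then insert 0 J else J :: nat set"
  have select0: "select (?J J e) ?xs = select J (down m) @ (if e then [0] else [])" "select K ?xs = select K (down m)"
    if "J \<subseteq> {1..m}" "K \<subseteq> {1..m}" for J K e
  proof -
    have "select (insert 0 J) (down m) = select J (down m)" unfolding select_def by (rule filter_cong) auto
    then show "select (?J J e) ?xs = select J (down m) @ (if e then [0] else [])" "select K ?xs = select K (down m)"
      using that by auto
  qed
  have "pfaffian r (skew_matrix m n (twist s t))
    = pfaffian r (\<lambda>c d. ?B c d)"
  proof (rule pfaffian_cong)
    fix c d assume cd: "c < 2 * r" "d < 2 * r"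
    let ?col = "\<lambda>c. int c + 1 - (int n - int m)"
    have le: "?col c \<le> int m" "?col d \<le> int m" using cd n by auto
    have "skew_matrix m n (twist s t) c d = skew_form m (h_fun t) (?col c) (?col d) - Q_form m (Q2 s) (h_fun t) (?col c) (?col d)"
      using cd n skew_form_twist[OF le, of s t] by (simp add: skew_matrix_def)
    also have "\<dots> = ?B c d"
      unfolding xs(2) skew_form_def Q_form_def rw_def schur_row_def Q_sign_def diff_conv_add_uminus sum_negf[symmetric]
      by (intro arg_cong2[where f = "(+)"] sum.cong refl) (simp_all add: power_add algebra_simps)
    finally show "skew_matrix m n (twist s t) c d = ?B c d" .
  qed
  also have "\<dots> = (\<Sum>(K, J)\<in>?P. X K J)"
    unfolding X_def by (rule sum_pairs_singles[OF Q_sign_anti xs(1), symmetric])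
  also have "\<dots> = (\<Sum>(K, J)\<in>{x\<in>?P. 0 \<notin> fst x}. X K J)"
  proof (rule sum.mono_neutral_right)
    have "?P \<subseteq> Pow (set ?xs) \<times> Pow (set ?xs)" by auto
    then show "finite ?P" by (rule finite_subset) simp
    show "\<forall>x\<in>?P - {x\<in>?P. 0 \<notin> fst x}. (case x of (K, J) \<Rightarrow> X K J) = 0"
    proof
      fix x assume x: "x \<in> ?P - {x\<in>?P. 0 \<notin> fst x}"
      obtain K J where [simp]: "x = (K, J)" by (rule prod.exhaust)
      have "0 \<in> K" using x by auto
      then have "in_pairs ?p ?q (select K ?xs) = in_pairs ?p ?q (select K (down m)) @ [rw 0, rw 0]"
        by (simp add: in_pairs_def)
      moreover have "rows_det (us @ v # v # vs) = 0" for us vs and v :: "nat \<Rightarrow> 'a"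
        by (rule rows_det_eq_0_if_eq_rows[of "length us" _ "Suc (length us)"]) (auto simp: nth_append)
      ultimately have "X K J = 0" by (simp add: X_def)
      then show "(case x of (K, J) \<Rightarrow> X K J) = 0" by simp
    qed
  qed auto
  also have "\<dots> = (\<Sum>(K, J, e)\<in>?R. X K (?J J e))"
  proof (rule sum.reindex_bij_witness[where i = "\<lambda>(K, J, e). (K, ?J J e)" and j = "\<lambda>(K, J). (K, J - {0}, 0 \<in> J)"],
      goal_cases)
    case (1 x)
    obtain K J where x: "x = (K, J)" by (rule prod.exhaust)
    show ?case unfolding x by (cases "0 \<in> J") (simp_all add: insert_absorb)
  next
    case (2 x)
    obtain K J where x: "x = (K, J)" by (rule prod.exhaust)
    have K: "K \<subseteq> {1..m}"
    proof
      fix i assume "i \<in> K"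
      moreover have "i \<noteq> 0" using 2 x \<open>i \<in> K\<close> by (metis (no_types, lifting) fst_conv mem_Collect_eq)
      ultimately show "i \<in> {1..m}" using 2 x xs by auto
    qed
    have J: "J - {0} \<subseteq> {1..m}" "finite J" using 2 x xs by (auto intro: finite_subset)
    have "card J = card (J - {0}) + of_bool (0 \<in> J)"
      using card.remove[OF J(2), of 0] by (cases "0 \<in> J") simp_all
    moreover have "2 * card K + card J = n" "K \<inter> J = {}" using 2 x n by simp_all
    ultimately have "2 * card K + card (J - {0}) + of_bool (0 \<in> J) = n" "K \<inter> (J - {0}) = {}" by auto
    then show ?case unfolding x prod.case mem_Collect_eq using K J(1) by (intro conjI)
  next
    case (3 x)
    obtain K J e where x: "x = (K, J, e)" by (metis prod_cases3)
    have "0 \<notin> J" using 3 x by auto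
    then show ?case unfolding x by (cases e) auto
  next
    case (4 x)
    obtain K J e where x: "x = (K, J, e)" by (metis prod_cases3)
    have s: "0 \<notin> K" "0 \<notin> J" "finite J" "K \<subseteq> {..m}" "J \<subseteq> {..m}" "K \<inter> J = {}" "2 * card K + card J + of_bool e = n"
      using 4 x by (auto intro: finite_subset)
    then have "2 * card K + card (?J J e) = 2 * r" "K \<inter> ?J J e = {}" "?J J e \<subseteq> {..m}"
      using n by (cases e; simp)+
    then show ?case unfolding x prod.case mem_Collect_eq fst_conv xs(2) using s(1,4) by (intro conjI)
  next
    case (5 x)
    obtain K J where x: "x = (K, J)" by (rule prod.exhaust)
    show ?case unfolding x by (cases "0 \<in> J") (simp_all add: insert_absorb)
  qed
  finally have pf: "pfaffian r (skew_matrix m n (twist s t)) = (\<Sum>(K, J, e)\<in>?R. X K (?J J e))" .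
  have "(\<Sum>\<mu>\<in>I_set 0 n (- int m). delta0 m \<mu> * schur_Q (quotient0 \<mu>) s * schur (quotient1 \<mu>) t)
    = (\<Sum>(K, J, e)\<in>?R. ?c * X K (?J J e))"
    unfolding sum_I_set_0
  proof (rule sum.cong[OF refl])
    fix x assume "x \<in> ?R"
    moreover obtain K J e where x: "x = (K, J, e)" by (metis prod_cases3)
    ultimately have K: "K \<subseteq> {1..m}" "J \<subseteq> {1..m}" "K \<inter> J = {}" and c: "2 * card K + card J + of_bool e = n" by auto
    have "length (select J (down m)) = card J" using K by (simp add: length_select)
    moreover have "even (2 * card K + card J + of_bool e)" using c n by simp
    ultimately have "odd (length (select J (down m))) \<longleftrightarrow> e" by (cases e) simp_all
    then have pad: "pad_even (select J (down m)) = select J (down m) @ (if e then [0] else [])"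
      by (simp add: pad_even_def)
    have "?T K J e
      = ?c * X K (?J J e)"
      unfolding signed_term_bar0[OF K c] X_def select0[OF K(2,1)] pad rw_def[symmetric] using n by (cases e) simp_all
    then show "(case x of (K, J, e) \<Rightarrow> ?T K J e)
      = (case x of (K, J, e) \<Rightarrow> ?c * X K (?J J e))" unfolding x by simp
  qed
  also have "\<dots> = ?c * (\<Sum>(K, J, e)\<in>?R. X K (?J J e))"
    by (simp add: sum_distrib_left case_prod_unfold)
  finally show ?thesis unfolding pf .
qed

text \<open>
  The determinants have odd size and are bordered by one more column, in which only the row
  \<open>q 0\<close> is nonzero. A nonzero determinant therefore contains \<open>q 0\<close>: as a
  single, in the place of the part 0 that is appended to \<open>\<mu>[0]\<close>, or paired with the
  row \<open>p 0\<close> of the position 0 when the part 1 is present. Apart from the border,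
  \<open>q 0\<close> equals \<open>p 0\<close>, so that the index 0 contributes nothing to the
  alternating form and the form in \<open>Q\<close> is the same as for even \<open>n\<close>.
\<close>

lemma sum_I_set_0_odd:
  fixes t s :: "nat \<Rightarrow> 'a::field_char_0"
  assumes n: "Suc n = 2 * r"
  shows "(\<Sum>\<mu>\<in>I_set 0 n (- int m). delta0 m \<mu> * schur_Q (quotient0 \<mu>) s * schur (quotient1 \<mu>) t)
    = (- 1) ^ ((\<Sum>i\<leftarrow>down m. i + 1 + m) + (m + 1)) * pfaffian r (skew_matrix m n (twist s t))"
proof -
  define rw where "rw = schur_row t (int n - int m)"
  let ?xs = "down m @ [0]"
  define p where "p i c = (if c = n then 0 else rw (int i) c)" for i :: nat and c
  \<comment> \<open>The entry \<open>- 1\<close> gives the border of \<open>skew_matrix\<close> the sign with which \<open>h(u)\<close> enters it.\<close>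
  define q where "q i c = (if c = n then (if i = 0 then - 1 else 0) else rw (- int i) c)" for i :: nat and c
  let ?B = "\<lambda>c d. (\<Sum>i\<in>set ?xs. (- 1) ^ Suc i * (p i c * q i d - q i c * p i d))
        + (\<Sum>a\<in>set ?xs. \<Sum>b\<in>set ?xs. Q_sign s a b * q a c * q b d)"
  let ?T = "\<lambda>K J e. delta0 m (bar0 K J e m) * schur_Q (quotient0 (bar0 K J e m)) s * schur (quotient1 (bar0 K J e m)) t"
  let ?c = "(- 1) ^ ((\<Sum>i\<leftarrow>down m. i + 1 + m) + (m + 1)) :: 'a"
  define X where "X K J = (\<Prod>i\<in>K. (- 1) ^ Suc i) * pf_list (Q_sign s) (select J ?xs) *
    rows_det (in_pairs p q (select K ?xs) @ map q (select J ?xs))" for K J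
  have odd_n: "odd n" using n by presburger
  have xs: "distinct ?xs" "set ?xs = {..m}" by auto
  let ?P = "{(K, J). K \<subseteq> set ?xs \<and> J \<subseteq> set ?xs \<and> K \<inter> J = {} \<and> 2 * card K + card J = 2 * r}"
  let ?R = "{(K, J, e). K \<subseteq> {1..m} \<and> J \<subseteq> {1..m} \<and> K \<inter> J = {} \<and> 2 * card K + card J + of_bool e = n}"
  let ?K = "\<lambda>K e. if e then insert 0 K else K :: nat set"
  let ?J = "\<lambda>J e. if e then J else insert 0 J :: nat set"
  have select0: "select (?K K e) ?xs = select K (down m) @ (if e then [0] else [])"
    "select (?J J e) ?xs = select J (down m) @ (if e then [] else [0])"
    if "J \<subseteq> {1..m}" "K \<subseteq> {1..m}" for J K e
  proof -
    have "select (insert 0 A) (down m) = select A (down m)" for A unfolding select_def by (rule filter_cong) auto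
    then show "select (?K K e) ?xs = select K (down m) @ (if e then [0] else [])"
      "select (?J J e) ?xs = select J (down m) @ (if e then [] else [0])"
      using that by auto
  qed
  have "pfaffian r (skew_matrix m n (twist s t))
    = pfaffian r (\<lambda>c d. ?B c d)"
  proof (rule pfaffian_cong)
    fix c d assume cd: "c < 2 * r" "d < 2 * r"
    let ?col = "\<lambda>c. int c + 1 - (int n - int m)"
    have border: "?B c n = h_fun (twist s t) (?col c)" if c: "c < n" for c
    proof -
      have le: "?col c \<le> int m" using c by auto
      have 1: "(\<Sum>i\<in>set ?xs. (- 1) ^ Suc i * (p i c * q i n - q i c * p i n)) = h_fun t (?col c)"
      proof -
        have "(\<Sum>i\<in>set ?xs. (- 1) ^ Suc i * (p i c * q i n - q i c * p i n)) = (\<Sum>i\<le>m. if i = 0 then rw 0 c else 0)"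
          unfolding xs(2) using c by (intro sum.cong refl) (auto simp: p_def q_def)
        then show ?thesis by (simp add: rw_def schur_row_def)
      qed
      have 2: "(\<Sum>a\<in>set ?xs. \<Sum>b\<in>set ?xs. Q_sign s a b * q a c * q b n)
        = (\<Sum>a\<le>m. (- 1) ^ a * (if a = 0 then 0 else q_fun s a) * h_fun t (?col c - int a))"
        unfolding xs(2)
      proof (intro sum.cong refl)
        fix a
        have "(\<Sum>b\<le>m. Q_sign s a b * q a c * q b n) = (\<Sum>b\<le>m. if b = 0 then - (Q_sign s a 0 * q a c) else 0)"
          by (intro sum.cong refl) (auto simp: q_def)
        also have "\<dots> = - (Q_sign s a 0 * q a c)" by simp
        also have "\<dots> = (- 1) ^ a * (if a = 0 then 0 else q_fun s a) * h_fun t (?col c - int a)"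
          using c by (simp add: Q_sign_def Q2_0_right q_def rw_def schur_row_def algebra_simps)
        finally show "(\<Sum>b\<le>m. Q_sign s a b * q a c * q b n)
          = (- 1) ^ a * (if a = 0 then 0 else q_fun s a) * h_fun t (?col c - int a)" .
      qed
      have "h_fun t (?col c) + (\<Sum>a\<le>m. (- 1) ^ a * (if a = 0 then 0 else q_fun s a) * h_fun t (?col c - int a))
        = (\<Sum>a\<le>m. if a = 0 then h_fun t (?col c) else 0)
          + (\<Sum>a\<le>m. (- 1) ^ a * (if a = 0 then 0 else q_fun s a) * h_fun t (?col c - int a))" by simp
      also have "\<dots> = (\<Sum>a\<le>m. (- 1) ^ a * q_fun s a * h_fun t (?col c - int a))"
        unfolding sum.distrib[symmetric] by (intro sum.cong refl) (auto simp: q_fun_0)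
      finally show ?thesis unfolding 1 2 h_fun_twist[OF le, of s t] .
    qed
    have anti: "?B d c = - ?B c d" for c d
    proof -
      have 1: "(\<Sum>i\<in>set ?xs. (- 1) ^ Suc i * (p i d * q i c - q i d * p i c))
        = - (\<Sum>i\<in>set ?xs. (- 1) ^ Suc i * (p i c * q i d - q i c * p i d))"
        unfolding sum_negf[symmetric] by (intro sum.cong refl) (simp add: algebra_simps)
      have "(\<Sum>a\<in>set ?xs. \<Sum>b\<in>set ?xs. Q_sign s a b * q a d * q b c) = (\<Sum>b\<in>set ?xs. \<Sum>a\<in>set ?xs. Q_sign s a b * q a d * q b c)"
        by (rule sum.swap)
      also have "\<dots> = - (\<Sum>a\<in>set ?xs. \<Sum>b\<in>set ?xs. Q_sign s a b * q a c * q b d)"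
        unfolding sum_negf[symmetric]
      proof (intro sum.cong refl)
        fix a b show "Q_sign s b a * q b d * q a c = - (Q_sign s a b * q a c * q b d)"
          unfolding Q_sign_anti[of s b a] by (simp add: mult_ac)
      qed
      finally show ?thesis unfolding 1 by (simp only: minus_add_distrib)
    qed
    have inner: "?B c d = skew_form m (h_fun (twist s t)) (?col c) (?col d)" if cd: "c < n" "d < n"
    proof -
      have le: "?col c \<le> int m" "?col d \<le> int m" using cd by auto
      have "?B c d = skew_form m (h_fun t) (?col c) (?col d) - Q_form m (Q2 s) (h_fun t) (?col c) (?col d)"
        unfolding xs(2) skew_form_def Q_form_def Q_sign_def diff_conv_add_uminus sum_negf[symmetric]
        using cd
        by (intro arg_cong2[where f = "(+)"] sum.cong refl)
          (simp_all add: p_def q_def rw_def schur_row_def power_add algebra_simps)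
      then show ?thesis unfolding skew_form_twist[OF le] .
    qed
    consider "c < n" "d < n" | "c < n" "d = n" | "c = n" "d < n" | "c = n" "d = n" using cd n by linarith
    then show "skew_matrix m n (twist s t) c d = ?B c d"
    proof cases
      case 1
      then show ?thesis unfolding inner[OF 1] by (simp add: skew_matrix_def)
    next
      case 2
      then show ?thesis using border[OF 2(1)] by (simp add: skew_matrix_def)
    next
      case 3
      then show ?thesis using border[OF 3(2)] anti[of n d] by (simp add: skew_matrix_def)
    next
      case 4
      have z: "x = 0" if "x = - x" for x :: 'a
      proof -
        have "2 * x = x + x" by simp
        also have "\<dots> = 0" using that by (simp only: add_eq_0_iff)
        finally show ?thesis by simp
      qed
      have "skew_matrix m n (twist s t) n n = 0" by (simp add: skew_matrix_def)
      also have "0 = ?B n n" by (rule z[OF anti, symmetric])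
      finally show ?thesis unfolding 4 .
    qed
  qed
  also have "\<dots> = (\<Sum>(K, J)\<in>?P. X K J)"
    unfolding X_def by (rule sum_pairs_singles[OF Q_sign_anti xs(1), symmetric])
  also have "\<dots> = (\<Sum>(K, J)\<in>{x\<in>?P. 0 \<in> fst x \<union> snd x}. X K J)"
  proof (rule sum.mono_neutral_right)
    have "?P \<subseteq> Pow (set ?xs) \<times> Pow (set ?xs)" by auto
    then show "finite ?P" by (rule finite_subset) simp
    show "\<forall>x\<in>?P - {x\<in>?P. 0 \<in> fst x \<union> snd x}. (case x of (K, J) \<Rightarrow> X K J) = 0"
    proof
      fix x assume x: "x \<in> ?P - {x\<in>?P. 0 \<in> fst x \<union> snd x}"
      obtain K J where [simp]: "x = (K, J)" by (rule prod.exhaust)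
      have s: "0 \<notin> K" "0 \<notin> J" "K \<subseteq> set ?xs" "J \<subseteq> set ?xs" "2 * card K + card J = 2 * r" using x by auto
      let ?vs = "in_pairs p q (select K ?xs) @ map q (select J ?xs)"
      have len: "length ?vs = Suc n" using s xs(1) n by (simp only: length_append length_map in_pairs_simps(4) length_select)
      have "\<forall>v\<in>set ?vs. v n = 0"
        using s(1,2) by (auto simp: p_def q_def split: if_splits)
      from rows_det_zero_last_column[OF len this] have "rows_det ?vs = 0" .
      then show "(case x of (K, J) \<Rightarrow> X K J) = 0" unfolding X_def by simp
    qed
  qed auto
  also have "\<dots> = (\<Sum>(K, J, e)\<in>?R. X (?K K e) (?J J e))"
  proof (rule sum.reindex_bij_witness[where i = "\<lambda>(K, J, e). (?K K e, ?J J e)" and j = "\<lambda>(K, J). (K - {0}, J - {0}, 0 \<in> K)"],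
      goal_cases)
    case (1 x)
    obtain K J where x: "x = (K, J)" by (rule prod.exhaust)
    have "0 \<in> J \<longleftrightarrow> 0 \<notin> K" using 1 x by auto
    then show ?case unfolding x by (cases "0 \<in> K") (simp_all add: insert_absorb)
  next
    case (2 x)
    obtain K J where x: "x = (K, J)" by (rule prod.exhaust)
    have s: "K \<subseteq> {..m}" "J \<subseteq> {..m}" "K \<inter> J = {}" "2 * card K + card J = Suc n" "0 \<in> K \<union> J"
      using 2 x xs n by auto
    then have f: "finite K" "finite J" by (auto intro: finite_subset)
    have A: "A - {0} \<subseteq> {1..m}" if "A \<subseteq> {..m}" for A using that by (auto simp: Suc_le_eq)
    have c: "card A = card (A - {0}) + of_bool (0 \<in> A)" if "finite A" for A :: "nat set"
      using card.remove[OF that, of 0] by (cases "0 \<in> A") simp_all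
    have "of_bool (0 \<in> J) + of_bool (0 \<in> K) = (1 :: nat)" using s(3,5) by auto
    then have "2 * card (K - {0}) + card (J - {0}) + of_bool (0 \<in> K) = n"
      using s(4) c[OF f(1)] c[OF f(2)] by linarith
    moreover have "(K - {0}) \<inter> (J - {0}) = {}" using s by auto
    ultimately show ?case unfolding x prod.case mem_Collect_eq using A[OF s(1)] A[OF s(2)] by (intro conjI)
  next
    case (3 x)
    obtain K J e where x: "x = (K, J, e)" by (metis prod_cases3)
    have "0 \<notin> J" "0 \<notin> K" using 3 x by auto
    then show ?case unfolding x by (cases e) auto
  next
    case (4 x)
    obtain K J e where x: "x = (K, J, e)" by (metis prod_cases3)
    have s: "0 \<notin> K" "0 \<notin> J" "finite K" "finite J" "K \<subseteq> {..m}" "J \<subseteq> {..m}" "K \<inter> J = {}" "2 * card K + card J + of_bool e = n"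
      using 4 x by (auto intro: finite_subset)
    then have "2 * card (?K K e) + card (?J J e) = 2 * r" "?K K e \<inter> ?J J e = {}"
      "?K K e \<subseteq> {..m}" "?J J e \<subseteq> {..m}" "0 \<in> ?K K e \<union> ?J J e"
      using n by (cases e; simp)+
    then show ?case unfolding x prod.case mem_Collect_eq fst_conv snd_conv xs(2) by (intro conjI)
  next
    case (5 x)
    obtain K J where x: "x = (K, J)" by (rule prod.exhaust)
    have "0 \<in> J \<longleftrightarrow> 0 \<notin> K" using 5 x by auto
    then show ?case unfolding x by (cases "0 \<in> K") (simp_all add: insert_absorb)
  qed
  finally have pf: "pfaffian r (skew_matrix m n (twist s t)) = (\<Sum>(K, J, e)\<in>?R. X (?K K e) (?J J e))" .
  have "(\<Sum>\<mu>\<in>I_set 0 n (- int m). delta0 m \<mu> * schur_Q (quotient0 \<mu>) s * schur (quotient1 \<mu>) t)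
    = (\<Sum>(K, J, e)\<in>?R. ?c * X (?K K e) (?J J e))"
    unfolding sum_I_set_0
  proof (rule sum.cong[OF refl])
    fix x assume "x \<in> ?R"
    moreover obtain K J e where x: "x = (K, J, e)" by (metis prod_cases3)
    ultimately have K: "K \<subseteq> {1..m}" "J \<subseteq> {1..m}" "K \<inter> J = {}" and c: "2 * card K + card J + of_bool e = n" by auto
    have len: "length (select K (down m)) = card K" "length (select J (down m)) = card J" using K by (simp_all add: length_select)
    have "odd (2 * card K + card J + of_bool e)" using c odd_n by simp
    then have "odd (length (select J (down m))) \<longleftrightarrow> \<not> e" using len by (cases e) simp_all
    then have pad: "pad_even (select J (down m)) = select J (down m) @ (if e then [] else [0])"
      by (simp add: pad_even_def)
    have K0: "0 \<notin> K" "finite K" using K by (auto intro: finite_subset)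
    have pr: "(\<Prod>i\<in>?K K e. (- 1 :: 'a) ^ Suc i) = (if e then - 1 else 1) * (\<Prod>i\<in>K. (- 1) ^ Suc i)"
      using K0 by simp
    let ?vs = "in_pairs p q (select K (down m)) @ map q (select J (down m)) @ (if e then [p 0] else [])"
    let ?ws = "in_pairs (\<lambda>i. rw (int i)) (\<lambda>i. rw (- int i)) (select K (down m))
          @ map (\<lambda>i. rw (- int i)) (select J (down m)) @ (if e then [rw 0] else [])"
    have lv: "length ?vs = n" using len c by (cases e) simp_all
    have "rows_det (in_pairs p q (select (?K K e) ?xs) @ map q (select (?J J e) ?xs)) = rows_det (?vs @ [q 0])"
    proof (cases e)
      case True
      have "rows_det (in_pairs p q (select K (down m)) @ p 0 # q 0 # map q (select J (down m)))
        = (- 1) ^ length (select J (down m)) * rows_det ((in_pairs p q (select K (down m)) @ [p 0]) @ map q (select J (down m)) @ [q 0])"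
        using rows_det_move[of "in_pairs p q (select K (down m)) @ [p 0]" "q 0" "map q (select J (down m))" "[]"] by simp
      also have "rows_det ((in_pairs p q (select K (down m)) @ [p 0]) @ map q (select J (down m)) @ [q 0])
        = (- 1) ^ length (select J (down m)) * rows_det (in_pairs p q (select K (down m)) @ map q (select J (down m)) @ [p 0, q 0])"
        using rows_det_move[of "in_pairs p q (select K (down m))" "p 0" "map q (select J (down m))" "[q 0]"] by simp
      finally have "rows_det (in_pairs p q (select K (down m)) @ p 0 # q 0 # map q (select J (down m)))
        = rows_det (in_pairs p q (select K (down m)) @ map q (select J (down m)) @ [p 0, q 0])"
        by (simp add: power_mult_distrib[symmetric] mult.assoc[symmetric])
      moreover have "in_pairs p q (select K (down m) @ [0]) = in_pairs p q (select K (down m)) @ [p 0, q 0]"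
        by (simp add: in_pairs_def)
      ultimately show ?thesis unfolding select0[OF K(2,1)] using True by simp
    next
      case False
      then show ?thesis unfolding select0[OF K(2,1)] by simp
    qed
    also have "\<dots> = rows_det ?vs * q 0 (length ?vs)"
    proof (rule rows_det_append_last, rule disjI1, rule ballI)
      fix v assume "v \<in> set ?vs"
      moreover have "0 \<notin> set (select K (down m))" "0 \<notin> set (select J (down m))" by auto
      ultimately show "v (length ?vs) = 0" unfolding lv by (auto simp: p_def q_def split: if_splits)
    qed
    also have "q 0 (length ?vs) = - 1" unfolding lv by (simp add: q_def)
    also have "rows_det ?vs = rows_det ?ws"
    proof (rule rows_det_cong)
      show len_eq: "length ?vs = length ?ws" by simp
      fix c assume "c < length ?ws"
      then have "c < n" unfolding len_eq[symmetric] lv .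
      then show "map (\<lambda>v. v c) ?vs = map (\<lambda>v. v c) ?ws"
        by (simp add: comp_def p_def q_def)
    qed
    finally have det: "rows_det (in_pairs p q (select (?K K e) ?xs) @ map q (select (?J J e) ?xs)) = rows_det ?ws * - 1" .
    have "?T K J e
      = ?c * X (?K K e) (?J J e)"
      unfolding signed_term_bar0[OF K c] X_def det pr
      unfolding select0(2)[OF K(2,1)] pad rw_def[symmetric]
      using odd_n by (cases e) simp_all
    then show "(case x of (K, J, e) \<Rightarrow> ?T K J e)
      = (case x of (K, J, e) \<Rightarrow> ?c * X (?K K e) (?J J e))" unfolding x by simp
  qed
  also have "\<dots> = ?c * (\<Sum>(K, J, e)\<in>?R. X (?K K e) (?J J e))"
    by (simp add: sum_distrib_left case_prod_unfold)
  finally show ?thesis unfolding pf .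
qed

text \<open>
  The left hand side depends on \<open>s\<close> and \<open>t\<close> only through \<open>u\<close>,
  so it does not change when \<open>(s, t)\<close> is replaced by \<open>(0, u)\<close>. For
  \<open>s = 0\<close> every \<open>Q\<close>-function of a nonempty partition vanishes.
\<close>

theorem sum_color_0:
  fixes t s :: "nat \<Rightarrow> 'a::field_char_0"
  shows "(\<Sum>\<mu> \<in> I_set 0 n (- int m).
          delta0 m \<mu> * schur_Q (quotient0 \<mu>) s * schur (quotient1 \<mu>) t)
       = (\<Sum>\<mu> | \<mu> \<in> I_set 0 n (- int m) \<and> quotient0 \<mu> = [].
          delta0 m \<mu> * schur (quotient1 \<mu>) (twist s t))"
proof -
  let ?F = "\<lambda>s t. \<Sum>\<mu> \<in> I_set 0 n (- int m). delta0 m \<mu> * schur_Q (quotient0 \<mu>) s * schur (quotient1 \<mu>) t"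
  have tw: "twist (\<lambda>_. 0) (twist s t) = twist s t" by (auto simp: twist_def fun_eq_iff)
  have "?F s t = ?F (\<lambda>_. 0) (twist s t)"
  proof (cases "even n")
    case True
    then obtain r where "n = 2 * r" by (rule evenE)
    then show ?thesis by (simp only: sum_I_set_0_even tw)
  next
    case False
    then obtain r where "Suc n = 2 * r" by (metis even_Suc evenE)
    then show ?thesis by (simp only: sum_I_set_0_odd tw)
  qed
  also have "\<dots> = (\<Sum>\<mu> | \<mu> \<in> I_set 0 n (- int m) \<and> quotient0 \<mu> = [].
      delta0 m \<mu> * schur (quotient1 \<mu>) (twist s t))"
    by (rule sum.mono_neutral_cong_right) (auto simp: finite_I_set schur_Q_zero)
  finally show ?thesis .
qed

theorem theorem3p1:
  fixes t s :: "nat \<Rightarrow> 'a::field_char_0" and m n :: nat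
  shows
    "(n \<le> m \<longrightarrow>
        (\<Sum>\<mu> \<in> I_set 1 n (int m). delta1 n \<mu> * schur (quotient1 \<mu>) t)
          = schur (rectangle (m - n) n) (\<lambda>j. 2 * t (2 * j))) \<and>
     (\<Sum>\<mu> \<in> I_set 0 n (- int m).
          delta0 m \<mu> * schur_Q (quotient0 \<mu>) s * schur (quotient1 \<mu>) t)
       = (\<Sum>\<mu> | \<mu> \<in> I_set 0 n (- int m) \<and> quotient0 \<mu> = [].
          delta0 m \<mu> * schur (quotient1 \<mu>) (\<lambda>j. if even j then t j else t j - s j))"
  using sum_color_1[of n m t] sum_color_0[of m s t n] unfolding twist_def by simp

end
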